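(* Let $N,\ell\in\mathbb{N}^*$ be such that $\ell\le N$, let $U_0\in H^N(\mathbb{R})\cap L^1(\mathbb{R})$ (componentwise), and let $U=(v,u,z,y,\phi,\theta,\eta)^T$ be the solution of the Cauchy problem $$\begin{cases} v_t-u_x-y-\theta=0,\\ u_t-k_1v_x=0,\\ z_t-y_x=0,\\ y_t-k_2z_x+k_1v=0,\\ \phi_t-\theta_x=0,\\ \theta_t-k_3\phi_x+k_1v+\gamma\eta_x=0,\\ \eta_t-k_4\eta_{xx}+\gamma\theta_x=0,\end{cases}\qquad x\in\mathbb{R},\ t>0,\qquad U(\cdot,0)=U_0 .$$ Then, for any $j\in\{0,\dots,N-\ell\}$, there exist $c_0,\tilde c_0>0$ such that, for any $t\in\mathbb{R}_+$: if $k_1=k_2=k_3$, $$\|\partial_x^jU(\cdot,t)\|_{L^2(\mathbb{R})}\le c_0(1+t)^{-1/8-j/4}\|U_0\|_{L^1(\mathbb{R})}+c_0e^{-\tilde c_0t}\|\partial_x^{j+\ell}U_0\|_{L^2(\mathbb{R})},$$ and if $k_1=k_2=k_3$ does not hold, $$\|\partial_x^jU(\cdot,t)\|_{L^2(\mathbb{R})}\le c_0(1+t)^{-1/8-j/4}\|U_0\|_{L^1(\mathbb{R})}+c_0(1+t)^{-\ell/4}\|\partial_x^{j+\ell}U_0\|_{L^2(\mathbb{R})}.$$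
   Context: $k_1,k_2,k_3,k_4,\gamma>0$ are constants; $\mathbb{N}^*$ is the set of positive integers and $\mathbb{R}_+=[0,\infty)$. The system is the first-order form (with $u=\varphi_t$, $y=\psi_t$, $\theta=w_t$, $v=\varphi_x+\psi+w$, $z=\psi_x$, $\phi=w_x$) of the laminated Timoshenko system with interfacial slip coupled to Fourier heat conduction acting through the third (slip) equation. The solution $U$ is the one whose Fourier transform in $x$, $\widehat U(\xi,t)$, solves for each $\xi\in\mathbb{R}$ the linear ODE system obtained by replacing $\partial_x$ by $i\xi$, with initial value $\widehat U_0(\xi)$. Norms of vector-valued functions are the usual ones. *)

theory Defs
  imports "HOL-Analysis.Analysis"
begin

text \<open>
  Functions on the line are represented by Borel measurable functions, and every integral is taken
  with respect to Lebesgue measure \<^term>\<open>lborel\<close>. States are vectors in \<^typ>\<open>complex^7\<close> with the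
  Euclidean norm; real-valued data are the special case in which all components are real.
\<close>

definition in_L1 :: "(real \<Rightarrow> 'a::euclidean_space) \<Rightarrow> bool" where
  "in_L1 f \<longleftrightarrow> integrable lborel f"

definition L1_norm :: "(real \<Rightarrow> 'a::euclidean_space) \<Rightarrow> real" where
  "L1_norm f = (LINT x|lborel. norm (f x))"

definition in_L2 :: "(real \<Rightarrow> 'a::euclidean_space) \<Rightarrow> bool" where
  "in_L2 f \<longleftrightarrow> f \<in> borel_measurable lborel \<and> integrable lborel (\<lambda>x. (norm (f x))\<^sup>2)"

definition L2_norm :: "(real \<Rightarrow> 'a::euclidean_space) \<Rightarrow> real" where
  "L2_norm f = sqrt (LINT x|lborel. (norm (f x))\<^sup>2)"

definition test_function :: "(real \<Rightarrow> real) \<Rightarrow> bool" where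
  "test_function \<psi> \<longleftrightarrow>
     (\<forall>n x. (deriv ^^ n) \<psi> differentiable (at x)) \<and> compact (closure {x. \<psi> x \<noteq> 0})"

text \<open>\<open>g\<close> in \<open>L\<^sup>2\<close> is the \<open>n\<close>-th derivative, in the sense of distributions, of \<open>f\<close> in \<open>L\<^sup>2\<close>.\<close>

definition has_weak_deriv ::
    "nat \<Rightarrow> (real \<Rightarrow> 'a::euclidean_space) \<Rightarrow> (real \<Rightarrow> 'a) \<Rightarrow> bool" where
  "has_weak_deriv n f g \<longleftrightarrow> in_L2 f \<and> in_L2 g \<and>
     (\<forall>\<psi>. test_function \<psi> \<longrightarrow>
        (LINT x|lborel. (deriv ^^ n) \<psi> x *\<^sub>R f x) = (-1) ^ n *\<^sub>R (LINT x|lborel. \<psi> x *\<^sub>R g x))"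

text \<open>The weak derivative is unique up to null sets, so its norm does not depend on the choice;
  the value is meaningful only if a weak derivative in \<open>L\<^sup>2\<close> exists.\<close>

definition weak_deriv :: "nat \<Rightarrow> (real \<Rightarrow> 'a::euclidean_space) \<Rightarrow> real \<Rightarrow> 'a" where
  "weak_deriv n f = (SOME g. has_weak_deriv n f g)"

definition in_Sobolev :: "nat \<Rightarrow> (real \<Rightarrow> 'a::euclidean_space) \<Rightarrow> bool" where
  "in_Sobolev N f \<longleftrightarrow> (\<forall>n\<le>N. \<exists>g. has_weak_deriv n f g)"

definition fourier :: "(real \<Rightarrow> complex ^ 'n::finite) \<Rightarrow> real \<Rightarrow> complex ^ 'n" where
  "fourier f \<xi> = (\<chi> i. LINT x|lborel. cis (- (\<xi> * x)) * f x $ i)"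

text \<open>A function in \<open>L\<^sup>2\<close> need not be integrable; its (Plancherel) Fourier transform is the limit in
  \<open>L\<^sup>2\<close> of the transforms of its truncations to \<open>[-R, R]\<close>. The extended integral is used so that
  convergence to \<open>0\<close> cannot hold through a failure of integrability.\<close>

definition has_L2_fourier ::
    "(real \<Rightarrow> complex ^ 'n::finite) \<Rightarrow> (real \<Rightarrow> complex ^ 'n) \<Rightarrow> bool" where
  "has_L2_fourier f g \<longleftrightarrow> in_L2 f \<and> in_L2 g \<and>
     ((\<lambda>R. \<integral>\<^sup>+ \<xi>. ennreal ((norm (fourier (\<lambda>x. indicator {-R..R} x *\<^sub>R f x) \<xi> - g \<xi>))\<^sup>2) \<partial>lborel)
        \<longlongrightarrow> 0) at_top"

text \<open>The components of the state are \<open>1 = v\<close>, \<open>2 = u\<close>, \<open>3 = z\<close>, \<open>4 = y\<close>, \<open>5 = \<phi>\<close>, \<open>6 = \<theta>\<close>,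
  \<open>7 = \<eta>\<close>. With \<open>D = \<i>\<xi>\<close> in place of the derivative in \<open>x\<close>, this is the transformed system at the
  frequency \<open>\<xi>\<close>; at \<open>t = 0\<close> the time derivative is one-sided.\<close>

definition laminated_ode ::
    "real \<Rightarrow> real \<Rightarrow> real \<Rightarrow> real \<Rightarrow> real \<Rightarrow> real \<Rightarrow> (real \<Rightarrow> complex ^ 7) \<Rightarrow> bool" where
  "laminated_ode k1 k2 k3 k4 \<gamma> \<xi> W \<longleftrightarrow>
     (let D = \<i> * of_real \<xi>;
          v = (\<lambda>t. W t $ 1); u = (\<lambda>t. W t $ 2); z = (\<lambda>t. W t $ 3); y = (\<lambda>t. W t $ 4);
          \<phi> = (\<lambda>t. W t $ 5); \<theta> = (\<lambda>t. W t $ 6); \<eta> = (\<lambda>t. W t $ 7)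
      in \<forall>t\<ge>0.
        (v has_vector_derivative D * u t + y t + \<theta> t) (at t within {0..}) \<and>
        (u has_vector_derivative of_real k1 * (D * v t)) (at t within {0..}) \<and>
        (z has_vector_derivative D * y t) (at t within {0..}) \<and>
        (y has_vector_derivative of_real k2 * (D * z t) - of_real k1 * v t) (at t within {0..}) \<and>
        (\<phi> has_vector_derivative D * \<theta> t) (at t within {0..}) \<and>
        (\<theta> has_vector_derivative
            of_real k3 * (D * \<phi> t) - of_real k1 * v t - of_real \<gamma> * (D * \<eta> t)) (at t within {0..}) \<and>
        (\<eta> has_vector_derivative
            of_real k4 * (D\<^sup>2 * \<eta> t) - of_real \<gamma> * (D * \<theta> t)) (at t within {0..}))"

text \<open>\<open>U t x\<close> is the state at time \<open>t\<close> and position \<open>x\<close>. The initial datum \<open>U0\<close> is meant to be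
  integrable, so that its transform is defined at every frequency.\<close>

definition laminated_solution ::
    "real \<Rightarrow> real \<Rightarrow> real \<Rightarrow> real \<Rightarrow> real \<Rightarrow> (real \<Rightarrow> complex ^ 7) \<Rightarrow> (real \<Rightarrow> real \<Rightarrow> complex ^ 7) \<Rightarrow> bool"
  where
  "laminated_solution k1 k2 k3 k4 \<gamma> U0 U \<longleftrightarrow>
     (\<exists>W. (\<forall>\<xi>. laminated_ode k1 k2 k3 k4 \<gamma> \<xi> (W \<xi>) \<and> W \<xi> 0 = fourier U0 \<xi>) \<and>
          (\<forall>t\<ge>0. has_L2_fourier (U t) (\<lambda>\<xi>. W \<xi> t)))"

end

theory Submission
  imports Defs "HOL-Probability.Probability"
begin

text \<open>
  The proof estimates the transformed system frequency by frequency. Its energy is dissipated only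
  through \<open>\<eta>\<close>, at the rate \<open>\<xi>\<^sup>2 |\<eta>|\<^sup>2\<close>, and the coupling terms carry this dissipation over to the other
  components one after the other: to \<open>\<theta>\<close>, then \<open>v\<close>, and from there on. Each transfer costs powers of
  \<open>\<xi>\<close>, and the worst loss is \<open>\<xi>\<^sup>4\<close> for \<open>|\<xi>| \<le> 1\<close> and \<open>\<xi>\<^sup>-\<^sup>4\<close> for \<open>|\<xi>| \<ge> 1\<close>. When \<open>k\<^sub>1 = k\<^sub>2 = k\<^sub>3\<close>, the
  terms of highest order in the functionals that reach \<open>v\<close> and \<open>y\<close> cancel, and there is no loss for
  \<open>|\<xi>| \<ge> 1\<close>. The two regimes give the two terms of the estimate: the low frequencies
  are bounded by the norm of \<open>U\<^sub>0\<close> in \<open>L\<^sup>1\<close>, the high ones by \<open>l\<close> further derivatives of \<open>U\<^sub>0\<close>. Of Plancherel's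
  theorem only the inequality for integrable functions is needed; Gaussian regularisation yields it.
\<close>

section \<open>Lyapunov functionals for the transformed system\<close>

text \<open>The dissipation \<open>D\<close> aimed at is fixed beforehand, and each transfer may
  draw on all of it, though only with an arbitrarily small factor; the circle closes with
  \<open>controls R D D\<close>, where half of \<open>D\<close> survives. The weight in a functional
  is then dictated by its worst error term. The critical component for small \<open>\<xi>\<close> is
  \<open>u\<close>: from \<open>y\<close> and \<open>y - \<xi> u\<close> it comes out with weight
  \<open>\<xi>^3\<close>, which would give only the rate \<open>\<xi>^6\<close>. Quantities whose
  derivatives are of second order in \<open>\<xi>\<close>, such as
  \<open>2 u + \<xi> (y + \<theta>)\<close> and \<open>z + \<phi> - \<xi> v\<close>, recover the
  lost power. Unequal constants are felt through the terms \<open>(k3 - k1) \<xi> u \<theta>\<close>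
  and \<open>(k1 - k2) \<xi> u y\<close>, which for large \<open>\<xi>\<close> are damped by
  negative powers of \<open>\<xi>\<close>. As to time, rescaling \<open>\<xi>\<close> in the
  integral of \<open>\<xi>^(2 j) exp (- c \<xi>^4 t)\<close> yields
  \<open>t^(-(2 j + 1) / 4)\<close>, and for large \<open>\<xi>\<close> the factor
  \<open>exp (- c t / \<xi>^4)\<close> is at most a constant times
  \<open>(1 + t)^(- l / 2) \<xi>^(2 l)\<close>; square roots give the exponents of the
  theorem.\<close>

locale laminated =
  fixes k1 k2 k3 k4 \<gamma> :: real
  assumes pos: "k1 > 0" "k2 > 0" "k3 > 0" "k4 > 0" "\<gamma> > 0"
begin

text \<open>Multiplying \<open>u\<close>, \<open>z\<close>, \<open>\<phi>\<close> and \<open>\<eta>\<close> by \<open>- \<i>\<close> turns the transformed system into one with real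
  coefficients, so that real and imaginary parts can be treated separately.\<close>

definition real_solution :: "real \<Rightarrow> (real \<Rightarrow> real^7) \<Rightarrow> bool" where
  "real_solution \<xi> x \<longleftrightarrow> (\<forall>t\<ge>0.
     ((\<lambda>t. x t $ 1) has_real_derivative - \<xi> * x t $ 2 + x t $ 4 + x t $ 6) (at t within {0..}) \<and>
     ((\<lambda>t. x t $ 2) has_real_derivative k1 * \<xi> * x t $ 1) (at t within {0..}) \<and>
     ((\<lambda>t. x t $ 3) has_real_derivative \<xi> * x t $ 4) (at t within {0..}) \<and>
     ((\<lambda>t. x t $ 4) has_real_derivative - k2 * \<xi> * x t $ 3 - k1 * x t $ 1) (at t within {0..}) \<and>
     ((\<lambda>t. x t $ 5) has_real_derivative \<xi> * x t $ 6) (at t within {0..}) \<and>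
     ((\<lambda>t. x t $ 6) has_real_derivative
        - k3 * \<xi> * x t $ 5 - k1 * x t $ 1 + \<gamma> * \<xi> * x t $ 7) (at t within {0..}) \<and>
     ((\<lambda>t. x t $ 7) has_real_derivative - k4 * \<xi>\<^sup>2 * x t $ 7 - \<gamma> * \<xi> * x t $ 6) (at t within {0..}))"

lemma real_solutionD:
  assumes "real_solution \<xi> x" "t \<ge> 0"
  shows "((\<lambda>t. x t $ 1) has_real_derivative - \<xi> * x t $ 2 + x t $ 4 + x t $ 6) (at t within {0..})"
    and "((\<lambda>t. x t $ 2) has_real_derivative k1 * \<xi> * x t $ 1) (at t within {0..})"
    and "((\<lambda>t. x t $ 3) has_real_derivative \<xi> * x t $ 4) (at t within {0..})"
    and "((\<lambda>t. x t $ 4) has_real_derivative - k2 * \<xi> * x t $ 3 - k1 * x t $ 1) (at t within {0..})"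
    and "((\<lambda>t. x t $ 5) has_real_derivative \<xi> * x t $ 6) (at t within {0..})"
    and "((\<lambda>t. x t $ 6) has_real_derivative
        - k3 * \<xi> * x t $ 5 - k1 * x t $ 1 + \<gamma> * \<xi> * x t $ 7) (at t within {0..})"
    and "((\<lambda>t. x t $ 7) has_real_derivative - k4 * \<xi>\<^sup>2 * x t $ 7 - \<gamma> * \<xi> * x t $ 6) (at t within {0..})"
  using assms unfolding real_solution_def by blast+

text \<open>The derivative is again a function of frequency and state, so that differential
  inequalities along solutions become pointwise inequalities in \<open>X\<close>.\<close>

definition flow_derivative ::
    "real set \<Rightarrow> (real \<Rightarrow> real^7 \<Rightarrow> real) \<Rightarrow> (real \<Rightarrow> real^7 \<Rightarrow> real) \<Rightarrow> bool" where
  "flow_derivative R G G' \<longleftrightarrow> (\<forall>\<xi>\<in>R. \<forall>x. real_solution \<xi> x \<longrightarrow>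
     (\<forall>t\<ge>0. ((\<lambda>t. G \<xi> (x t)) has_real_derivative G' \<xi> (x t)) (at t within {0..})))"

text \<open>Integrated along a solution, this bounds the time integral of \<open>S\<close> by
  \<open>\<mu>\<close> times that of \<open>D\<close> plus boundary values of \<open>G\<close>. The
  constant \<open>C\<close> may depend on \<open>\<mu>\<close> but not on the frequency.\<close>

definition controls ::
    "real set \<Rightarrow> (real \<Rightarrow> real^7 \<Rightarrow> real) \<Rightarrow> (real \<Rightarrow> real^7 \<Rightarrow> real) \<Rightarrow> bool" where
  "controls R D S \<longleftrightarrow> (\<forall>\<mu>>0. \<exists>C\<ge>0. \<exists>G G'. flow_derivative R G G' \<and>
     (\<forall>\<xi>\<in>R. \<forall>X. \<bar>G \<xi> X\<bar> \<le> C * (norm X)\<^sup>2 \<and> G' \<xi> X \<le> \<mu> * D \<xi> X - S \<xi> X))"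

definition bounded_by ::
    "real set \<Rightarrow> (real \<Rightarrow> real^7 \<Rightarrow> real) \<Rightarrow> (real \<Rightarrow> real^7 \<Rightarrow> real) \<Rightarrow> bool" where
  "bounded_by R D T \<longleftrightarrow> (\<exists>C>0. \<forall>\<xi>\<in>R. \<forall>X. T \<xi> X \<le> C * D \<xi> X)"

definition form_bounded :: "real set \<Rightarrow> (real \<Rightarrow> real^7 \<Rightarrow> real) \<Rightarrow> bool" where
  "form_bounded R F \<longleftrightarrow> (\<exists>C\<ge>0. \<forall>\<xi>\<in>R. \<forall>X. \<bar>F \<xi> X\<bar> \<le> C * (norm X)\<^sup>2)"

lemma flow_derivativeI:
  assumes "\<And>\<xi> x t. \<xi> \<in> R \<Longrightarrow> real_solution \<xi> x \<Longrightarrow> 0 \<le> t \<Longrightarrow>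
     ((\<lambda>t. F \<xi> (x t)) has_real_derivative F' \<xi> (x t)) (at t within {0..})"
  shows "flow_derivative R F F'"
  using assms by (simp add: flow_derivative_def)

lemma flow_derivative_linear:
  assumes "flow_derivative R F F'" "flow_derivative R G G'"
  shows "flow_derivative R (\<lambda>\<xi> X. a * F \<xi> X + b * G \<xi> X) (\<lambda>\<xi> X. a * F' \<xi> X + b * G' \<xi> X)"
  using assms unfolding flow_derivative_def by (intro ballI allI impI DERIV_add DERIV_cmult) simp_all

section \<open>Absorption of error terms\<close>

lemma young_ineq:
  fixes a b M \<mu> :: real
  assumes "\<mu> > 0"
  shows "M * (a * b) \<le> \<mu> / 2 * b\<^sup>2 + M\<^sup>2 / (2 * \<mu>) * a\<^sup>2"
proof -
  have "0 \<le> (\<mu> * b - M * a)\<^sup>2 / (2 * \<mu>)" using assms by simp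
  also have "\<dots> = \<mu> / 2 * b\<^sup>2 + M\<^sup>2 / (2 * \<mu>) * a\<^sup>2 - M * (a * b)"
    using assms by (simp add: field_simps power2_eq_square)
  finally show ?thesis by simp
qed

text \<open>Since \<open>E\<close> need not be nonnegative, \<^const>\<open>controls\<close> also expresses that an error term \<open>E\<close> in the
  derivative of a functional can be absorbed. This replaces an explicit hierarchy of small weights.\<close>

lemma controls_step:
  assumes der: "flow_derivative R F (\<lambda>\<xi> X. E \<xi> X - c * d \<xi> X)"
    and bnd: "form_bounded R F" and ctl: "controls R D E" and "c > 0"
  shows "controls R D d"
  unfolding controls_def
proof (intro allI impI)
  fix \<mu> :: real assume "\<mu> > 0"
  \<comment> \<open>The combined functional is divided by \<open>c\<close> at the end, so the
    allowance is multiplied by \<open>c\<close> here.\<close>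
  then have "\<mu> * c > 0" using \<open>c > 0\<close> by simp
  from ctl[unfolded controls_def, rule_format, OF this]
  obtain B G G' where B: "B \<ge> 0" and G: "flow_derivative R G G'"
    and GG: "\<forall>\<xi>\<in>R. \<forall>X. \<bar>G \<xi> X\<bar> \<le> B * (norm X)\<^sup>2 \<and> G' \<xi> X \<le> \<mu> * c * D \<xi> X - E \<xi> X"
    by (elim exE conjE)
  obtain K where K: "K \<ge> 0" "\<forall>\<xi>\<in>R. \<forall>X. \<bar>F \<xi> X\<bar> \<le> K * (norm X)\<^sup>2"
    using bnd unfolding form_bounded_def by blast
  let ?H = "\<lambda>\<xi> X. 1 / c * F \<xi> X + 1 / c * G \<xi> X"
  let ?H' = "\<lambda>\<xi> X. 1 / c * (E \<xi> X - c * d \<xi> X) + 1 / c * G' \<xi> X"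
  show "\<exists>C\<ge>0. \<exists>G G'. flow_derivative R G G' \<and>
     (\<forall>\<xi>\<in>R. \<forall>X. \<bar>G \<xi> X\<bar> \<le> C * (norm X)\<^sup>2 \<and> G' \<xi> X \<le> \<mu> * D \<xi> X - d \<xi> X)"
  proof (intro exI conjI ballI allI)
    show "0 \<le> (K + B) / c" using K(1) B \<open>c > 0\<close> by simp
    show "flow_derivative R ?H ?H'" by (rule flow_derivative_linear[OF der G])
    fix \<xi> X assume \<xi>: "\<xi> \<in> R"
    have "\<bar>?H \<xi> X\<bar> \<le> (\<bar>F \<xi> X\<bar> + \<bar>G \<xi> X\<bar>) / c"
      using \<open>c > 0\<close> by (intro order_trans[OF abs_triangle_ineq]) (simp add: add_divide_distrib)
    also have "\<dots> \<le> (K * (norm X)\<^sup>2 + B * (norm X)\<^sup>2) / c"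
      using K(2) GG \<xi> \<open>c > 0\<close> by (intro divide_right_mono add_mono) auto
    finally show "\<bar>?H \<xi> X\<bar> \<le> (K + B) / c * (norm X)\<^sup>2" by (simp add: distrib_right)
    have "1 / c * G' \<xi> X \<le> 1 / c * (\<mu> * c * D \<xi> X - E \<xi> X)"
      using GG \<xi> \<open>c > 0\<close> by (intro mult_left_mono) auto
    then show "?H' \<xi> X \<le> \<mu> * D \<xi> X - d \<xi> X"
      using \<open>c > 0\<close> by (simp add: field_simps)
  qed
qed

text \<open>\<open>controls R D\<close> and \<open>bounded_by R D\<close> share these two closure
  properties; the rules for squares of linear expressions are thus proved once for both.\<close>

definition lower_cone :: "real set \<Rightarrow> ((real \<Rightarrow> real^7 \<Rightarrow> real) \<Rightarrow> bool) \<Rightarrow> bool" where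
  "lower_cone R P \<longleftrightarrow> (\<forall>S T. P S \<longrightarrow> P T \<longrightarrow> P (\<lambda>\<xi> X. S \<xi> X + T \<xi> X)) \<and>
     (\<forall>S T C. P S \<longrightarrow> C > 0 \<longrightarrow> (\<forall>\<xi>\<in>R. \<forall>X. T \<xi> X \<le> C * S \<xi> X) \<longrightarrow> P T)"

lemma cone_add: "lower_cone R P \<Longrightarrow> P S \<Longrightarrow> P T \<Longrightarrow> P (\<lambda>\<xi> X. S \<xi> X + T \<xi> X)"
  by (simp add: lower_cone_def)

lemma cone_mono: "P T" if "lower_cone R P" "P S" "C > 0" "\<And>\<xi> X. \<xi> \<in> R \<Longrightarrow> T \<xi> X \<le> C * S \<xi> X"
  using that unfolding lower_cone_def by metis

lemma cone_square_weight:
  assumes "lower_cone R P" and "P (\<lambda>\<xi> X. (a \<xi> X)\<^sup>2)" and "\<And>\<xi>. \<xi> \<in> R \<Longrightarrow> \<bar>w \<xi>\<bar> \<le> 1"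
  shows "P (\<lambda>\<xi> X. (w \<xi> * a \<xi> X)\<^sup>2)"
proof (rule cone_mono[OF assms(1), OF assms(2), of 1])
  fix \<xi> X assume "\<xi> \<in> R"
  then have "(w \<xi>)\<^sup>2 \<le> 1" using assms(3) by (simp add: abs_square_le_1)
  then have "(w \<xi>)\<^sup>2 * (a \<xi> X)\<^sup>2 \<le> 1 * (a \<xi> X)\<^sup>2" by (rule mult_right_mono) simp
  then show "(w \<xi> * a \<xi> X)\<^sup>2 \<le> 1 * (a \<xi> X)\<^sup>2" by (simp add: power_mult_distrib)
qed simp

lemma cone_square_power:
  assumes "lower_cone R P" and "P (\<lambda>\<xi> X. (p \<xi> ^ m * a \<xi> X)\<^sup>2)" and "\<And>\<xi>. \<xi> \<in> R \<Longrightarrow> \<bar>p \<xi>\<bar> \<le> 1" and "m \<le> n"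
  shows "P (\<lambda>\<xi> X. (p \<xi> ^ n * a \<xi> X)\<^sup>2)"
proof -
  have "p \<xi> ^ n = p \<xi> ^ (n - m) * p \<xi> ^ m" for \<xi>
    using \<open>m \<le> n\<close> by (simp flip: power_add)
  moreover have "P (\<lambda>\<xi> X. (p \<xi> ^ (n - m) * (p \<xi> ^ m * a \<xi> X))\<^sup>2)"
    using assms(3) by (intro cone_square_weight[OF assms(1), OF assms(2)]) (simp add: power_abs power_le_one)
  ultimately show ?thesis by (simp add: mult.assoc)
qed

lemma cone_square_plain:
  assumes P: "lower_cone R P"
  shows "P (\<lambda>\<xi> X. (a \<xi> X)\<^sup>2) \<Longrightarrow> P (\<lambda>\<xi> X. (b \<xi> X)\<^sup>2) \<Longrightarrow> P (\<lambda>\<xi> X. (a \<xi> X + b \<xi> X)\<^sup>2)"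
    and "P (\<lambda>\<xi> X. (a \<xi> X)\<^sup>2) \<Longrightarrow> P (\<lambda>\<xi> X. (b \<xi> X)\<^sup>2) \<Longrightarrow> P (\<lambda>\<xi> X. (a \<xi> X - b \<xi> X)\<^sup>2)"
    and "P (\<lambda>\<xi> X. (a \<xi> X)\<^sup>2) \<Longrightarrow> P (\<lambda>\<xi> X. (k * a \<xi> X)\<^sup>2)"
proof -
  have sq: "(x + y)\<^sup>2 \<le> 2 * (x\<^sup>2 + y\<^sup>2)" "(x - y)\<^sup>2 \<le> 2 * (x\<^sup>2 + y\<^sup>2)" for x y :: real
    using sum_squares_bound[of x y] sum_squares_bound[of x "- y"] by (simp_all add: power2_sum power2_diff)
  show "P (\<lambda>\<xi> X. (a \<xi> X + b \<xi> X)\<^sup>2)" "P (\<lambda>\<xi> X. (a \<xi> X - b \<xi> X)\<^sup>2)"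
    if "P (\<lambda>\<xi> X. (a \<xi> X)\<^sup>2)" "P (\<lambda>\<xi> X. (b \<xi> X)\<^sup>2)"
    by (rule cone_mono[OF P, OF cone_add[OF P, OF that], of 2]; simp only: sq zero_less_numeral)+
  \<comment> \<open>The constant in \<open>cone_mono\<close> has to be positive, while
    \<open>k\<close> may be 0; hence \<open>k\<^sup>2 + 1\<close>.\<close>
  show "P (\<lambda>\<xi> X. (k * a \<xi> X)\<^sup>2)" if "P (\<lambda>\<xi> X. (a \<xi> X)\<^sup>2)"
    by (rule cone_mono[OF P, OF that, of "k\<^sup>2 + 1"]) (auto simp: power_mult_distrib mult_right_mono add_nonneg_pos)
qed

text \<open>Directed by the syntax of the linear form: weights pass through sums and constants, and
  an inner factor \<open>\<xi>\<close> changes the exponent of the weight. Repeated resolution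
  reduces a weighted expression to its components.\<close>

lemma cone_square_weighted:
  assumes P: "lower_cone R P"
  shows "P (\<lambda>\<xi> X. (w \<xi> * a \<xi> X)\<^sup>2) \<Longrightarrow> P (\<lambda>\<xi> X. (w \<xi> * b \<xi> X)\<^sup>2) \<Longrightarrow>
      P (\<lambda>\<xi> X. (w \<xi> * (a \<xi> X + b \<xi> X))\<^sup>2)"
    and "P (\<lambda>\<xi> X. (w \<xi> * a \<xi> X)\<^sup>2) \<Longrightarrow> P (\<lambda>\<xi> X. (w \<xi> * b \<xi> X)\<^sup>2) \<Longrightarrow>
      P (\<lambda>\<xi> X. (w \<xi> * (a \<xi> X - b \<xi> X))\<^sup>2)"
    and "P (\<lambda>\<xi> X. (w \<xi> * a \<xi> X)\<^sup>2) \<Longrightarrow> P (\<lambda>\<xi> X. (w \<xi> * (k * a \<xi> X))\<^sup>2)"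
    and "P (\<lambda>\<xi> X. (\<xi> ^ Suc n * a \<xi> X)\<^sup>2) \<Longrightarrow> P (\<lambda>\<xi> X. (\<xi> ^ n * (\<xi> * a \<xi> X))\<^sup>2)"
    and "(\<And>\<xi>. \<xi> \<in> R \<Longrightarrow> \<xi> \<noteq> 0) \<Longrightarrow> 1 \<le> n \<Longrightarrow> P (\<lambda>\<xi> X. (inverse \<xi> ^ (n - 1) * a \<xi> X)\<^sup>2) \<Longrightarrow>
      P (\<lambda>\<xi> X. (inverse \<xi> ^ n * (\<xi> * a \<xi> X))\<^sup>2)"
proof -
  show "P (\<lambda>\<xi> X. (w \<xi> * a \<xi> X)\<^sup>2) \<Longrightarrow> P (\<lambda>\<xi> X. (w \<xi> * b \<xi> X)\<^sup>2) \<Longrightarrow>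
      P (\<lambda>\<xi> X. (w \<xi> * (a \<xi> X + b \<xi> X))\<^sup>2)"
    unfolding distrib_left by (rule cone_square_plain[OF P])
  show "P (\<lambda>\<xi> X. (w \<xi> * a \<xi> X)\<^sup>2) \<Longrightarrow> P (\<lambda>\<xi> X. (w \<xi> * b \<xi> X)\<^sup>2) \<Longrightarrow>
      P (\<lambda>\<xi> X. (w \<xi> * (a \<xi> X - b \<xi> X))\<^sup>2)"
    unfolding right_diff_distrib by (rule cone_square_plain[OF P])
  show "P (\<lambda>\<xi> X. (w \<xi> * a \<xi> X)\<^sup>2) \<Longrightarrow> P (\<lambda>\<xi> X. (w \<xi> * (k * a \<xi> X))\<^sup>2)"
    unfolding mult.left_commute[of _ k] by (rule cone_square_plain[OF P])
  show "P (\<lambda>\<xi> X. (\<xi> ^ Suc n * a \<xi> X)\<^sup>2) \<Longrightarrow> P (\<lambda>\<xi> X. (\<xi> ^ n * (\<xi> * a \<xi> X))\<^sup>2)"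
    by (simp add: mult_ac)
  show "P (\<lambda>\<xi> X. (inverse \<xi> ^ n * (\<xi> * a \<xi> X))\<^sup>2)"
    if "\<And>\<xi>. \<xi> \<in> R \<Longrightarrow> \<xi> \<noteq> 0" "1 \<le> n" "P (\<lambda>\<xi> X. (inverse \<xi> ^ (n - 1) * a \<xi> X)\<^sup>2)"
  proof -
    have "(inverse \<xi> ^ n * (\<xi> * a \<xi> X))\<^sup>2 \<le> 1 * (inverse \<xi> ^ (n - 1) * a \<xi> X)\<^sup>2" if "\<xi> \<in> R" for \<xi> X
      using \<open>1 \<le> n\<close> \<open>\<And>\<xi>. \<xi> \<in> R \<Longrightarrow> \<xi> \<noteq> 0\<close>[OF that] by (cases n) (simp_all add: field_simps)
    then show ?thesis by (intro cone_mono[OF P, OF that(3) zero_less_one])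
  qed
qed

text \<open>In a sum, each summand is granted \<open>\<mu> / 2\<close>. For a multiple
  \<open>C\<close>, the functional is scaled by \<open>C\<close> and the allowance by
  \<open>1 / C\<close>.\<close>

lemma cone_controls: "lower_cone R (controls R D)"
  unfolding lower_cone_def
proof (intro conjI allI impI)
  fix S T assume S: "controls R D S" and T: "controls R D T"
  show "controls R D (\<lambda>\<xi> X. S \<xi> X + T \<xi> X)"
    unfolding controls_def
  proof (intro allI impI)
    fix \<mu> :: real assume "\<mu> > 0"
    then have "\<mu> / 2 > 0" by simp
    from S[unfolded controls_def, rule_format, OF this] T[unfolded controls_def, rule_format, OF this]
    obtain A B F F' G G' where AB: "A \<ge> 0" "B \<ge> 0"
      and der: "flow_derivative R F F'" "flow_derivative R G G'"
      and FF: "\<forall>\<xi>\<in>R. \<forall>X. \<bar>F \<xi> X\<bar> \<le> A * (norm X)\<^sup>2 \<and> F' \<xi> X \<le> \<mu> / 2 * D \<xi> X - S \<xi> X"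
      and GG: "\<forall>\<xi>\<in>R. \<forall>X. \<bar>G \<xi> X\<bar> \<le> B * (norm X)\<^sup>2 \<and> G' \<xi> X \<le> \<mu> / 2 * D \<xi> X - T \<xi> X"
      by (elim exE conjE)
    show "\<exists>C\<ge>0. \<exists>G G'. flow_derivative R G G' \<and>
       (\<forall>\<xi>\<in>R. \<forall>X. \<bar>G \<xi> X\<bar> \<le> C * (norm X)\<^sup>2 \<and> G' \<xi> X \<le> \<mu> * D \<xi> X - (S \<xi> X + T \<xi> X))"
    proof (intro exI conjI ballI allI)
      show "0 \<le> A + B" using AB by simp
      show "flow_derivative R (\<lambda>\<xi> X. F \<xi> X + G \<xi> X) (\<lambda>\<xi> X. F' \<xi> X + G' \<xi> X)"
        using flow_derivative_linear[OF der, of 1 1] by simp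
      fix \<xi> X assume "\<xi> \<in> R"
      with FF GG have *: "\<bar>F \<xi> X\<bar> \<le> A * (norm X)\<^sup>2" "F' \<xi> X \<le> \<mu> / 2 * D \<xi> X - S \<xi> X"
        "\<bar>G \<xi> X\<bar> \<le> B * (norm X)\<^sup>2" "G' \<xi> X \<le> \<mu> / 2 * D \<xi> X - T \<xi> X" by blast+
      show "\<bar>F \<xi> X + G \<xi> X\<bar> \<le> (A + B) * (norm X)\<^sup>2"
        using *(1,3) by (simp add: distrib_right)
      show "F' \<xi> X + G' \<xi> X \<le> \<mu> * D \<xi> X - (S \<xi> X + T \<xi> X)"
        using *(2,4) by simp
    qed
  qed
next
  fix S T and C :: real
  assume S: "controls R D S" and C: "C > 0" and TS: "\<forall>\<xi>\<in>R. \<forall>X. T \<xi> X \<le> C * S \<xi> X"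
  show "controls R D T"
    unfolding controls_def
  proof (intro allI impI)
    fix \<mu> :: real assume "\<mu> > 0"
    show "\<exists>C\<ge>0. \<exists>G G'. flow_derivative R G G' \<and>
       (\<forall>\<xi>\<in>R. \<forall>X. \<bar>G \<xi> X\<bar> \<le> C * (norm X)\<^sup>2 \<and> G' \<xi> X \<le> \<mu> * D \<xi> X - T \<xi> X)"
    proof -
      have "\<mu> / C > 0" using C \<open>\<mu> > 0\<close> by simp
      from S[unfolded controls_def, rule_format, OF this]
      obtain B G G' where B: "B \<ge> 0" and der: "flow_derivative R G G'"
        and GG: "\<forall>\<xi>\<in>R. \<forall>X. \<bar>G \<xi> X\<bar> \<le> B * (norm X)\<^sup>2 \<and> G' \<xi> X \<le> \<mu> / C * D \<xi> X - S \<xi> X"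
        by (elim exE conjE)
      show ?thesis
      proof (intro exI conjI ballI allI)
        show "0 \<le> C * B" using B C by simp
        show "flow_derivative R (\<lambda>\<xi> X. C * G \<xi> X) (\<lambda>\<xi> X. C * G' \<xi> X)"
          using flow_derivative_linear[OF der der, of C 0] by simp
        fix \<xi> X assume \<xi>: "\<xi> \<in> R"
        show "\<bar>C * G \<xi> X\<bar> \<le> C * B * (norm X)\<^sup>2"
          using GG \<xi> C by (simp add: abs_mult mult.assoc)
        have "C * G' \<xi> X \<le> C * (\<mu> / C * D \<xi> X - S \<xi> X)"
          using GG \<xi> C by (intro mult_left_mono) auto
        also have "\<dots> = \<mu> * D \<xi> X - C * S \<xi> X"
          using C by (simp add: right_diff_distrib)
        finally show "C * G' \<xi> X \<le> \<mu> * D \<xi> X - T \<xi> X"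
          using TS[rule_format, OF \<xi>, of X] by simp
      qed
    qed
  qed
qed

lemma cone_bounded_by: "lower_cone R (bounded_by R D)"
  unfolding lower_cone_def
proof (intro conjI allI impI)
  fix S T assume "bounded_by R D S" "bounded_by R D T"
  then obtain A B where "A > 0" "B > 0" and AB: "\<forall>\<xi>\<in>R. \<forall>X. S \<xi> X \<le> A * D \<xi> X" "\<forall>\<xi>\<in>R. \<forall>X. T \<xi> X \<le> B * D \<xi> X"
    unfolding bounded_by_def by blast
  have "S \<xi> X + T \<xi> X \<le> (A + B) * D \<xi> X" if "\<xi> \<in> R" for \<xi> X
    unfolding distrib_right using AB that by (intro add_mono) auto
  then show "bounded_by R D (\<lambda>\<xi> X. S \<xi> X + T \<xi> X)"
    unfolding bounded_by_def using \<open>A > 0\<close> \<open>B > 0\<close> by (intro exI[of _ "A + B"]) auto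
next
  fix S T and C :: real
  assume "bounded_by R D S" and C: "C > 0" and T: "\<forall>\<xi>\<in>R. \<forall>X. T \<xi> X \<le> C * S \<xi> X"
  then obtain A where "A > 0" and A: "\<forall>\<xi>\<in>R. \<forall>X. S \<xi> X \<le> A * D \<xi> X"
    unfolding bounded_by_def by blast
  have "T \<xi> X \<le> C * A * D \<xi> X" if "\<xi> \<in> R" for \<xi> X
  proof -
    have "C * S \<xi> X \<le> C * (A * D \<xi> X)" using A that C by (intro mult_left_mono) auto
    then show ?thesis using T[rule_format, OF that, of X] by (simp add: mult.assoc)
  qed
  then show "bounded_by R D T"
    unfolding bounded_by_def using \<open>A > 0\<close> C by (intro exI[of _ "C * A"]) auto
qed

text \<open>Young's inequality puts at most half of \<open>\<mu> * D\<close> on the square of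
  \<open>b\<close>; the multiple of the square of \<open>a\<close>, however large, is controlled
  with the other half. The roles are asymmetric, so error terms are always written with the
  controlled factor first.\<close>

lemma controls_product:
  assumes a: "controls R D (\<lambda>\<xi> X. (a \<xi> X)\<^sup>2)" and b: "bounded_by R D (\<lambda>\<xi> X. (b \<xi> X)\<^sup>2)"
  shows "controls R D (\<lambda>\<xi> X. k * (a \<xi> X * b \<xi> X))"
  unfolding controls_def
proof (intro allI impI)
  fix \<mu> :: real assume \<mu>: "\<mu> > 0"
  obtain B where B: "B > 0" "\<forall>\<xi>\<in>R. \<forall>X. (b \<xi> X)\<^sup>2 \<le> B * D \<xi> X"
    using b unfolding bounded_by_def by blast
  define \<nu> where "\<nu> = \<mu> / B"
  have \<nu>: "\<nu> > 0" "\<nu> * B = \<mu>" using \<mu> B(1) by (simp_all add: \<nu>_def)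
  have "controls R D (\<lambda>\<xi> X. k\<^sup>2 / (2 * \<nu>) * (a \<xi> X)\<^sup>2)"
    by (rule cone_mono[OF cone_controls, OF a, of "k\<^sup>2 / (2 * \<nu>) + 1"])
      (use \<nu> in \<open>auto simp: distrib_right intro!: add_nonneg_pos\<close>)
  from this[unfolded controls_def, rule_format, of "\<mu> / 2"]
  obtain C G G' where C: "C \<ge> 0" and der: "flow_derivative R G G'"
    and GG: "\<forall>\<xi>\<in>R. \<forall>X. \<bar>G \<xi> X\<bar> \<le> C * (norm X)\<^sup>2 \<and> G' \<xi> X \<le> \<mu> / 2 * D \<xi> X - k\<^sup>2 / (2 * \<nu>) * (a \<xi> X)\<^sup>2"
    using \<mu> by auto
  have "G' \<xi> X \<le> \<mu> * D \<xi> X - k * (a \<xi> X * b \<xi> X)" if \<xi>: "\<xi> \<in> R" for \<xi> X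
  proof -
    have "\<nu> * (b \<xi> X)\<^sup>2 \<le> \<nu> * (B * D \<xi> X)" using B(2) \<xi> \<nu>(1) by (intro mult_left_mono) auto
    also have "\<dots> = \<mu> * D \<xi> X" using \<nu>(2) by (simp flip: mult.assoc)
    finally have "\<nu> * (b \<xi> X)\<^sup>2 \<le> \<mu> * D \<xi> X" .
    then have "k * (a \<xi> X * b \<xi> X) \<le> \<mu> / 2 * D \<xi> X + k\<^sup>2 / (2 * \<nu>) * (a \<xi> X)\<^sup>2"
      using young_ineq[OF \<nu>(1), of k "a \<xi> X" "b \<xi> X"] by simp
    moreover have "G' \<xi> X \<le> \<mu> / 2 * D \<xi> X - k\<^sup>2 / (2 * \<nu>) * (a \<xi> X)\<^sup>2" using GG \<xi> by blast
    ultimately show ?thesis by simp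
  qed
  then show "\<exists>C\<ge>0. \<exists>G G'. flow_derivative R G G' \<and>
     (\<forall>\<xi>\<in>R. \<forall>X. \<bar>G \<xi> X\<bar> \<le> C * (norm X)\<^sup>2 \<and> G' \<xi> X \<le> \<mu> * D \<xi> X - k * (a \<xi> X * b \<xi> X))"
    using C der GG by blast
qed

lemma form_bounded_rules:
  shows "form_bounded R F \<Longrightarrow> form_bounded R G \<Longrightarrow> form_bounded R (\<lambda>\<xi> X. F \<xi> X + G \<xi> X)"
    and "form_bounded R F \<Longrightarrow> form_bounded R G \<Longrightarrow> form_bounded R (\<lambda>\<xi> X. F \<xi> X - G \<xi> X)"
    and "form_bounded R F \<Longrightarrow> form_bounded R (\<lambda>\<xi> X. k * F \<xi> X)"
proof -
  show "form_bounded R F \<Longrightarrow> form_bounded R (\<lambda>\<xi> X. k * F \<xi> X)" for F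
    unfolding form_bounded_def
    by (elim exE conjE, rule_tac x = "\<bar>k\<bar> * C" in exI) (auto simp: abs_mult mult.assoc intro!: mult_left_mono)
  show *: "form_bounded R F \<Longrightarrow> form_bounded R G \<Longrightarrow> form_bounded R (\<lambda>\<xi> X. F \<xi> X + G \<xi> X)" for F G
    unfolding form_bounded_def
    by (elim exE conjE, rule_tac x = "C + Ca" in exI)
      (auto simp: distrib_right intro!: order_trans[OF abs_triangle_ineq] add_mono)
  have "form_bounded R (\<lambda>\<xi> X. - G \<xi> X)" if "form_bounded R G"
    using that by (simp add: form_bounded_def)
  then show "form_bounded R F \<Longrightarrow> form_bounded R G \<Longrightarrow> form_bounded R (\<lambda>\<xi> X. F \<xi> X - G \<xi> X)"
    using *[of F "\<lambda>\<xi> X. - G \<xi> X"] by simp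
qed

lemma form_bounded_weight:
  assumes "form_bounded R F" and w: "\<And>\<xi>. \<xi> \<in> R \<Longrightarrow> \<bar>w \<xi>\<bar> \<le> 1"
  shows "form_bounded R (\<lambda>\<xi> X. w \<xi> * F \<xi> X)"
proof -
  obtain C where "C \<ge> 0" and C: "\<forall>\<xi>\<in>R. \<forall>X. \<bar>F \<xi> X\<bar> \<le> C * (norm X)\<^sup>2"
    using assms(1) unfolding form_bounded_def by blast
  have "\<bar>w \<xi> * F \<xi> X\<bar> \<le> C * (norm X)\<^sup>2" if "\<xi> \<in> R" for \<xi> X
    unfolding abs_mult
    by (rule order_trans[OF mult_left_le_one_le[OF abs_ge_zero abs_ge_zero w[OF that]]]) (use C that in blast)
  then show ?thesis unfolding form_bounded_def using \<open>C \<ge> 0\<close> by blast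
qed

lemma form_bounded_product:
  assumes "bounded_by R (\<lambda>\<xi> X. (norm X)\<^sup>2) (\<lambda>\<xi> X. (a \<xi> X)\<^sup>2)"
    and "bounded_by R (\<lambda>\<xi> X. (norm X)\<^sup>2) (\<lambda>\<xi> X. (b \<xi> X)\<^sup>2)"
  shows "form_bounded R (\<lambda>\<xi> X. a \<xi> X * b \<xi> X)"
proof -
  obtain A B where "A > 0" "B > 0" and AB: "\<forall>\<xi>\<in>R. \<forall>X. (a \<xi> X)\<^sup>2 \<le> A * (norm X)\<^sup>2" "\<forall>\<xi>\<in>R. \<forall>X. (b \<xi> X)\<^sup>2 \<le> B * (norm X)\<^sup>2"
    using assms unfolding bounded_by_def by blast
  have "\<bar>x * y\<bar> \<le> x\<^sup>2 + y\<^sup>2" for x y :: real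
    using sum_squares_bound[of "\<bar>x\<bar>" "\<bar>y\<bar>"] mult_nonneg_nonneg[of "\<bar>x\<bar>" "\<bar>y\<bar>"]
    unfolding abs_mult power2_abs by linarith
  then have "\<bar>a \<xi> X * b \<xi> X\<bar> \<le> (A + B) * (norm X)\<^sup>2" if "\<xi> \<in> R" for \<xi> X
    using AB that by (smt (verit, best) distrib_right)
  then show ?thesis
    using \<open>A > 0\<close> \<open>B > 0\<close> unfolding form_bounded_def by (intro exI[of _ "A + B"]) auto
qed

lemma bounded_by_norm_nth: "bounded_by R (\<lambda>\<xi> X. (norm X)\<^sup>2) (\<lambda>\<xi> X. (X $ i)\<^sup>2)"
proof -
  have "(X $ i)\<^sup>2 \<le> 1 * (norm X)\<^sup>2" for X :: "real^7"
    using power_mono[OF component_le_norm_cart[of X i] abs_ge_zero, of 2] by simp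
  then show ?thesis unfolding bounded_by_def by (intro exI[of _ 1]) auto
qed

section \<open>The energy and the first controlled quantity\<close>

definition energy :: "real^7 \<Rightarrow> real" where
  "energy X = k1 * (X $ 1)\<^sup>2 + (X $ 2)\<^sup>2 + k2 * (X $ 3)\<^sup>2 + (X $ 4)\<^sup>2 + k3 * (X $ 5)\<^sup>2
     + (X $ 6)\<^sup>2 + (X $ 7)\<^sup>2"

text \<open>The weights \<open>k1\<close>, \<open>k2\<close>, \<open>k3\<close> make all coupling
  terms cancel in pairs; only heat diffusion remains.\<close>

lemma flow_derivative_energy:
  "flow_derivative R (\<lambda>\<xi>. energy) (\<lambda>\<xi> X. - (2 * k4) * (\<xi> * X $ 7)\<^sup>2)"
  unfolding flow_derivative_def energy_def real_solution_def
  by (auto intro!: derivative_eq_intros simp: algebra_simps power2_eq_square)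

lemma forall_7: "(\<forall>i::7. P i) \<longleftrightarrow> P 1 \<and> P 2 \<and> P 3 \<and> P 4 \<and> P 5 \<and> P 6 \<and> P 7"
proof -
  have "i = 1 \<or> i = 2 \<or> i = 3 \<or> i = 4 \<or> i = 5 \<or> i = 6 \<or> i = 7" for i :: 7
  proof (cases i)
    case (of_int z)
    \<comment> \<open>In the type \<open>7\<close> the numeral 7 denotes 0, so the case
      \<open>z = 0\<close> is the last disjunct.\<close>
    then have "z = 0 \<or> z = 1 \<or> z = 2 \<or> z = 3 \<or> z = 4 \<or> z = 5 \<or> z = 6" by fastforce
    then show ?thesis using of_int(1) by auto
  qed
  then show ?thesis by metis
qed

lemma UNIV_7: "(UNIV :: 7 set) = {1, 2, 3, 4, 5, 6, 7}"
  using forall_7[of "\<lambda>i. i \<in> {1, 2, 3, 4, 5, 6, 7}"] by auto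

lemma sum_7: "sum f (UNIV :: 7 set) = f 1 + f 2 + f 3 + f 4 + f 5 + f 6 + f 7"
  unfolding UNIV_7 by (simp add: add_ac)

lemma norm_sq_7: "(norm X)\<^sup>2 = (norm (X $ 1))\<^sup>2 + (norm (X $ 2))\<^sup>2 + (norm (X $ 3))\<^sup>2 + (norm (X $ 4))\<^sup>2
    + (norm (X $ 5))\<^sup>2 + (norm (X $ 6))\<^sup>2 + (norm (X $ 7))\<^sup>2" for X :: "'a::real_normed_vector ^ 7"
  unfolding norm_vec_def L2_set_def by (simp add: sum_7 sum_nonneg)

lemma energy_bounds: "\<exists>A>0. \<forall>X. energy X \<le> A * (norm X)\<^sup>2 \<and> (norm X)\<^sup>2 \<le> A * energy X"
proof -
  define A where "A = 1 + k1 + k2 + k3 + 1 / k1 + 1 / k2 + 1 / k3"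
  have A: "1 \<le> A" "k1 \<le> A" "k2 \<le> A" "k3 \<le> A" "1 / k1 \<le> A" "1 / k2 \<le> A" "1 / k3 \<le> A"
    using pos by (simp_all add: A_def)
  then have B: "1 \<le> A * k1" "1 \<le> A * k2" "1 \<le> A * k3"
    using pos by (simp_all add: divide_simps)
  have "energy X \<le> A * (norm X)\<^sup>2 \<and> (norm X)\<^sup>2 \<le> A * energy X" for X
    using mult_right_mono[OF A(1), of "(X $ 2)\<^sup>2"] mult_right_mono[OF A(1), of "(X $ 4)\<^sup>2"]
      mult_right_mono[OF A(1), of "(X $ 6)\<^sup>2"] mult_right_mono[OF A(1), of "(X $ 7)\<^sup>2"]
      mult_right_mono[OF A(2), of "(X $ 1)\<^sup>2"] mult_right_mono[OF A(3), of "(X $ 3)\<^sup>2"]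
      mult_right_mono[OF A(4), of "(X $ 5)\<^sup>2"] mult_right_mono[OF B(1), of "(X $ 1)\<^sup>2"]
      mult_right_mono[OF B(2), of "(X $ 3)\<^sup>2"] mult_right_mono[OF B(3), of "(X $ 5)\<^sup>2"]
    by (simp add: norm_sq_7 energy_def algebra_simps)
  then show ?thesis using A(1) by (intro exI[of _ A]) auto
qed

text \<open>Divided by \<open>2 * k4\<close>, the energy is the required functional: its derivative
  is exactly minus this square. The allowance \<open>\<mu> * D\<close> is given away, which needs
  \<open>D\<close> nonnegative.\<close>

lemma controls_base: "controls R D (\<lambda>\<xi> X. (\<xi> * X $ 7)\<^sup>2)" if "\<And>\<xi> X. \<xi> \<in> R \<Longrightarrow> 0 \<le> D \<xi> X"
  unfolding controls_def
proof (intro allI impI)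
  fix \<mu> :: real assume "\<mu> > 0"
  obtain A where A: "A > 0" "\<And>X. energy X \<le> A * (norm X)\<^sup>2"
    using energy_bounds by blast
  have en: "0 \<le> energy X" for X unfolding energy_def using pos by simp
  show "\<exists>C\<ge>0. \<exists>G G'. flow_derivative R G G' \<and>
     (\<forall>\<xi>\<in>R. \<forall>X. \<bar>G \<xi> X\<bar> \<le> C * (norm X)\<^sup>2 \<and> G' \<xi> X \<le> \<mu> * D \<xi> X - (\<xi> * X $ 7)\<^sup>2)"
  proof (intro exI conjI ballI allI)
    show "0 \<le> A / (2 * k4)" using A pos by simp
    show "flow_derivative R (\<lambda>\<xi> X. energy X / (2 * k4)) (\<lambda>\<xi> X. - (\<xi> * X $ 7)\<^sup>2)"
      using flow_derivative_energy[of R] pos unfolding flow_derivative_def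
      by (auto intro!: derivative_eq_intros)
    fix \<xi> X assume "\<xi> \<in> R"
    show "\<bar>energy X / (2 * k4)\<bar> \<le> A / (2 * k4) * (norm X)\<^sup>2"
      using A(2)[of X] en[of X] pos by (simp add: divide_right_mono)
    show "- (\<xi> * X $ 7)\<^sup>2 \<le> \<mu> * D \<xi> X - (\<xi> * X $ 7)\<^sup>2"
      using that[OF \<open>\<xi> \<in> R\<close>] \<open>\<mu> > 0\<close> by simp
  qed
qed

section \<open>From controlled dissipation to exponential decay\<close>

lemma nonincreasing_from_0:
  fixes f f' :: "real \<Rightarrow> real"
  assumes "\<And>t. t \<ge> 0 \<Longrightarrow> (f has_real_derivative f' t) (at t within {0..})"
    and "\<And>t. t \<ge> 0 \<Longrightarrow> f' t \<le> 0" and "t \<ge> 0"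
  shows "f t \<le> f 0"
proof (rule DERIV_nonpos_imp_decreasing_open[OF \<open>t \<ge> 0\<close>])
  fix s assume s: "0 < s" "s < t"
  have "at s within {0..} = at s" using s by (intro at_within_interior) auto
  then show "\<exists>y. (f has_real_derivative y) (at s) \<and> y \<le> 0"
    using assms(1,2)[of s] s by auto
next
  have "continuous_on {0..} f"
    using assms(1) by (intro DERIV_continuous_on[where D = f']) auto
  then show "continuous_on {0..t} f" by (rule continuous_on_subset) auto
qed

text \<open>With \<open>\<mu> = 1 / 2\<close> there is a functional satisfying
  \<open>G' \<le> - D / 2\<close>. It need not be positive, but adding a multiple of the energy,
  whose derivative is nonpositive, makes it equivalent to the squared norm; Gronwall's argument then
  applies.\<close>

lemma controls_decay:
  assumes ctl: "controls R D D"
    and \<rho>: "\<And>\<xi> X. \<xi> \<in> R \<Longrightarrow> \<rho> \<xi> * (norm X)\<^sup>2 \<le> D \<xi> X" and \<rho>0: "\<And>\<xi>. \<xi> \<in> R \<Longrightarrow> 0 \<le> \<rho> \<xi>"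
  shows "\<exists>C>0. \<exists>c>0. \<forall>\<xi>\<in>R. \<forall>x. real_solution \<xi> x \<longrightarrow>
    (\<forall>t\<ge>0. (norm (x t))\<^sup>2 \<le> C * exp (- c * \<rho> \<xi> * t) * (norm (x 0))\<^sup>2)"
proof -
  obtain B where B: "B > 0" "\<And>X. energy X \<le> B * (norm X)\<^sup>2" "\<And>X. (norm X)\<^sup>2 \<le> B * energy X"
    using energy_bounds by blast
  from ctl[unfolded controls_def, rule_format, of "1 / 2"]
  obtain C G G' where C: "C \<ge> 0" and G: "flow_derivative R G G'"
    and GG: "\<forall>\<xi>\<in>R. \<forall>X. \<bar>G \<xi> X\<bar> \<le> C * (norm X)\<^sup>2 \<and> G' \<xi> X \<le> 1 / 2 * D \<xi> X - D \<xi> X"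
    by auto
  note Gb = GG[rule_format, THEN conjunct1] and Gi = GG[rule_format, THEN conjunct2]
  \<comment> \<open>Since \<open>G \<ge> - C * (norm X)\<^sup>2\<close> and
    \<open>B * energy X \<ge> (norm X)\<^sup>2\<close>, this multiple of the energy leaves
    \<open>(norm X)\<^sup>2\<close> as a lower bound.\<close>
  define L where "L = (\<lambda>\<xi> X. G \<xi> X + (C + 1) * B * energy X)"
  define L' where "L' = (\<lambda>\<xi> X. G' \<xi> X + (C + 1) * B * (- (2 * k4) * (\<xi> * X $ 7)\<^sup>2))"
  define M where "M = C + (C + 1) * B * B"
  have M: "M > 0" using B(1) C by (simp add: M_def add_nonneg_pos)
  \<comment> \<open>\<open>M\<close> bounds \<open>L\<close> from above, so half of
    \<open>\<rho> \<xi> * (norm X)\<^sup>2\<close> is at least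
    \<open>\<rho> \<xi> * L \<xi> X / (2 * M)\<close>.\<close>
  define c where "c = 1 / (2 * M)"
  have c: "c > 0" using M by (simp add: c_def)
  have dL: "flow_derivative R L L'"
    using flow_derivative_linear[OF G flow_derivative_energy, of 1 "(C + 1) * B"]
    unfolding L_def L'_def by simp
  have L1: "(norm X)\<^sup>2 \<le> L \<xi> X" if "\<xi> \<in> R" for \<xi> X
  proof -
    have "(C + 1) * (norm X)\<^sup>2 \<le> (C + 1) * (B * energy X)"
      using B(3)[of X] C by (intro mult_left_mono) auto
    then show ?thesis using Gb[OF that, of X] by (simp add: L_def algebra_simps)
  qed
  have L2: "L \<xi> X \<le> M * (norm X)\<^sup>2" if "\<xi> \<in> R" for \<xi> X
  proof -
    have "(C + 1) * B * energy X \<le> (C + 1) * B * (B * (norm X)\<^sup>2)"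
      using B(1,2) C by (intro mult_left_mono) auto
    then show ?thesis using Gb[OF that, of X] by (simp add: L_def M_def algebra_simps)
  qed
  have L3: "L' \<xi> X \<le> - c * \<rho> \<xi> * L \<xi> X" if "\<xi> \<in> R" for \<xi> X
  proof -
    have "0 \<le> (C + 1) * B * (2 * k4 * (\<xi> * X $ 7)\<^sup>2)"
      using C B(1) pos by (intro mult_nonneg_nonneg) auto
    then have "L' \<xi> X \<le> - (1 / 2) * D \<xi> X"
      using Gi[OF that, of X] unfolding L'_def by linarith
    also have "\<dots> \<le> - (1 / 2) * (\<rho> \<xi> * (norm X)\<^sup>2)"
      using \<rho>[OF that, of X] by (intro mult_left_mono_neg) auto
    also have "\<dots> = - (c * \<rho> \<xi>) * (M * (norm X)\<^sup>2)"
      using M by (simp add: c_def)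
    also have "\<dots> \<le> - (c * \<rho> \<xi>) * L \<xi> X"
      using L2[OF that, of X] c \<rho>0[OF that] by (intro mult_left_mono_neg) auto
    finally show ?thesis by simp
  qed
  have "(norm (x t))\<^sup>2 \<le> M * exp (- c * \<rho> \<xi> * t) * (norm (x 0))\<^sup>2"
    if \<xi>: "\<xi> \<in> R" and x: "real_solution \<xi> x" and t: "t \<ge> 0" for \<xi> x t
  proof -
    \<comment> \<open>Gronwall's argument: with the integrating factor, \<open>L\<close> is
      nonincreasing in time.\<close>
    have "exp (c * \<rho> \<xi> * t) * L \<xi> (x t) \<le> exp (c * \<rho> \<xi> * 0) * L \<xi> (x 0)"
    proof (rule nonincreasing_from_0[OF _ _ t])
      fix s :: real assume s: "s \<ge> 0"
      have "((\<lambda>t. L \<xi> (x t)) has_real_derivative L' \<xi> (x s)) (at s within {0..})"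
        using dL \<xi> x s unfolding flow_derivative_def by blast
      then show "((\<lambda>t. exp (c * \<rho> \<xi> * t) * L \<xi> (x t)) has_real_derivative
          exp (c * \<rho> \<xi> * s) * (c * \<rho> \<xi> * L \<xi> (x s) + L' \<xi> (x s))) (at s within {0..})"
        by (auto intro!: derivative_eq_intros simp: algebra_simps)
      show "exp (c * \<rho> \<xi> * s) * (c * \<rho> \<xi> * L \<xi> (x s) + L' \<xi> (x s)) \<le> 0"
        using L3[OF \<xi>, of "x s"] by (intro mult_nonneg_nonpos) auto
    qed
    then have "L \<xi> (x t) \<le> exp (- c * \<rho> \<xi> * t) * L \<xi> (x 0)"
      by (simp add: exp_minus field_simps)
    also have "\<dots> \<le> exp (- c * \<rho> \<xi> * t) * (M * (norm (x 0))\<^sup>2)"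
      using L2[OF \<xi>] by (intro mult_left_mono) auto
    finally show ?thesis using L1[OF \<xi>, of "x t"] by (simp add: mult_ac)
  qed
  then show ?thesis using M c by blast
qed

end

section \<open>Decay at low frequencies\<close>

context laminated
begin

lemmas square_controls = cone_square_plain[OF cone_controls] cone_square_weighted[OF cone_controls]
lemmas square_bounded = cone_square_plain[OF cone_bounded_by] cone_square_weighted[OF cone_bounded_by]
lemmas square_bounded_norm = cone_square_plain[OF cone_bounded_by] bounded_by_norm_nth cone_square_weight[OF cone_bounded_by]

text \<open>\<open>\<eta>\<close> keeps the weight of its own dissipation; the square
  \<open>\<xi>\<^sup>2\<close> on all other components is what a rate \<open>\<xi>^4\<close>
  requires.\<close>

definition low_rate :: "real \<Rightarrow> real^7 \<Rightarrow> real" where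
  "low_rate \<xi> X = (\<xi> * X $ 7)\<^sup>2
     + (\<xi>\<^sup>2 * X $ 1)\<^sup>2
     + (\<xi>\<^sup>2 * X $ 2)\<^sup>2
     + (\<xi>\<^sup>2 * X $ 3)\<^sup>2
     + (\<xi>\<^sup>2 * X $ 4)\<^sup>2
     + (\<xi>\<^sup>2 * X $ 5)\<^sup>2
     + (\<xi>\<^sup>2 * X $ 6)\<^sup>2"

lemma low_rate_nonneg: "0 \<le> low_rate \<xi> X"
  by (simp add: low_rate_def)

lemma bounded_low:
  shows "bounded_by R low_rate (\<lambda>\<xi> X. (\<xi> * X $ 7)\<^sup>2)"
    and "bounded_by R low_rate (\<lambda>\<xi> X. (\<xi>\<^sup>2 * X $ 1)\<^sup>2)"
    and "bounded_by R low_rate (\<lambda>\<xi> X. (\<xi>\<^sup>2 * X $ 2)\<^sup>2)"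
    and "bounded_by R low_rate (\<lambda>\<xi> X. (\<xi>\<^sup>2 * X $ 3)\<^sup>2)"
    and "bounded_by R low_rate (\<lambda>\<xi> X. (\<xi>\<^sup>2 * X $ 4)\<^sup>2)"
    and "bounded_by R low_rate (\<lambda>\<xi> X. (\<xi>\<^sup>2 * X $ 5)\<^sup>2)"
    and "bounded_by R low_rate (\<lambda>\<xi> X. (\<xi>\<^sup>2 * X $ 6)\<^sup>2)"
  unfolding bounded_by_def low_rate_def by (rule exI[of _ 1], simp)+

lemma abs_le_1_low: "\<xi> \<in> {0..1} \<Longrightarrow> \<bar>\<xi>\<bar> \<le> 1" "\<xi> \<in> {0..1} \<Longrightarrow> \<bar>\<xi> ^ n\<bar> \<le> 1" for \<xi> :: real
  by (auto simp: power_le_one)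

lemma controls_power_low:
  "controls {0..1} D (\<lambda>\<xi> X. (\<xi> ^ m * a \<xi> X)\<^sup>2) \<Longrightarrow> m \<le> n \<Longrightarrow> controls {0..1} D (\<lambda>\<xi> X. (\<xi> ^ n * a \<xi> X)\<^sup>2)"
  by (rule cone_square_power[OF cone_controls, where p = "\<lambda>\<xi>. \<xi>"]) auto

lemma bounded_power_low:
  "bounded_by {0..1} D (\<lambda>\<xi> X. (\<xi> ^ m * a \<xi> X)\<^sup>2) \<Longrightarrow> m \<le> n \<Longrightarrow> bounded_by {0..1} D (\<lambda>\<xi> X. (\<xi> ^ n * a \<xi> X)\<^sup>2)"
  by (rule cone_square_power[OF cone_bounded_by, where p = "\<lambda>\<xi>. \<xi>"]) auto

lemmas bounded_low_power = bounded_low(2-7)[THEN bounded_power_low] bounded_low(1)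
  bounded_power_low[where m = 1, simplified power_one_right, OF bounded_low(1)]

lemma controls_low_eta: "controls {0..1} low_rate (\<lambda>\<xi> X. (\<xi> * X $ 7)\<^sup>2)"
  by (rule controls_base) (rule low_rate_nonneg)

lemmas controls_low_power1 = controls_low_eta
  controls_power_low[where m = 1, simplified power_one_right, OF controls_low_eta]

lemmas controls_rules = cone_add[OF cone_controls] controls_product
lemmas form_rules = form_bounded_rules form_bounded_weight form_bounded_product square_bounded_norm

text \<open>The term \<open>- \<gamma> \<xi> \<theta>\<close> in the equation of
  \<open>\<eta>\<close> makes \<open>\<eta> \<theta>\<close> produce
  \<open>- \<gamma> \<xi> \<theta>\<^sup>2\<close>. The prefactor \<open>\<xi>^3\<close> is dictated
  by the error \<open>k1 \<xi>^3 \<eta> v\<close>, which must split into \<open>\<xi> \<eta>\<close>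
  and \<open>\<xi>\<^sup>2 v\<close>.\<close>

lemma controls_low_theta: "controls {0..1} low_rate (\<lambda>\<xi> X. (\<xi>\<^sup>2 * X $ 6)\<^sup>2)"
proof (rule controls_step)
  show "flow_derivative {0..1} (\<lambda>\<xi> X. \<xi> ^ 3 * (X $ 7 * X $ 6))
    (\<lambda>\<xi> X. \<gamma> * ((\<xi> * X $ 7) * (\<xi> ^ 3 * X $ 7)) + (- k4) * ((\<xi> * X $ 7) * (\<xi> ^ 4 * X $ 6)) +
      (- k3) * ((\<xi> * X $ 7) * (\<xi> ^ 3 * X $ 5)) + (- k1) * ((\<xi> * X $ 7) * (\<xi>\<^sup>2 * X $ 1)) - \<gamma> * (\<xi>\<^sup>2 * X $ 6)\<^sup>2)"
    by (rule flow_derivativeI, rule DERIV_cong,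
      (rule real_solutionD derivative_intros | assumption)+, algebra)
\<comment> \<open>The first block bounds the functional by the squared norm. The second splits the
  error at its plus signs and treats each product by \<open>controls_product\<close>: left factor
  controlled, right factor dominated by \<open>low_rate\<close>. The explicit coefficients, even 1,
  give the error the shape these rules match. All later steps follow this pattern.\<close>
qed ((rule form_rules abs_le_1_low | assumption)+,
    (rule controls_rules controls_low_power1 bounded_low_power square_controls square_bounded | simp add: pos add_pos_pos)+)

lemmas controls_low_power2 = controls_low_power1 controls_low_theta[THEN controls_power_low]

text \<open>\<open>k1 v \<theta>\<close> yields \<open>- k1\<^sup>2 v\<^sup>2\<close> but also
  \<open>- k1 k3 \<xi> v \<phi>\<close>; the summand \<open>k3 u \<phi>\<close> cancels the latter.
  The remaining cross term \<open>(k3 - k1) \<xi> u \<theta>\<close> contains the controlled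
  \<open>\<theta>\<close>.\<close>

lemma controls_low_v: "controls {0..1} low_rate (\<lambda>\<xi> X. (\<xi>\<^sup>2 * X $ 1)\<^sup>2)"
proof (rule controls_step)
  show "flow_derivative {0..1} (\<lambda>\<xi> X. \<xi> ^ 4 * (k1 * (X $ 1 * X $ 6) + k3 * (X $ 2 * X $ 5)))
    (\<lambda>\<xi> X. k1 * ((\<xi>\<^sup>2 * X $ 6) * (\<xi>\<^sup>2 * X $ 4)) + k1 * ((\<xi>\<^sup>2 * X $ 6) * (\<xi>\<^sup>2 * X $ 6)) +
      (k3 - k1) * ((\<xi>\<^sup>2 * X $ 6) * (\<xi> ^ 3 * X $ 2)) +
      (k1 * \<gamma>) * ((\<xi> * X $ 7) * (\<xi> ^ 4 * X $ 1)) - (k1 * k1) * (\<xi>\<^sup>2 * X $ 1)\<^sup>2)"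
    by (rule flow_derivativeI, rule DERIV_cong,
      (rule real_solutionD derivative_intros | assumption)+, algebra)
qed ((rule form_rules abs_le_1_low | assumption)+,
    (rule controls_rules controls_low_power2 bounded_low_power square_controls square_bounded | simp add: pos add_pos_pos)+)

lemmas controls_low_power3 = controls_low_power2 controls_low_v[THEN controls_power_low]

text \<open>In the real variables the first equation reads
  \<open>v' = (y - \<xi> u) + \<theta>\<close>, so pairing \<open>v\<close> with
  \<open>\<xi> u - y\<close> produces minus the square of this combination.\<close>

lemma controls_low_y_u: "controls {0..1} low_rate (\<lambda>\<xi> X. (\<xi>\<^sup>2 * (X $ 4 - \<xi> * X $ 2))\<^sup>2)"
proof (rule controls_step)
  show "flow_derivative {0..1} (\<lambda>\<xi> X. \<xi> ^ 4 * (X $ 1 * (\<xi> * X $ 2 - X $ 4)))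
    (\<lambda>\<xi> X. (- 1) * ((\<xi>\<^sup>2 * X $ 6) * (\<xi>\<^sup>2 * (X $ 4 - \<xi> * X $ 2))) +
      1 * ((\<xi>\<^sup>2 * X $ 1) * (\<xi>\<^sup>2 * (k1 * X $ 1 + k1 * (\<xi> * (\<xi> * X $ 1)) + k2 * (\<xi> * X $ 3)))) - 1 * (\<xi>\<^sup>2 * (X $ 4 - \<xi> * X $ 2))\<^sup>2)"
    by (rule flow_derivativeI, rule DERIV_cong,
      (rule real_solutionD derivative_intros | assumption)+, algebra)
qed ((rule form_rules abs_le_1_low | assumption)+,
    (rule controls_rules controls_low_power3 bounded_low_power square_controls square_bounded | simp add: pos add_pos_pos)+)

lemmas controls_low_power4 = controls_low_power3 controls_low_y_u[THEN controls_power_low]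

text \<open>The two summands cancel the term in \<open>\<xi> v z\<close>. What is left,
  \<open>(k1 - k2) \<xi> u y - k1 y\<^sup>2\<close>, becomes \<open>- k2 y\<^sup>2\<close> plus a
  controlled product once \<open>\<xi> u\<close> is written as \<open>y - (y - \<xi> u)\<close>;
  this is why that combination had to come before \<open>y\<close>.\<close>

lemma controls_low_y: "controls {0..1} low_rate (\<lambda>\<xi> X. (\<xi>\<^sup>2 * X $ 4)\<^sup>2)"
proof (rule controls_step)
  show "flow_derivative {0..1} (\<lambda>\<xi> X. \<xi> ^ 4 * (- k1 * (X $ 1 * X $ 4) - k2 * (X $ 2 * X $ 3)))
    (\<lambda>\<xi> X. (- k1) * ((\<xi>\<^sup>2 * X $ 6) * (\<xi>\<^sup>2 * X $ 4)) +
      (k1 * k1) * ((\<xi>\<^sup>2 * X $ 1) * (\<xi>\<^sup>2 * X $ 1)) +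
      (k2 - k1) * ((\<xi>\<^sup>2 * (X $ 4 - \<xi> * X $ 2)) * (\<xi>\<^sup>2 * X $ 4)) - k2 * (\<xi>\<^sup>2 * X $ 4)\<^sup>2)"
    by (rule flow_derivativeI, rule DERIV_cong,
      (rule real_solutionD derivative_intros | assumption)+, algebra)
qed ((rule form_rules abs_le_1_low | assumption)+,
    (rule controls_rules controls_low_power4 bounded_low_power square_controls square_bounded | simp add: pos add_pos_pos)+)

lemmas controls_low_power5 = controls_low_power4 controls_low_y[THEN controls_power_low]

text \<open>In \<open>y - \<theta>\<close> the terms \<open>k1 v\<close> cancel, and its derivative
  is \<open>- \<xi>\<close> times the difference of the two fluxes,
  \<open>k2 z - k3 \<phi> + \<gamma> \<eta>\<close>.\<close>

lemma controls_low_flux: "controls {0..1} low_rate (\<lambda>\<xi> X. (\<xi>\<^sup>2 * (k2 * X $ 3 - k3 * X $ 5 + \<gamma> * X $ 7))\<^sup>2)"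
proof (rule controls_step)
  show "flow_derivative {0..1} (\<lambda>\<xi> X. \<xi> ^ 3 * ((X $ 4 - X $ 6) * (k2 * X $ 3 - k3 * X $ 5 + \<gamma> * X $ 7)))
    (\<lambda>\<xi> X. k2 * ((\<xi>\<^sup>2 * (X $ 4 - X $ 6)) * (\<xi>\<^sup>2 * X $ 4)) +
      (- (k3 + \<gamma>\<^sup>2)) * ((\<xi>\<^sup>2 * (X $ 4 - X $ 6)) * (\<xi>\<^sup>2 * X $ 6)) +
      (- \<gamma> * k4) * ((\<xi> * X $ 7) * (\<xi> ^ 4 * (X $ 4 - X $ 6))) - 1 * (\<xi>\<^sup>2 * (k2 * X $ 3 - k3 * X $ 5 + \<gamma> * X $ 7))\<^sup>2)"
    by (rule flow_derivativeI, rule DERIV_cong,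
      (rule real_solutionD derivative_intros | assumption)+, algebra)
qed ((rule form_rules abs_le_1_low | assumption)+,
    (rule controls_rules controls_low_power5 bounded_low_power square_controls square_bounded | simp add: pos add_pos_pos)+)

lemmas controls_low_power6 = controls_low_power5 controls_low_flux[THEN controls_power_low]

text \<open>Both factors vary only at order \<open>\<xi>\<^sup>2\<close>. In
  \<open>2 u + \<xi> (y + \<theta>)\<close> the terms in \<open>v\<close> cancel, leaving the
  derivative \<open>- \<xi>\<^sup>2 (k2 z + k3 \<phi> - \<gamma> \<eta>)\<close>. In the second
  factor \<open>k2 \<xi> v\<close> removes \<open>y\<close> and the coefficient
  \<open>k2 + k3 + \<gamma>\<^sup>2\<close> removes \<open>\<theta>\<close>, leaving
  \<open>- \<xi>\<^sup>2 (\<gamma> k2 u + k4 (k2 + k3) \<eta>)\<close>. Hence the prefactor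
  \<open>\<xi>\<^sup>2\<close> already reaches \<open>\<xi>^4 u\<^sup>2\<close>.\<close>

lemma controls_low_u: "controls {0..1} low_rate (\<lambda>\<xi> X. (\<xi>\<^sup>2 * X $ 2)\<^sup>2)"
proof (rule controls_step)
  show "flow_derivative {0..1} (\<lambda>\<xi> X. \<xi>\<^sup>2 * ((2 * X $ 2 + \<xi> * (X $ 4 + X $ 6)) * ((k2 + k3 + \<gamma>\<^sup>2) * X $ 7 - \<gamma> * ((k2 * X $ 3 - k3 * X $ 5 + \<gamma> * X $ 7) - k2 * (\<xi> * X $ 1)))))
    (\<lambda>\<xi> X. (- (\<gamma> * k2)) * ((\<xi>\<^sup>2 * (X $ 4 + X $ 6)) * (\<xi> ^ 3 * X $ 2)) +
      (- (k4 * (k2 + k3))) * ((\<xi> * X $ 7) * (\<xi> ^ 3 * (2 * X $ 2 + \<xi> * (X $ 4 + X $ 6)))) +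
      1 * ((\<xi>\<^sup>2 * (\<gamma> * ((k2 * X $ 3 - k3 * X $ 5 + \<gamma> * X $ 7) - k2 * (\<xi> * X $ 1)) - (k2 + k3 + \<gamma>\<^sup>2) * X $ 7)) * (\<xi>\<^sup>2 * (k2 * X $ 3 + k3 * X $ 5 - \<gamma> * X $ 7))) - (2 * \<gamma> * k2) * (\<xi>\<^sup>2 * X $ 2)\<^sup>2)"
    by (rule flow_derivativeI, rule DERIV_cong,
      (rule real_solutionD derivative_intros | assumption)+, algebra)
qed ((rule form_rules abs_le_1_low | assumption)+,
    (rule controls_rules controls_low_power6 bounded_low_power square_controls square_bounded | simp add: pos add_pos_pos)+)

lemmas controls_low_power7 = controls_low_power6 controls_low_u[THEN controls_power_low]

text \<open>\<open>z + \<phi> - \<xi> v\<close> has derivative exactly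
  \<open>\<xi>\<^sup>2 u\<close>, with \<open>u\<close> controlled. The derivative of the other
  factor contributes \<open>- \<xi>\<^sup>2 (k2 z + k3 \<phi> - \<gamma> \<eta>)\<close>. Expressing
  \<open>k3 \<phi>\<close> by \<open>k2 z\<close>, the flux and \<open>\<eta>\<close> turns both
  into positive multiples of \<open>z\<close> up to controlled terms.\<close>

lemma controls_low_z: "controls {0..1} low_rate (\<lambda>\<xi> X. (\<xi>\<^sup>2 * X $ 3)\<^sup>2)"
proof (rule controls_step)
  show "flow_derivative {0..1} (\<lambda>\<xi> X. \<xi>\<^sup>2 * (k3 * ((2 * X $ 2 + \<xi> * (X $ 4 + X $ 6)) * (X $ 3 + X $ 5 - \<xi> * X $ 1))))
    (\<lambda>\<xi> X. (2 * k3) * ((\<xi>\<^sup>2 * X $ 2) * (\<xi>\<^sup>2 * X $ 2)) +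
      k3 * ((\<xi>\<^sup>2 * X $ 2) * (\<xi> ^ 3 * (X $ 4 + X $ 6))) +
      (2 * k2) * ((\<xi>\<^sup>2 * ((k2 * X $ 3 - k3 * X $ 5 + \<gamma> * X $ 7) - \<gamma> * X $ 7 + k3 * (\<xi> * X $ 1))) * (\<xi>\<^sup>2 * X $ 3)) +
      (k2 + k3) * ((\<xi>\<^sup>2 * (k2 * X $ 3 - k3 * X $ 5 + \<gamma> * X $ 7)) * (\<xi>\<^sup>2 * X $ 3)) +
      (- 1) * ((\<xi>\<^sup>2 * ((k2 * X $ 3 - k3 * X $ 5 + \<gamma> * X $ 7) - \<gamma> * X $ 7 + k3 * (\<xi> * X $ 1))) * (\<xi>\<^sup>2 * (k2 * X $ 3 - k3 * X $ 5 + \<gamma> * X $ 7))) - (2 * k2 * (k2 + k3)) * (\<xi>\<^sup>2 * X $ 3)\<^sup>2)"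
    by (rule flow_derivativeI, rule DERIV_cong,
      (rule real_solutionD derivative_intros | assumption)+, algebra)
qed ((rule form_rules abs_le_1_low | assumption)+,
    (rule controls_rules controls_low_power7 bounded_low_power square_controls square_bounded | simp add: pos add_pos_pos)+)

lemmas controls_low_power8 = controls_low_power7 controls_low_z[THEN controls_power_low]

lemma controls_low_phi: "controls {0..1} low_rate (\<lambda>\<xi> X. (\<xi>\<^sup>2 * X $ 5)\<^sup>2)"
proof -
  have "controls {0..1} low_rate (\<lambda>\<xi> X. (\<xi>\<^sup>2 * (1 / k3 * (k2 * X $ 3 - (k2 * X $ 3 - k3 * X $ 5 + \<gamma> * X $ 7) + \<gamma> * X $ 7)))\<^sup>2)"
    by (rule controls_low_power8 square_controls | simp)+
  then show ?thesis using pos by simp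
qed

lemma decay_low:
  "\<exists>C>0. \<exists>c>0. \<forall>\<xi>\<in>{0..1}. \<forall>x. real_solution \<xi> x \<longrightarrow>
    (\<forall>t\<ge>0. (norm (x t))\<^sup>2 \<le> C * exp (- c * \<xi> ^ 4 * t) * (norm (x 0))\<^sup>2)"
proof (rule controls_decay)
  show "controls {0..1} low_rate low_rate"
  proof -
    have "controls {0..1} low_rate (\<lambda>\<xi> X. (\<xi> * X $ 7)\<^sup>2
     + (\<xi>\<^sup>2 * X $ 1)\<^sup>2
     + (\<xi>\<^sup>2 * X $ 2)\<^sup>2
     + (\<xi>\<^sup>2 * X $ 3)\<^sup>2
     + (\<xi>\<^sup>2 * X $ 4)\<^sup>2
     + (\<xi>\<^sup>2 * X $ 5)\<^sup>2
     + (\<xi>\<^sup>2 * X $ 6)\<^sup>2)"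
      by (rule cone_add[OF cone_controls] controls_low_power8 controls_low_phi order_refl)+
    then show ?thesis by (simp add: low_rate_def[abs_def])
  qed
  fix \<xi> :: real and X :: "real^7" assume "\<xi> \<in> {0..1}"
  then have "\<xi> ^ 4 \<le> \<xi>\<^sup>2" by (intro power_decreasing) auto
  then have "\<xi> ^ 4 * (X $ 7)\<^sup>2 \<le> (\<xi> * X $ 7)\<^sup>2"
    by (simp add: power_mult_distrib mult_right_mono)
  then show "\<xi> ^ 4 * (norm X)\<^sup>2 \<le> low_rate \<xi> X"
    by (simp add: low_rate_def norm_sq_7 power_mult_distrib distrib_left flip: power_mult)
qed simp


end

section \<open>Decay at high frequencies\<close>

context laminated
begin

lemma abs_inverse_le_1: "\<xi> \<in> {1..} \<Longrightarrow> \<bar>inverse \<xi>\<bar> \<le> 1" "\<xi> \<in> {1..} \<Longrightarrow> \<bar>inverse \<xi> ^ n\<bar> \<le> 1" for \<xi> :: real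
  by (auto simp: abs_inverse power_le_one inverse_le_1_iff)

lemma bounded_power_high:
  "bounded_by {1..} D (\<lambda>\<xi> X. (inverse \<xi> ^ m * a \<xi> X)\<^sup>2) \<Longrightarrow> m \<le> n \<Longrightarrow>
    bounded_by {1..} D (\<lambda>\<xi> X. (inverse \<xi> ^ n * a \<xi> X)\<^sup>2)"
  by (rule cone_square_power[OF cone_bounded_by, where p = inverse]) (assumption | erule abs_inverse_le_1)+

lemma bounded_eta_high:
  assumes "bounded_by {1..} D (\<lambda>\<xi> X. (\<xi> * X $ 7)\<^sup>2)"
  shows "bounded_by {1..} D (\<lambda>\<xi> X. (X $ 7)\<^sup>2)"
proof (rule cone_mono[OF cone_bounded_by, OF assms zero_less_one])
  fix \<xi> :: real and X :: "real^7" assume "\<xi> \<in> {1..}"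
  then have "1 * (X $ 7)\<^sup>2 \<le> \<xi>\<^sup>2 * (X $ 7)\<^sup>2" by (intro mult_right_mono) auto
  then show "(X $ 7)\<^sup>2 \<le> 1 * (\<xi> * X $ 7)\<^sup>2" by (simp add: power_mult_distrib)
qed

text \<open>The method \<open>algebra\<close> treats \<open>inverse \<xi>\<close> as an
  indeterminate of its own; the hypothesis \<open>inverse \<xi> * \<xi> = 1\<close> is the relation
  it needs.\<close>

lemma flow_derivative_highI:
  assumes "\<And>\<xi> x t. inverse \<xi> * \<xi> = 1 \<Longrightarrow> real_solution \<xi> x \<Longrightarrow> 0 \<le> t \<Longrightarrow>
     ((\<lambda>t. F \<xi> (x t)) has_real_derivative F' \<xi> (x t)) (at t within {0..})"
  shows "flow_derivative {1..} F F'"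
  using assms by (auto simp: flow_derivative_def)

text \<open>The loss accumulates along the chain of transfers: none for \<open>\<theta>\<close> and
  \<open>\<phi>\<close>, one power of \<open>\<xi>\<close> for \<open>v\<close> and
  \<open>u\<close>, two for \<open>y\<close> and \<open>z\<close>. The last determine the rate
  \<open>\<xi>^(-4)\<close>.\<close>

definition high_rate :: "real \<Rightarrow> real^7 \<Rightarrow> real" where
  "high_rate \<xi> X = (\<xi> * X $ 7)\<^sup>2
     + (inverse \<xi> * X $ 1)\<^sup>2
     + (inverse \<xi> * X $ 2)\<^sup>2
     + (inverse \<xi> ^ 2 * X $ 3)\<^sup>2
     + (inverse \<xi> ^ 2 * X $ 4)\<^sup>2
     + (X $ 5)\<^sup>2
     + (X $ 6)\<^sup>2"

lemma high_rate_nonneg: "0 \<le> high_rate \<xi> X"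
  by (simp add: high_rate_def)

lemma bounded_high:
  shows "bounded_by R high_rate (\<lambda>\<xi> X. (\<xi> * X $ 7)\<^sup>2)"
    and "bounded_by R high_rate (\<lambda>\<xi> X. (inverse \<xi> * X $ 1)\<^sup>2)"
    and "bounded_by R high_rate (\<lambda>\<xi> X. (inverse \<xi> * X $ 2)\<^sup>2)"
    and "bounded_by R high_rate (\<lambda>\<xi> X. (inverse \<xi> ^ 2 * X $ 3)\<^sup>2)"
    and "bounded_by R high_rate (\<lambda>\<xi> X. (inverse \<xi> ^ 2 * X $ 4)\<^sup>2)"
    and "bounded_by R high_rate (\<lambda>\<xi> X. (X $ 5)\<^sup>2)"
    and "bounded_by R high_rate (\<lambda>\<xi> X. (X $ 6)\<^sup>2)"
  unfolding bounded_by_def high_rate_def by (rule exI[of _ 1], simp)+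

definition equal_rate :: "real \<Rightarrow> real^7 \<Rightarrow> real" where
  "equal_rate \<xi> X = (\<xi> * X $ 7)\<^sup>2
     + (X $ 1)\<^sup>2
     + (X $ 2)\<^sup>2
     + (X $ 3)\<^sup>2
     + (X $ 4)\<^sup>2
     + (X $ 5)\<^sup>2
     + (X $ 6)\<^sup>2"

lemma equal_rate_nonneg: "0 \<le> equal_rate \<xi> X"
  by (simp add: equal_rate_def)

lemma bounded_equal:
  shows "bounded_by R equal_rate (\<lambda>\<xi> X. (\<xi> * X $ 7)\<^sup>2)"
    and "bounded_by R equal_rate (\<lambda>\<xi> X. (X $ 1)\<^sup>2)"
    and "bounded_by R equal_rate (\<lambda>\<xi> X. (X $ 2)\<^sup>2)"
    and "bounded_by R equal_rate (\<lambda>\<xi> X. (X $ 3)\<^sup>2)"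
    and "bounded_by R equal_rate (\<lambda>\<xi> X. (X $ 4)\<^sup>2)"
    and "bounded_by R equal_rate (\<lambda>\<xi> X. (X $ 5)\<^sup>2)"
    and "bounded_by R equal_rate (\<lambda>\<xi> X. (X $ 6)\<^sup>2)"
  unfolding bounded_by_def equal_rate_def by (rule exI[of _ 1], simp)+

lemmas bounded_high_power = bounded_high
  bounded_high(2,3)[THEN bounded_power_high[where m = 1, simplified power_one_right]]
  bounded_high(4,5)[THEN bounded_power_high]
  bounded_eta_high[OF bounded_high(1)]

lemma controls_high_eta: "controls {1..} high_rate (\<lambda>\<xi> X. (\<xi> * X $ 7)\<^sup>2)"
  by (rule controls_base) (rule high_rate_nonneg)

lemma controls_equal_eta: "controls {1..} equal_rate (\<lambda>\<xi> X. (\<xi> * X $ 7)\<^sup>2)"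
  by (rule controls_base) (rule equal_rate_nonneg)

text \<open>The functional is that of low frequencies; the prefactor is now limited by the diffusion
  term \<open>k4 \<xi>\<^sup>2 \<eta> \<theta>\<close>, which \<open>inverse \<xi>\<close> turns
  into \<open>\<xi> \<eta>\<close> times \<open>\<theta>\<close>.\<close>

lemma controls_high_theta: "controls {1..} high_rate (\<lambda>\<xi> X. (X $ 6)\<^sup>2)"
proof (rule controls_step)
  show "flow_derivative {1..} (\<lambda>\<xi> X. inverse \<xi> * (X $ 7 * X $ 6))
    (\<lambda>\<xi> X. \<gamma> * ((\<xi> * X $ 7) * (inverse \<xi> * X $ 7)) + (- k4) * ((\<xi> * X $ 7) * X $ 6) +
      (- k3) * ((\<xi> * X $ 7) * (inverse \<xi> * X $ 5)) +
      (- k1) * ((\<xi> * X $ 7) * (inverse \<xi> ^ 2 * X $ 1)) - \<gamma> * (X $ 6)\<^sup>2)"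
    by (rule flow_derivative_highI, rule DERIV_cong,
      (rule real_solutionD derivative_intros | assumption)+, algebra)
qed ((rule form_rules abs_inverse_le_1 | assumption)+,
    (rule controls_rules controls_high_eta bounded_high_power square_controls square_bounded abs_inverse_le_1 cone_square_weight[OF cone_bounded_by] | simp add: pos add_pos_pos)+)

text \<open>The obstacle is \<open>(k3 - k1) \<xi> u \<theta>\<close>: the weight
  \<open>inverse \<xi> ^ 2\<close> turns it into \<open>\<theta>\<close> times
  \<open>inverse \<xi> * u\<close>, at the cost of one power of \<open>\<xi>\<close> on
  \<open>v\<close>.\<close>

lemma controls_high_v: "controls {1..} high_rate (\<lambda>\<xi> X. (inverse \<xi> * X $ 1)\<^sup>2)"
proof (rule controls_step)
  show "flow_derivative {1..} (\<lambda>\<xi> X. inverse \<xi> ^ 2 * (k1 * (X $ 1 * X $ 6) + k3 * (X $ 2 * X $ 5)))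
    (\<lambda>\<xi> X. k1 * (X $ 6 * (inverse \<xi> ^ 2 * X $ 4)) + k1 * (X $ 6 * (inverse \<xi> ^ 2 * X $ 6)) +
      (k1 * \<gamma>) * ((\<xi> * X $ 7) * (inverse \<xi> ^ 2 * X $ 1)) +
      (k3 - k1) * (X $ 6 * (inverse \<xi> * X $ 2)) - (k1 * k1) * (inverse \<xi> * X $ 1)\<^sup>2)"
    by (rule flow_derivative_highI, rule DERIV_cong,
      (rule real_solutionD derivative_intros | assumption)+, algebra)
qed ((rule form_rules abs_inverse_le_1 | assumption)+,
    (rule controls_rules controls_high_eta controls_high_theta bounded_high_power square_controls square_bounded abs_inverse_le_1 cone_square_weight[OF cone_bounded_by] | simp add: pos add_pos_pos)+)

lemma controls_high_phi: "controls {1..} high_rate (\<lambda>\<xi> X. (X $ 5)\<^sup>2)"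
proof (rule controls_step)
  show "flow_derivative {1..} (\<lambda>\<xi> X. inverse \<xi> * (X $ 6 * X $ 5))
    (\<lambda>\<xi> X. 1 * (X $ 6 * X $ 6) + (- k1) * ((inverse \<xi> * X $ 1) * X $ 5) +
      \<gamma> * ((\<xi> * X $ 7) * (inverse \<xi> * X $ 5)) - k3 * (X $ 5)\<^sup>2)"
    by (rule flow_derivative_highI, rule DERIV_cong,
      (rule real_solutionD derivative_intros | assumption)+, algebra)
qed ((rule form_rules abs_inverse_le_1 | assumption)+,
    (rule controls_rules controls_high_eta controls_high_theta controls_high_v bounded_high_power square_controls square_bounded abs_inverse_le_1 cone_square_weight[OF cone_bounded_by] | simp add: pos add_pos_pos)+)

text \<open>The weight \<open>\<xi>^(-4)\<close> is forced by \<open>k2 \<xi> v z\<close>, which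
  must split into \<open>inverse \<xi> * v\<close> and \<open>inverse \<xi> ^ 2 * z\<close>. It is
  multiplied out in the functional because a bare factor \<open>\<xi>\<close> is unbounded
  here.\<close>

lemma controls_high_y_u: "controls {1..} high_rate (\<lambda>\<xi> X. (inverse \<xi> ^ 2 * (X $ 4 - \<xi> * X $ 2))\<^sup>2)"
proof (rule controls_step)
  show "flow_derivative {1..} (\<lambda>\<xi> X. X $ 1 * (inverse \<xi> ^ 3 * X $ 2 - inverse \<xi> ^ 4 * X $ 4))
    (\<lambda>\<xi> X. (- 1) * (X $ 6 * (inverse \<xi> ^ 4 * (X $ 4 - \<xi> * X $ 2))) +
      1 * ((inverse \<xi> * X $ 1) * (k1 * (inverse \<xi> ^ 3 * X $ 1) + k1 * (inverse \<xi> * X $ 1) + k2 * (inverse \<xi> ^ 2 * X $ 3))) - 1 * (inverse \<xi> ^ 2 * (X $ 4 - \<xi> * X $ 2))\<^sup>2)"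
    by (rule flow_derivative_highI, rule DERIV_cong,
      (rule real_solutionD derivative_intros | assumption)+, algebra)
qed ((rule form_rules abs_inverse_le_1 | assumption)+,
    (rule controls_rules controls_high_eta controls_high_theta controls_high_v controls_high_phi bounded_high_power square_controls square_bounded abs_inverse_le_1 cone_square_weight[OF cone_bounded_by] | simp add: pos add_pos_pos)+)

lemma controls_high_y: "controls {1..} high_rate (\<lambda>\<xi> X. (inverse \<xi> ^ 2 * X $ 4)\<^sup>2)"
proof (rule controls_step)
  show "flow_derivative {1..} (\<lambda>\<xi> X. inverse \<xi> ^ 4 * (- k1 * (X $ 1 * X $ 4) - k2 * (X $ 2 * X $ 3)))
    (\<lambda>\<xi> X. (- k1) * (X $ 6 * (inverse \<xi> ^ 4 * X $ 4)) +
      (k1 * k1) * ((inverse \<xi> * X $ 1) * (inverse \<xi> ^ 3 * X $ 1)) +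
      (k2 - k1) * ((inverse \<xi> ^ 2 * (X $ 4 - \<xi> * X $ 2)) * (inverse \<xi> ^ 2 * X $ 4)) - k2 * (inverse \<xi> ^ 2 * X $ 4)\<^sup>2)"
    by (rule flow_derivativeI, rule DERIV_cong,
      (rule real_solutionD derivative_intros | assumption)+, algebra)
qed ((rule form_rules abs_inverse_le_1 | assumption)+,
    (rule controls_rules controls_high_eta controls_high_theta controls_high_v controls_high_phi controls_high_y_u bounded_high_power square_controls square_bounded abs_inverse_le_1 cone_square_weight[OF cone_bounded_by] | simp add: pos add_pos_pos)+)

text \<open>The term \<open>- k2 \<xi> z\<close> in the equation of \<open>y\<close> makes
  \<open>y z\<close> dissipate \<open>k2 \<xi> z\<^sup>2\<close>; five inverse powers bring this to
  the weight of \<open>high_rate\<close>.\<close>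

lemma controls_high_z: "controls {1..} high_rate (\<lambda>\<xi> X. (inverse \<xi> ^ 2 * X $ 3)\<^sup>2)"
proof (rule controls_step)
  show "flow_derivative {1..} (\<lambda>\<xi> X. inverse \<xi> ^ 5 * (X $ 4 * X $ 3))
    (\<lambda>\<xi> X. (- k1) * ((inverse \<xi> * X $ 1) * (inverse \<xi> ^ 4 * X $ 3)) +
      1 * ((inverse \<xi> ^ 2 * X $ 4) * (inverse \<xi> ^ 2 * X $ 4)) - k2 * (inverse \<xi> ^ 2 * X $ 3)\<^sup>2)"
    by (rule flow_derivative_highI, rule DERIV_cong,
      (rule real_solutionD derivative_intros | assumption)+, algebra)
qed ((rule form_rules abs_inverse_le_1 | assumption)+,
    (rule controls_rules controls_high_eta controls_high_theta controls_high_v controls_high_phi controls_high_y_u controls_high_y bounded_high_power square_controls square_bounded abs_inverse_le_1 cone_square_weight[OF cone_bounded_by] | simp add: pos add_pos_pos)+)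

text \<open>Division by \<open>\<xi>\<close> is a gain at high frequencies, so in contrast to low
  ones \<open>u\<close> can be read off from \<open>y\<close> and \<open>y - \<xi> u\<close> without
  a further functional.\<close>

lemma controls_high_u: "controls {1..} high_rate (\<lambda>\<xi> X. (inverse \<xi> * X $ 2)\<^sup>2)"
proof (rule cone_mono[OF cone_controls, OF _ zero_less_one])
  show "controls {1..} high_rate (\<lambda>\<xi> X. (inverse \<xi> ^ 2 * X $ 4 - inverse \<xi> ^ 2 * (X $ 4 - \<xi> * X $ 2))\<^sup>2)"
    by (rule square_controls controls_high_y controls_high_y_u)+
  fix \<xi> :: real and X :: "real^7" assume "\<xi> \<in> {1..}"
  then have "inverse \<xi> * \<xi> = 1" by simp
  then show "(inverse \<xi> * X $ 2)\<^sup>2 \<le> 1 * (inverse \<xi> ^ 2 * X $ 4 - inverse \<xi> ^ 2 * (X $ 4 - \<xi> * X $ 2))\<^sup>2" by (intro eq_refl, algebra)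
qed

lemma decay_high:
  "\<exists>C>0. \<exists>c>0. \<forall>\<xi>\<in>{1..}. \<forall>x. real_solution \<xi> x \<longrightarrow>
    (\<forall>t\<ge>0. (norm (x t))\<^sup>2 \<le> C * exp (- c * inverse \<xi> ^ 4 * t) * (norm (x 0))\<^sup>2)"
proof (rule controls_decay)
  have "controls {1..} high_rate (\<lambda>\<xi> X. (\<xi> * X $ 7)\<^sup>2
     + (inverse \<xi> * X $ 1)\<^sup>2
     + (inverse \<xi> * X $ 2)\<^sup>2
     + (inverse \<xi> ^ 2 * X $ 3)\<^sup>2
     + (inverse \<xi> ^ 2 * X $ 4)\<^sup>2
     + (X $ 5)\<^sup>2
     + (X $ 6)\<^sup>2)"
    by (rule cone_add[OF cone_controls] controls_high_eta controls_high_theta controls_high_v controls_high_phi controls_high_y_u controls_high_y controls_high_z controls_high_u)+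
  then show "controls {1..} high_rate high_rate" by (simp add: high_rate_def[abs_def])
  fix \<xi> :: real and X :: "real^7" assume "\<xi> \<in> {1..}"
  then have \<xi>: "1 \<le> \<xi>" by simp
  define h where "h = inverse \<xi>"
  have h: "0 \<le> h" "h \<le> 1" using \<xi> by (simp_all add: h_def field_simps)
  show "0 \<le> inverse \<xi> ^ 4" using h(1) by (simp add: h_def)
  have p: "h ^ 4 \<le> h ^ 2" "h ^ 4 \<le> 1" using h power_decreasing[of 2 4 h] power_le_one[of h 4] by auto
  have "1 \<le> \<xi>\<^sup>2" using \<xi> by simp
  note q = mult_right_mono[OF p(1)] mult_right_mono[OF p(2)] mult_right_mono[OF order_trans[OF p(2) this]]
  have "h ^ 4 * (norm X)\<^sup>2 \<le> high_rate \<xi> X"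
    using q(1)[of "(X $ 1)\<^sup>2"] q(1)[of "(X $ 2)\<^sup>2"] q(2)[of "(X $ 5)\<^sup>2"] q(2)[of "(X $ 6)\<^sup>2"] q(3)[of "(X $ 7)\<^sup>2"]
    by (simp add: high_rate_def norm_sq_7 power_mult_distrib distrib_left flip: h_def power_mult)
  then show "inverse \<xi> ^ 4 * (norm X)\<^sup>2 \<le> high_rate \<xi> X" by (simp add: h_def)
qed

section \<open>High frequencies with equal constants\<close>

lemma controls_equal_theta: "controls {1..} equal_rate (\<lambda>\<xi> X. (X $ 6)\<^sup>2)"
proof (rule controls_step)
  show "flow_derivative {1..} (\<lambda>\<xi> X. inverse \<xi> * (X $ 7 * X $ 6))
    (\<lambda>\<xi> X. \<gamma> * ((\<xi> * X $ 7) * (inverse \<xi> * X $ 7)) + (- k4) * ((\<xi> * X $ 7) * X $ 6) +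
      (- k3) * ((\<xi> * X $ 7) * (inverse \<xi> * X $ 5)) +
      (- k1) * ((\<xi> * X $ 7) * (inverse \<xi> ^ 2 * X $ 1)) - \<gamma> * (X $ 6)\<^sup>2)"
    by (rule flow_derivative_highI, rule DERIV_cong,
      (rule real_solutionD derivative_intros | assumption)+, algebra)
qed ((rule form_rules abs_inverse_le_1 | assumption)+,
    (rule controls_rules controls_equal_eta bounded_equal bounded_eta_high[OF bounded_equal(1)] square_controls square_bounded abs_inverse_le_1 cone_square_weight[OF cone_bounded_by] | simp add: pos add_pos_pos)+)

text \<open>For equal constants the terms \<open>\<xi> u \<theta>\<close> from the two products
  cancel, so no negative power of \<open>\<xi>\<close> is needed in the functional.\<close>

lemma controls_equal_v:
  assumes eq: "k2 = k1" "k3 = k1"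
  shows "controls {1..} equal_rate (\<lambda>\<xi> X. (X $ 1)\<^sup>2)"
proof (rule controls_step)
  show "flow_derivative {1..} (\<lambda>\<xi> X. (X $ 1 * X $ 6 + X $ 2 * X $ 5))
    (\<lambda>\<xi> X. 1 * (X $ 6 * X $ 4) + 1 * (X $ 6 * X $ 6) + \<gamma> * ((\<xi> * X $ 7) * X $ 1) - k1 * (X $ 1)\<^sup>2)"
    by (rule flow_derivativeI, rule DERIV_cong,
      (rule real_solutionD derivative_intros | assumption)+, unfold eq, algebra)
qed ((rule form_rules abs_inverse_le_1 | assumption)+,
    (rule controls_rules controls_equal_eta controls_equal_theta bounded_equal bounded_eta_high[OF bounded_equal(1)] square_controls square_bounded abs_inverse_le_1 cone_square_weight[OF cone_bounded_by] | simp add: pos add_pos_pos)+)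

lemma controls_equal_phi:
  assumes eq: "k2 = k1" "k3 = k1"
  shows "controls {1..} equal_rate (\<lambda>\<xi> X. (X $ 5)\<^sup>2)"
proof (rule controls_step)
  show "flow_derivative {1..} (\<lambda>\<xi> X. inverse \<xi> * (X $ 6 * X $ 5))
    (\<lambda>\<xi> X. 1 * (X $ 6 * X $ 6) + (- k1) * (X $ 1 * (inverse \<xi> * X $ 5)) +
      \<gamma> * ((\<xi> * X $ 7) * (inverse \<xi> * X $ 5)) - k3 * (X $ 5)\<^sup>2)"
    by (rule flow_derivative_highI, rule DERIV_cong,
      (rule real_solutionD derivative_intros | assumption)+, algebra)
qed ((rule form_rules abs_inverse_le_1 | assumption)+,
    (rule controls_rules controls_equal_eta controls_equal_theta controls_equal_v[OF eq] bounded_equal bounded_eta_high[OF bounded_equal(1)] square_controls square_bounded abs_inverse_le_1 cone_square_weight[OF cone_bounded_by] | simp add: pos add_pos_pos)+)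

text \<open>Here the terms \<open>\<xi> u y\<close> cancel, so that \<open>- y\<^sup>2\<close> is
  obtained without first controlling \<open>y - \<xi> u\<close>.\<close>

lemma controls_equal_y:
  assumes eq: "k2 = k1" "k3 = k1"
  shows "controls {1..} equal_rate (\<lambda>\<xi> X. (X $ 4)\<^sup>2)"
proof (rule controls_step)
  show "flow_derivative {1..} (\<lambda>\<xi> X. ((- 1) * (X $ 1 * X $ 4) - X $ 2 * X $ 3))
    (\<lambda>\<xi> X. (- 1) * (X $ 6 * X $ 4) + k1 * (X $ 1 * X $ 1) - 1 * (X $ 4)\<^sup>2)"
    by (rule flow_derivativeI, rule DERIV_cong,
      (rule real_solutionD derivative_intros | assumption)+, unfold eq, algebra)
qed ((rule form_rules abs_inverse_le_1 | assumption)+,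
    (rule controls_rules controls_equal_eta controls_equal_theta controls_equal_v[OF eq] controls_equal_phi[OF eq] bounded_equal bounded_eta_high[OF bounded_equal(1)] square_controls square_bounded abs_inverse_le_1 cone_square_weight[OF cone_bounded_by] | simp add: pos add_pos_pos)+)

lemma controls_equal_z:
  assumes eq: "k2 = k1" "k3 = k1"
  shows "controls {1..} equal_rate (\<lambda>\<xi> X. (X $ 3)\<^sup>2)"
proof (rule controls_step)
  show "flow_derivative {1..} (\<lambda>\<xi> X. inverse \<xi> * (X $ 4 * X $ 3))
    (\<lambda>\<xi> X. (- k1) * (X $ 1 * (inverse \<xi> * X $ 3)) + 1 * (X $ 4 * X $ 4) - k2 * (X $ 3)\<^sup>2)"
    by (rule flow_derivative_highI, rule DERIV_cong,
      (rule real_solutionD derivative_intros | assumption)+, algebra)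
qed ((rule form_rules abs_inverse_le_1 | assumption)+,
    (rule controls_rules controls_equal_eta controls_equal_theta controls_equal_v[OF eq] controls_equal_phi[OF eq] controls_equal_y[OF eq] bounded_equal bounded_eta_high[OF bounded_equal(1)] square_controls square_bounded abs_inverse_le_1 cone_square_weight[OF cone_bounded_by] | simp add: pos add_pos_pos)+)

text \<open>Once \<open>y\<close> and \<open>\<theta>\<close> are controlled, the equation of
  \<open>v\<close> gives access to \<open>- \<xi> u\<close> directly.\<close>

lemma controls_equal_u:
  assumes eq: "k2 = k1" "k3 = k1"
  shows "controls {1..} equal_rate (\<lambda>\<xi> X. (X $ 2)\<^sup>2)"
proof (rule controls_step)
  show "flow_derivative {1..} (\<lambda>\<xi> X. inverse \<xi> * (X $ 1 * X $ 2))
    (\<lambda>\<xi> X. 1 * (X $ 4 * (inverse \<xi> * X $ 2)) + 1 * (X $ 6 * (inverse \<xi> * X $ 2)) +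
      k1 * (X $ 1 * X $ 1) - 1 * (X $ 2)\<^sup>2)"
    by (rule flow_derivative_highI, rule DERIV_cong,
      (rule real_solutionD derivative_intros | assumption)+, algebra)
qed ((rule form_rules abs_inverse_le_1 | assumption)+,
    (rule controls_rules controls_equal_eta controls_equal_theta controls_equal_v[OF eq] controls_equal_phi[OF eq] controls_equal_y[OF eq] controls_equal_z[OF eq] bounded_equal bounded_eta_high[OF bounded_equal(1)] square_controls square_bounded abs_inverse_le_1 cone_square_weight[OF cone_bounded_by] | simp add: pos add_pos_pos)+)

lemma decay_equal:
  assumes eq: "k2 = k1" "k3 = k1"
  shows "\<exists>C>0. \<exists>c>0. \<forall>\<xi>\<in>{1..}. \<forall>x. real_solution \<xi> x \<longrightarrow>
    (\<forall>t\<ge>0. (norm (x t))\<^sup>2 \<le> C * exp (- c * 1 * t) * (norm (x 0))\<^sup>2)"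
proof (rule controls_decay)
  have "controls {1..} equal_rate (\<lambda>\<xi> X. (\<xi> * X $ 7)\<^sup>2
     + (X $ 1)\<^sup>2
     + (X $ 2)\<^sup>2
     + (X $ 3)\<^sup>2
     + (X $ 4)\<^sup>2
     + (X $ 5)\<^sup>2
     + (X $ 6)\<^sup>2)"
    by (rule cone_add[OF cone_controls] controls_equal_eta controls_equal_theta controls_equal_v[OF eq] controls_equal_phi[OF eq] controls_equal_y[OF eq] controls_equal_z[OF eq] controls_equal_u[OF eq])+
  then show "controls {1..} equal_rate equal_rate" by (simp add: equal_rate_def[abs_def])
  fix \<xi> :: real and X :: "real^7" assume "\<xi> \<in> {1..}"
  then have "1 \<le> \<xi>\<^sup>2" by simp
  then show "1 * (norm X)\<^sup>2 \<le> equal_rate \<xi> X"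
    using mult_right_mono[of 1 "\<xi>\<^sup>2" "(X $ 7)\<^sup>2"]
    by (simp add: equal_rate_def norm_sq_7 power_mult_distrib)
qed simp

end

section \<open>Decay of the complex system\<close>

text \<open>The flag \<open>e\<close> stands for the equality of \<open>k1\<close>,
  \<open>k2\<close> and \<open>k3\<close>.\<close>

definition decay_rate :: "bool \<Rightarrow> real \<Rightarrow> real" where
  "decay_rate e \<xi> = (if \<bar>\<xi>\<bar> \<le> 1 then \<xi> ^ 4 else if e then 1 else inverse \<xi> ^ 4)"

context laminated
begin

lemma decay_real:
  "\<exists>C>0. \<exists>c>0. \<forall>\<xi>\<ge>0. \<forall>x. real_solution \<xi> x \<longrightarrow> (\<forall>t\<ge>0.
    (norm (x t))\<^sup>2 \<le> C * exp (- c * decay_rate (k1 = k2 \<and> k2 = k3) \<xi> * t) * (norm (x 0))\<^sup>2)"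
proof -
  let ?e = "k1 = k2 \<and> k2 = k3"
  obtain C1 c1 where 1: "C1 > 0" "c1 > 0" "\<forall>\<xi>\<in>{0..1}. \<forall>x. real_solution \<xi> x \<longrightarrow>
    (\<forall>t\<ge>0. (norm (x t))\<^sup>2 \<le> C1 * exp (- c1 * \<xi> ^ 4 * t) * (norm (x 0))\<^sup>2)"
    using decay_low by (elim exE conjE)
  have "\<exists>C>0. \<exists>c>0. \<forall>\<xi>\<in>{1..}. \<forall>x. real_solution \<xi> x \<longrightarrow> (\<forall>t\<ge>0. (norm (x t))\<^sup>2 \<le>
      C * exp (- c * (if ?e then 1 else inverse \<xi> ^ 4) * t) * (norm (x 0))\<^sup>2)"
  proof (cases ?e)
    case True
    then show ?thesis unfolding if_P[OF True] by (intro decay_equal) auto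
  next
    case False
    show ?thesis unfolding if_not_P[OF False] by (rule decay_high)
  qed
  then obtain C2 c2 where 2: "C2 > 0" "c2 > 0" "\<forall>\<xi>\<in>{1..}. \<forall>x. real_solution \<xi> x \<longrightarrow>
    (\<forall>t\<ge>0. (norm (x t))\<^sup>2 \<le> C2 * exp (- c2 * (if ?e then 1 else inverse \<xi> ^ 4) * t) * (norm (x 0))\<^sup>2)"
    by (elim exE conjE) (rule that)
  have mono: "K * exp (- k * r * t) * n \<le> max C1 C2 * exp (- min c1 c2 * r * t) * n"
    if "K \<le> max C1 C2" "min c1 c2 \<le> k" "0 \<le> r" "0 \<le> t" "0 \<le> n" for K k r t n :: real
    using that 1(1) by (intro mult_right_mono mult_mono) (auto simp: mult_right_mono)
  show ?thesis
  proof (rule exI[of _ "max C1 C2"], intro conjI exI[of _ "min c1 c2"] allI impI)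
    fix \<xi> t :: real and x assume *: "0 \<le> \<xi>" "real_solution \<xi> x" "0 \<le> t"
    show "(norm (x t))\<^sup>2 \<le> max C1 C2 * exp (- min c1 c2 * decay_rate ?e \<xi> * t) * (norm (x 0))\<^sup>2"
    proof (cases "\<xi> \<le> 1")
      case True
      then have "(norm (x t))\<^sup>2 \<le> C1 * exp (- c1 * \<xi> ^ 4 * t) * (norm (x 0))\<^sup>2"
        using 1(3) * by auto
      also have "\<dots> \<le> max C1 C2 * exp (- min c1 c2 * \<xi> ^ 4 * t) * (norm (x 0))\<^sup>2"
        using * by (intro mono) auto
      finally show ?thesis using True * by (simp add: decay_rate_def)
    next
      case False
      then have "(norm (x t))\<^sup>2 \<le> C2 * exp (- c2 * (if ?e then 1 else inverse \<xi> ^ 4) * t) * (norm (x 0))\<^sup>2"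
        using 2(3) * by auto
      also have "\<dots> \<le> max C1 C2 * exp (- min c1 c2 * (if ?e then 1 else inverse \<xi> ^ 4) * t) * (norm (x 0))\<^sup>2"
        using * by (intro mono) auto
      finally show ?thesis using False * by (simp add: decay_rate_def)
    qed
  qed (use 1 2 in auto)
qed

text \<open>\<open>s\<close> is the sign of \<open>\<xi>\<close>: changing the sign of
  \<open>u\<close>, \<open>z\<close>, \<open>\<phi>\<close> and \<open>\<eta>\<close> replaces
  \<open>\<xi>\<close> by its absolute value, so nonnegative frequencies suffice. \<open>p\<close>
  will be the real or the imaginary part, which are linear over the reals.\<close>

lemma real_solution_of_ode:
  assumes ode: "laminated_ode k1 k2 k3 k4 \<gamma> \<xi> W" and p: "bounded_linear p"
    and s: "s * \<xi> = \<bar>\<xi>\<bar>" "s * s = 1"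
    and x: "\<And>t. x t $ 1 = p (W t $ 1)" "\<And>t. x t $ 2 = s * p (- \<i> * W t $ 2)"
      "\<And>t. x t $ 3 = s * p (- \<i> * W t $ 3)" "\<And>t. x t $ 4 = p (W t $ 4)"
      "\<And>t. x t $ 5 = s * p (- \<i> * W t $ 5)" "\<And>t. x t $ 6 = p (W t $ 6)"
      "\<And>t. x t $ 7 = s * p (- \<i> * W t $ 7)"
  shows "real_solution \<bar>\<xi>\<bar> x"
  unfolding real_solution_def
proof (intro allI impI)
  fix t :: real assume t: "t \<ge> 0"
  interpret p: bounded_linear p by (rule p)
  have pr: "p (of_real a * z) = a * p z" for a z using p.scaleR[of a z] by (simp add: scaleR_conv_of_real)
  have d: "((\<lambda>t. p (f t)) has_real_derivative p f') (at t within {0..})"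
    if "(f has_vector_derivative f') (at t within {0..})" for f f'
    using p.has_vector_derivative[OF that] by (simp add: has_real_derivative_iff_has_vector_derivative)
  have d': "((\<lambda>t. s * p (- \<i> * f t)) has_real_derivative s * p (- \<i> * f')) (at t within {0..})"
    if "(f has_vector_derivative f') (at t within {0..})" for f f'
    using has_vector_derivative_mult_right[OF that, of "- \<i>"] by (intro DERIV_cmult d)
  have \<xi>: "\<xi> = s * \<bar>\<xi>\<bar>" using s by (metis mult.assoc mult_1)
  have q: "p (\<i> * of_real \<xi> * z) = - \<bar>\<xi>\<bar> * (s * p (- \<i> * z))" for z
  proof -
    have "p (\<i> * of_real \<xi> * z) = p (of_real (- \<xi>) * (- \<i> * z))" by (simp add: mult_ac)
    also have "\<dots> = - \<xi> * p (- \<i> * z)" by (rule pr)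
    finally show ?thesis by (subst (asm) (2) \<xi>) (simp add: mult_ac)
  qed
  have q': "s * p (- \<i> * (\<i> * of_real \<xi> * z)) = \<bar>\<xi>\<bar> * p z" for z
  proof -
    have "p (- \<i> * (\<i> * of_real \<xi> * z)) = p (of_real \<xi> * z)" by (simp add: mult.assoc[symmetric])
    then show ?thesis using pr[of \<xi> z] s by (simp add: mult.assoc[symmetric])
  qed
  note o = ode[unfolded laminated_ode_def Let_def, rule_format, OF t]
  have m: "- \<i> * (of_real k * z) = of_real k * (- \<i> * z)" for k z by simp
  have ps: "s * p (- \<i> * (of_real k * (\<i> * of_real \<xi> * z))) = k * (\<bar>\<xi>\<bar> * p z)" for k z
    unfolding m pr using q'[of z] by (simp add: mult.left_commute)
  have "s * p (- \<i> * (of_real k4 * ((\<i> * of_real \<xi>)\<^sup>2 * W t $ 7) - of_real \<gamma> * (\<i> * of_real \<xi> * W t $ 6)))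
    = - k4 * \<bar>\<xi>\<bar>\<^sup>2 * (s * p (- \<i> * W t $ 7)) - \<gamma> * \<bar>\<xi>\<bar> * p (W t $ 6)"
  proof -
    have "- \<i> * (of_real k4 * ((\<i> * of_real \<xi>)\<^sup>2 * W t $ 7)) = of_real (- k4 * \<xi>\<^sup>2) * (- \<i> * W t $ 7)"
      by (simp add: power_mult_distrib)
    then have "s * p (- \<i> * (of_real k4 * ((\<i> * of_real \<xi>)\<^sup>2 * W t $ 7))) = - k4 * \<bar>\<xi>\<bar>\<^sup>2 * (s * p (- \<i> * W t $ 7))"
      using pr[of "- k4 * \<xi>\<^sup>2" "- \<i> * W t $ 7"] by simp
    then show ?thesis
      using ps[of \<gamma> "W t $ 6"] unfolding right_diff_distrib p.diff by simp
  qed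
  note e7 = this
  show "((\<lambda>t. x t $ 1) has_real_derivative - \<bar>\<xi>\<bar> * x t $ 2 + x t $ 4 + x t $ 6) (at t within {0..}) \<and>
     ((\<lambda>t. x t $ 2) has_real_derivative k1 * \<bar>\<xi>\<bar> * x t $ 1) (at t within {0..}) \<and>
     ((\<lambda>t. x t $ 3) has_real_derivative \<bar>\<xi>\<bar> * x t $ 4) (at t within {0..}) \<and>
     ((\<lambda>t. x t $ 4) has_real_derivative - k2 * \<bar>\<xi>\<bar> * x t $ 3 - k1 * x t $ 1) (at t within {0..}) \<and>
     ((\<lambda>t. x t $ 5) has_real_derivative \<bar>\<xi>\<bar> * x t $ 6) (at t within {0..}) \<and>
     ((\<lambda>t. x t $ 6) has_real_derivative
        - k3 * \<bar>\<xi>\<bar> * x t $ 5 - k1 * x t $ 1 + \<gamma> * \<bar>\<xi>\<bar> * x t $ 7) (at t within {0..}) \<and>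
     ((\<lambda>t. x t $ 7) has_real_derivative
        - k4 * \<bar>\<xi>\<bar>\<^sup>2 * x t $ 7 - \<gamma> * \<bar>\<xi>\<bar> * x t $ 6) (at t within {0..})"
    unfolding x
  proof (intro conjI)
    show "((\<lambda>t. p (W t $ 1)) has_real_derivative
        - \<bar>\<xi>\<bar> * (s * p (- \<i> * W t $ 2)) + p (W t $ 4) + p (W t $ 6)) (at t within {0..})"
      by (rule DERIV_cong[OF d[OF o[THEN conjunct1]]]) (simp only: p.add q)
    show "((\<lambda>t. s * p (- \<i> * W t $ 2)) has_real_derivative k1 * \<bar>\<xi>\<bar> * p (W t $ 1)) (at t within {0..})"
      by (rule DERIV_cong[OF d'[OF o[THEN conjunct2, THEN conjunct1]]]) (rule trans[OF ps], algebra)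
    show "((\<lambda>t. s * p (- \<i> * W t $ 3)) has_real_derivative \<bar>\<xi>\<bar> * p (W t $ 4)) (at t within {0..})"
      by (rule DERIV_cong[OF d'[OF o[THEN conjunct2, THEN conjunct2, THEN conjunct1]]]) (simp only: q')
    show "((\<lambda>t. p (W t $ 4)) has_real_derivative
        - k2 * \<bar>\<xi>\<bar> * (s * p (- \<i> * W t $ 3)) - k1 * p (W t $ 1)) (at t within {0..})"
      by (rule DERIV_cong[OF d[OF o[THEN conjunct2, THEN conjunct2, THEN conjunct2, THEN conjunct1]]])
        (simp only: p.diff pr q)
    show "((\<lambda>t. s * p (- \<i> * W t $ 5)) has_real_derivative \<bar>\<xi>\<bar> * p (W t $ 6)) (at t within {0..})"
      by (rule DERIV_cong[OF d'[OF o[THEN conjunct2, THEN conjunct2, THEN conjunct2, THEN conjunct2, THEN conjunct1]]])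
        (simp only: q')
    show "((\<lambda>t. p (W t $ 6)) has_real_derivative - k3 * \<bar>\<xi>\<bar> * (s * p (- \<i> * W t $ 5)) - k1 * p (W t $ 1)
        + \<gamma> * \<bar>\<xi>\<bar> * (s * p (- \<i> * W t $ 7))) (at t within {0..})"
      by (rule DERIV_cong[OF d[OF o[THEN conjunct2, THEN conjunct2, THEN conjunct2, THEN conjunct2, THEN conjunct2, THEN conjunct1]]])
        (simp only: p.diff pr q)
    show "((\<lambda>t. s * p (- \<i> * W t $ 7)) has_real_derivative
        - k4 * \<bar>\<xi>\<bar>\<^sup>2 * (s * p (- \<i> * W t $ 7)) - \<gamma> * \<bar>\<xi>\<bar> * p (W t $ 6)) (at t within {0..})"
      by (rule DERIV_cong[OF d'[OF o[THEN conjunct2, THEN conjunct2, THEN conjunct2, THEN conjunct2, THEN conjunct2, THEN conjunct2]]])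
        (rule e7)
  qed
qed

lemma decay_complex:
  "\<exists>C>0. \<exists>c>0. \<forall>\<xi> W t. laminated_ode k1 k2 k3 k4 \<gamma> \<xi> W \<longrightarrow> 0 \<le> t \<longrightarrow>
    (norm (W t))\<^sup>2 \<le> C * exp (- c * decay_rate (k1 = k2 \<and> k2 = k3) \<xi> * t) * (norm (W 0))\<^sup>2"
proof -
  let ?e = "k1 = k2 \<and> k2 = k3"
  obtain C c where C: "C > 0" "c > 0" "\<forall>\<xi>\<ge>0. \<forall>x. real_solution \<xi> x \<longrightarrow> (\<forall>t\<ge>0.
    (norm (x t))\<^sup>2 \<le> C * exp (- c * decay_rate ?e \<xi> * t) * (norm (x 0))\<^sup>2)"
    using decay_real by (elim exE conjE)
  have "(norm (W t))\<^sup>2 \<le> C * exp (- c * decay_rate ?e \<xi> * t) * (norm (W 0))\<^sup>2"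
    if ode: "laminated_ode k1 k2 k3 k4 \<gamma> \<xi> W" and t: "0 \<le> t" for \<xi> W t
  proof -
    define s :: real where "s = (if \<xi> < 0 then - 1 else 1)"
    have s: "s * \<xi> = \<bar>\<xi>\<bar>" "s * s = 1" by (auto simp: s_def)
    have s2: "(s * a)\<^sup>2 = a\<^sup>2" for a using s(2) by (simp add: power_mult_distrib power2_eq_square[of s])
    define x :: "(complex \<Rightarrow> real) \<Rightarrow> real \<Rightarrow> real^7" where
      "x p t = (\<chi> i. if i = 1 \<or> i = 4 \<or> i = 6 then p (W t $ i) else s * p (- \<i> * W t $ i))" for p t
    have dec: "(norm (x p t))\<^sup>2 \<le> C * exp (- c * decay_rate ?e \<xi> * t) * (norm (x p 0))\<^sup>2"
      if "bounded_linear p" for p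
    proof -
      have "real_solution \<bar>\<xi>\<bar> (x p)"
        by (rule real_solution_of_ode[OF ode that s]) (simp_all add: x_def)
      moreover have "decay_rate ?e \<bar>\<xi>\<bar> = decay_rate ?e \<xi>"
        by (simp add: decay_rate_def power_inverse)
      ultimately show ?thesis using C(3) t by (metis abs_ge_zero)
    qed
    \<comment> \<open>Neither \<open>- \<i>\<close> nor \<open>s\<close> changes the modulus, so the
      two real states together carry the full norm.\<close>
    have nm: "(norm (W r))\<^sup>2 = (norm (x Re r))\<^sup>2 + (norm (x Im r))\<^sup>2" for r
      by (simp add: norm_sq_7 x_def s2 cmod_power2)
    show ?thesis
      using dec[OF bounded_linear_Re] dec[OF bounded_linear_Im]
      unfolding nm[of t] nm[of 0] distrib_left by linarith
  qed
  then show ?thesis using C by blast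
qed

end

section \<open>The Fourier transform of integrable functions\<close>

abbreviation sq_int :: "(real \<Rightarrow> 'a::real_normed_vector) \<Rightarrow> ennreal" where
  "sq_int f \<equiv> \<integral>\<^sup>+x. ennreal ((norm (f x))\<^sup>2) \<partial>lborel"

text \<open>Scalar counterpart of \<open>fourier\<close>. The kernel carries no normalising factor,
  whence the factors \<open>2 * pi\<close> below.\<close>

definition ft :: "(real \<Rightarrow> complex) \<Rightarrow> real \<Rightarrow> complex" where
  "ft f \<xi> = (LINT x|lborel. cis (- (\<xi> * x)) * f x)"

lemma measurable_cis [measurable]: "cis \<in> borel_measurable borel"
  by (intro borel_measurable_continuous_onI continuous_intros)

lemma measurable_cnj [measurable]: "cnj \<in> borel_measurable borel"
  by (intro borel_measurable_continuous_onI continuous_intros)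

lemma integrable_cis_mult:
  assumes "integrable M f" "g \<in> borel_measurable M"
  shows "integrable M (\<lambda>x. cis (g x) * f x)"
  using assms by (intro Bochner_Integration.integrable_bound[OF assms(1)]) (auto simp: norm_mult)

lemma cmod_ft_le: "cmod (ft f \<xi>) \<le> (LINT x|lborel. cmod (f x))"
  unfolding ft_def using integral_norm_bound[of lborel "\<lambda>x. cis (- (\<xi> * x)) * f x"] by (simp add: norm_mult)

lemma measurable_ft [measurable]:
  assumes [measurable]: "f \<in> borel_measurable borel"
  shows "ft f \<in> borel_measurable borel"
  unfolding ft_def[abs_def] by measurable

lemma integrable_pair_mult:
  fixes f g :: "real \<Rightarrow> complex"
  assumes f: "integrable lborel f" and g: "integrable lborel g"
  shows "integrable (lborel \<Otimes>\<^sub>M lborel) (\<lambda>(x, y). f x * g y)"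
proof (rule lborel_pair.Fubini_integrable)
  note [measurable] = borel_measurable_integrable[OF f] borel_measurable_integrable[OF g]
  show "(\<lambda>(x, y). f x * g y) \<in> borel_measurable (lborel \<Otimes>\<^sub>M lborel)" by measurable
  show "integrable lborel (\<lambda>x. LINT y|lborel. norm (case (x, y) of (x, y) \<Rightarrow> f x * g y))"
    using f by (simp add: norm_mult)
  show "AE x in lborel. integrable lborel (\<lambda>y. case (x, y) of (x, y) \<Rightarrow> f x * g y)"
    using g by simp
qed

lemma integrable_pair_cis:
  fixes f g :: "real \<Rightarrow> complex"
  assumes f: "integrable lborel f" and g: "integrable lborel g"
  shows "integrable (lborel \<Otimes>\<^sub>M lborel) (\<lambda>(x, \<xi>). cis (- (\<xi> * x)) * (f x * g \<xi>))"
proof -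
  have "integrable (lborel \<Otimes>\<^sub>M lborel) (\<lambda>p. cis (- (snd p * fst p)) * (f (fst p) * g (snd p)))"
    using integrable_pair_mult[OF f g]
    by (intro integrable_cis_mult) (simp_all add: split_beta')
  then show ?thesis by (simp add: split_beta')
qed

text \<open>Fubini's theorem for a kernel that is symmetric in \<open>x\<close> and
  \<open>\<xi>\<close>.\<close>

lemma integral_ft_mult:
  assumes f: "integrable lborel f" and g: "integrable lborel g"
  shows "(LINT \<xi>|lborel. ft f \<xi> * g \<xi>) = (LINT x|lborel. f x * ft g x)"
proof -
  note I = integrable_pair_cis[OF f g]
  have "(LINT \<xi>|lborel. ft f \<xi> * g \<xi>) = (LINT \<xi>|lborel. LINT x|lborel. cis (- (\<xi> * x)) * (f x * g \<xi>))"
    unfolding ft_def by (simp add: mult_ac flip: integral_mult_left_zero integral_mult_right_zero)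
  also have "\<dots> = (LINT x|lborel. LINT \<xi>|lborel. cis (- (\<xi> * x)) * (f x * g \<xi>))"
    using lborel_pair.Fubini_integral[OF I] by simp
  also have "\<dots> = (LINT x|lborel. f x * ft g x)"
    unfolding ft_def by (simp add: mult_ac flip: integral_mult_left_zero integral_mult_right_zero)
  finally show ?thesis .
qed

section \<open>Gaussian damping of transforms\<close>

definition gauss :: "real \<Rightarrow> real \<Rightarrow> complex" where
  "gauss s \<xi> = of_real (exp (- ((s * \<xi>)\<^sup>2) / 2))"

lemma measurable_gauss [measurable]: "gauss s \<in> borel_measurable borel"
  unfolding gauss_def[abs_def] by measurable

lemma gauss_bounds: "cmod (gauss s \<xi>) \<le> 1" "0 \<le> Re (gauss s \<xi>)" "Im (gauss s \<xi>) = 0"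
  by (simp_all add: gauss_def)

lemma gauss_tendsto: "(\<lambda>n. gauss (1 / real (Suc n)) \<xi>) \<longlonglongrightarrow> 1"
proof -
  have "(\<lambda>n. exp (- ((1 / real (Suc n) * \<xi>)\<^sup>2) / 2)) \<longlonglongrightarrow> exp (- ((0 * \<xi>)\<^sup>2) / 2)"
    by (intro tendsto_intros LIMSEQ_Suc[OF lim_1_over_n]) auto
  then show ?thesis unfolding gauss_def by (metis (no_types) tendsto_of_real mult_zero_left zero_power2 
     minus_zero div_0 exp_zero of_real_1)
qed

lemma gauss_eq_normal_density:
  assumes "s > 0"
  shows "gauss s \<xi> = of_real (sqrt (2 * pi) / s * normal_density 0 (1 / s) \<xi>)"
  using assms by (simp add: gauss_def normal_density_def real_sqrt_mult real_sqrt_divide field_simps power_mult_distrib)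

lemma integrable_gauss: "s > 0 \<Longrightarrow> integrable lborel (gauss s)"
  by (subst ext[OF gauss_eq_normal_density], assumption)
    (intro integrable_of_real integrable_mult_right integrable_normal_density; simp)

text \<open>A rescaling of the characteristic function of the standard normal distribution.\<close>

lemma ft_gauss:
  assumes s: "s > 0"
  shows "ft (gauss s) x = of_real (2 * pi * normal_density 0 s x)"
proof -
  have "of_real (exp (- ((x / s)\<^sup>2) / 2)) = char std_normal_distribution (- x / s)"
    by (simp add: char_std_normal_distribution)
  also have "\<dots> = (LINT r|lborel. std_normal_density r *\<^sub>R cis (- x / s * r))"
    unfolding char_def by (subst integral_density) (auto simp: cis_conv_exp)
  also have "\<dots> = (LINT r|lborel. cis (- x / s * r) * of_real (std_normal_density r))"
    by (simp add: scaleR_conv_of_real mult.commute)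
  also have "\<dots> = s *\<^sub>R (LINT \<xi>|lborel. cis (- x / s * (0 + s * \<xi>)) * of_real (std_normal_density (0 + s * \<xi>)))"
    using s by (subst lborel_integral_real_affine[where c = s and t = 0]) auto
  also have "\<dots> = s *\<^sub>R (LINT \<xi>|lborel. (cis (- (x * \<xi>)) * gauss s \<xi>) * of_real (1 / sqrt (2 * pi)))"
    using s by (intro arg_cong2[of _ _ _ _ "(*\<^sub>R)"] Bochner_Integration.integral_cong)
      (auto simp: gauss_def normal_density_def)
  also have "\<dots> = of_real (s / sqrt (2 * pi)) * ft (gauss s) x"
    unfolding ft_def by (subst integral_mult_left_zero) (simp add: scaleR_conv_of_real)
  finally have *: "of_real (s / sqrt (2 * pi)) * ft (gauss s) x = of_real (exp (- ((x / s)\<^sup>2) / 2))" ..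
  have "2 * pi * normal_density 0 s x = sqrt (2 * pi) / s * exp (- ((x / s)\<^sup>2) / 2)"
    using s by (simp add: normal_density_def real_sqrt_mult field_simps power_divide)
  also have "complex_of_real \<dots> = of_real (sqrt (2 * pi) / s) * (of_real (s / sqrt (2 * pi)) * ft (gauss s) x)"
    unfolding * by simp
  also have "\<dots> = of_real (sqrt (2 * pi) / s * (s / sqrt (2 * pi))) * ft (gauss s) x"
    by (simp only: of_real_mult mult.assoc)
  also have "sqrt (2 * pi) / s * (s / sqrt (2 * pi)) = 1" using s by simp
  finally show ?thesis by simp
qed

text \<open>On the left stands a damped inversion integral; by the multiplication formula it is an
  average of \<open>f\<close> around \<open>x\<close> against a normal density of width
  \<open>s\<close>.\<close>

lemma integral_ft_gauss:
  assumes f: "integrable lborel f" and s: "s > 0"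
  shows "(LINT \<xi>|lborel. ft f \<xi> * (cis (\<xi> * x) * gauss s \<xi>)) =
    (LINT y|lborel. f y * of_real (2 * pi * normal_density 0 s (y - x)))"
proof -
  have "ft (\<lambda>\<xi>. cis (\<xi> * x) * gauss s \<xi>) y = ft (gauss s) (y - x)" for y
    unfolding ft_def by (intro Bochner_Integration.integral_cong) (auto simp: cis_mult algebra_simps simp flip: mult.assoc)
  then show ?thesis
    using integral_ft_mult[OF f integrable_cis_mult[OF integrable_gauss[OF s], of "\<lambda>\<xi>. \<xi> * x"]]
    by (simp add: ft_gauss[OF s])
qed

text \<open>Schur's test: \<open>f y * f z\<close> is at most the mean of the two squares, and the
  kernel has mass one in either variable.\<close>

lemma nn_integral_schur:
  fixes f g k :: "real \<Rightarrow> real"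
  assumes [measurable]: "f \<in> borel_measurable borel" "k \<in> borel_measurable borel"
    and k: "\<And>x. 0 \<le> k x" "(\<integral>\<^sup>+x. ennreal (k x) \<partial>lborel) = 1" and f: "\<And>x. 0 \<le> f x"
  shows "(\<integral>\<^sup>+y. \<integral>\<^sup>+z. ennreal (f y * (f z * k (z - y))) \<partial>lborel \<partial>lborel) \<le> (\<integral>\<^sup>+x. ennreal ((f x)\<^sup>2) \<partial>lborel)"
proof -
  have shift: "(\<integral>\<^sup>+z. ennreal (k (z - y)) \<partial>lborel) = 1" "(\<integral>\<^sup>+z. ennreal (k (y - z)) \<partial>lborel) = 1" for y
    using nn_integral_real_affine[of "\<lambda>x. ennreal (k x)" 1 "- y"]
      nn_integral_real_affine[of "\<lambda>x. ennreal (k x)" "- 1" y] k(2) by simp_all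
  let ?I = "\<integral>\<^sup>+x. ennreal ((f x)\<^sup>2) \<partial>lborel"
  have "f y * (f z * k (z - y)) \<le> (f y)\<^sup>2 / 2 * k (z - y) + (f z)\<^sup>2 / 2 * k (z - y)" for y z
    using mult_right_mono[OF sum_squares_bound[of "f y" "f z"] k(1)[of "z - y"]]
    by (simp add: algebra_simps)
  then have "(\<integral>\<^sup>+y. \<integral>\<^sup>+z. ennreal (f y * (f z * k (z - y))) \<partial>lborel \<partial>lborel)
      \<le> (\<integral>\<^sup>+y. \<integral>\<^sup>+z. ennreal ((f y)\<^sup>2 / 2) * ennreal (k (z - y)) + ennreal ((f z)\<^sup>2 / 2) * ennreal (k (z - y)) \<partial>lborel \<partial>lborel)"
    using k(1) by (intro nn_integral_mono) (simp flip: ennreal_mult ennreal_plus)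
  also have "\<dots> = (\<integral>\<^sup>+y. (\<integral>\<^sup>+z. ennreal ((f y)\<^sup>2 / 2) * ennreal (k (z - y)) \<partial>lborel) \<partial>lborel)
      + (\<integral>\<^sup>+y. (\<integral>\<^sup>+z. ennreal ((f z)\<^sup>2 / 2) * ennreal (k (z - y)) \<partial>lborel) \<partial>lborel)"
    by (simp add: nn_integral_add)
  also have "(\<integral>\<^sup>+y. (\<integral>\<^sup>+z. ennreal ((f y)\<^sup>2 / 2) * ennreal (k (z - y)) \<partial>lborel) \<partial>lborel) = (\<integral>\<^sup>+y. ennreal ((f y)\<^sup>2 / 2) \<partial>lborel)"
    by (simp add: nn_integral_cmult shift)
  also have "(\<integral>\<^sup>+y. (\<integral>\<^sup>+z. ennreal ((f z)\<^sup>2 / 2) * ennreal (k (z - y)) \<partial>lborel) \<partial>lborel)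
     = (\<integral>\<^sup>+z. (\<integral>\<^sup>+y. ennreal ((f z)\<^sup>2 / 2) * ennreal (k (z - y)) \<partial>lborel) \<partial>lborel)"
    by (rule lborel_pair.Fubini') measurable
  also have "\<dots> = (\<integral>\<^sup>+z. ennreal ((f z)\<^sup>2 / 2) \<partial>lborel)"
    by (simp add: nn_integral_cmult shift)
  also have "(\<integral>\<^sup>+y. ennreal ((f y)\<^sup>2 / 2) \<partial>lborel) + (\<integral>\<^sup>+z. ennreal ((f z)\<^sup>2 / 2) \<partial>lborel) = ?I"
    by (subst nn_integral_add[symmetric]) (auto simp flip: ennreal_plus)
  finally show ?thesis .
qed

lemma nn_integral_normal_density: "s > 0 \<Longrightarrow> (\<integral>\<^sup>+x. ennreal (normal_density 0 s x) \<partial>lborel) = 1"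
  by (subst nn_integral_eq_integral) (auto simp: integral_normal_density integrable_normal_density)

text \<open>For \<open>g = cnj (ft f) * gauss s\<close> the product \<open>ft f * g\<close> is the
  damped square. The multiplication formula moves the transform onto \<open>g\<close>, where it
  becomes a conjugated Gaussian average of \<open>f\<close>, and Schur's test bounds the resulting
  double integral.\<close>

lemma ft_bessel_gauss:
  assumes f: "integrable lborel f" and s: "s > 0"
  shows "(\<integral>\<^sup>+\<xi>. ennreal ((cmod (ft f \<xi>))\<^sup>2 * Re (gauss s \<xi>)) \<partial>lborel)
    \<le> ennreal (2 * pi) * sq_int f"
proof -
  note [measurable] = borel_measurable_integrable[OF f, simplified]
  define N where "N = (LINT x|lborel. cmod (f x))"
  define g where "g = (\<lambda>\<xi>. cnj (ft f \<xi>) * gauss s \<xi>)"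
  have [measurable]: "g \<in> borel_measurable borel" unfolding g_def by measurable
  have fN: "cmod (ft f \<xi>) \<le> N" for \<xi> unfolding N_def by (rule cmod_ft_le)
  have N0: "0 \<le> N" using fN[of 0] norm_ge_zero order_trans by blast
  have g: "integrable lborel g"
  proof (rule Bochner_Integration.integrable_bound)
    show "integrable lborel (\<lambda>\<xi>. of_real N * gauss s \<xi>)" using integrable_gauss[OF s] by simp
    show "AE \<xi> in lborel. norm (g \<xi>) \<le> norm (complex_of_real N * gauss s \<xi>)"
      using fN N0 by (intro AE_I2) (simp add: g_def norm_mult mult_right_mono)
  qed measurable
  have ftg: "ft g y = cnj (LINT z|lborel. f z * of_real (2 * pi * normal_density 0 s (z - y)))" for y
  proof -
    have "gauss s \<xi> = cnj (gauss s \<xi>)" for \<xi> by (simp add: gauss_def)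
    note cg = this
    have "ft g y = (LINT \<xi>|lborel. cnj (ft f \<xi> * (cis (\<xi> * y) * gauss s \<xi>)))"
      unfolding ft_def[of g] unfolding g_def
      by (intro Bochner_Integration.integral_cong refl, subst cg) (simp add: cis_cnj mult_ac)
    also have "\<dots> = cnj (LINT \<xi>|lborel. ft f \<xi> * (cis (\<xi> * y) * gauss s \<xi>))" by (rule Bochner_Integration.integral_cnj)
    finally show ?thesis unfolding integral_ft_gauss[OF f s] .
  qed
  have sq: "ft f \<xi> * g \<xi> = of_real ((cmod (ft f \<xi>))\<^sup>2 * Re (gauss s \<xi>))" for \<xi>
    unfolding of_real_mult complex_norm_square by (simp add: g_def gauss_def)
  have "integrable lborel (\<lambda>\<xi>. ft f \<xi> * g \<xi>)"
  proof (rule Bochner_Integration.integrable_bound)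
    show "integrable lborel (\<lambda>\<xi>. of_real N * g \<xi>)" using g by simp
    show "AE \<xi> in lborel. norm (ft f \<xi> * g \<xi>) \<le> norm (complex_of_real N * g \<xi>)"
      using fN N0 by (intro AE_I2) (simp add: norm_mult mult_right_mono)
  qed measurable
  then have "(\<integral>\<^sup>+\<xi>. ennreal ((cmod (ft f \<xi>))\<^sup>2 * Re (gauss s \<xi>)) \<partial>lborel) =
      ennreal (LINT \<xi>|lborel. (cmod (ft f \<xi>))\<^sup>2 * Re (gauss s \<xi>))"
    unfolding sq complex_of_real_integrable_eq by (intro nn_integral_eq_integral) (auto simp: gauss_bounds)
  also have "(LINT \<xi>|lborel. (cmod (ft f \<xi>))\<^sup>2 * Re (gauss s \<xi>)) = cmod (LINT \<xi>|lborel. ft f \<xi> * g \<xi>)"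
    unfolding sq integral_complex_of_real norm_of_real by (simp add: integral_nonneg gauss_bounds)
  also have "(LINT \<xi>|lborel. ft f \<xi> * g \<xi>) = (LINT x|lborel. f x * ft g x)"
    by (rule integral_ft_mult[OF f g])
  also have "ennreal (cmod \<dots>) \<le> (\<integral>\<^sup>+x. ennreal (cmod (f x * ft g x)) \<partial>lborel)"
  proof (rule integral_norm_bound_ennreal)
    show "integrable lborel (\<lambda>x. f x * ft g x)"
    proof (rule Bochner_Integration.integrable_bound)
      show "integrable lborel (\<lambda>x. of_real (LINT x|lborel. cmod (g x)) * f x)" using f by simp
      show "AE x in lborel. norm (f x * ft g x) \<le> norm (complex_of_real (LINT x|lborel. cmod (g x)) * f x)"
        using cmod_ft_le[of g] by (intro AE_I2) (simp add: norm_mult mult.commute mult_left_mono integral_nonneg)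
    qed measurable
  qed
  also have "\<dots> \<le> (\<integral>\<^sup>+y. ennreal (2 * pi) * (\<integral>\<^sup>+z. ennreal (cmod (f y) * (cmod (f z) * normal_density 0 s (z - y))) \<partial>lborel) \<partial>lborel)"
  proof (rule nn_integral_mono)
    fix y :: real
    have "ennreal (cmod (ft g y)) \<le> (\<integral>\<^sup>+z. ennreal (cmod (f z * of_real (2 * pi * normal_density 0 s (z - y)))) \<partial>lborel)"
      unfolding ftg complex_mod_cnj
    proof (rule integral_norm_bound_ennreal)
      show "integrable lborel (\<lambda>z. f z * complex_of_real (2 * pi * normal_density 0 s (z - y)))"
      proof (rule Bochner_Integration.integrable_bound)
        define c where "c = 1 / sqrt (2 * pi * s\<^sup>2)"
        have c: "normal_density 0 s u \<le> c" "0 \<le> c" for u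
          unfolding normal_density_def c_def by (auto simp: divide_right_mono)
        show "integrable lborel (\<lambda>z. of_real (2 * pi * c) * f z)" using f by simp
        show "AE z in lborel. norm (f z * complex_of_real (2 * pi * normal_density 0 s (z - y)))
            \<le> norm (complex_of_real (2 * pi * c) * f z)"
          using c by (intro AE_I2) (simp add: norm_mult abs_mult mult.commute mult_left_mono)
      qed measurable
    qed
    also have "\<dots> = (\<integral>\<^sup>+z. ennreal (2 * pi) * ennreal (cmod (f z) * normal_density 0 s (z - y)) \<partial>lborel)"
      by (intro nn_integral_cong) (simp add: norm_mult mult_ac flip: ennreal_mult)
    finally have "ennreal (cmod (f y * ft g y)) \<le> ennreal (cmod (f y)) * (ennreal (2 * pi) * (\<integral>\<^sup>+z. ennreal (cmod (f z) * normal_density 0 s (z - y)) \<partial>lborel))"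
      by (simp add: norm_mult ennreal_mult mult_left_mono nn_integral_cmult)
    also have "\<dots> = ennreal (2 * pi) * (\<integral>\<^sup>+z. ennreal (cmod (f y)) * ennreal (cmod (f z) * normal_density 0 s (z - y)) \<partial>lborel)"
      by (simp add: nn_integral_cmult mult_ac)
    finally show "ennreal (cmod (f y * ft g y)) \<le> ennreal (2 * pi) * (\<integral>\<^sup>+z. ennreal (cmod (f y) * (cmod (f z) * normal_density 0 s (z - y))) \<partial>lborel)"
      by (simp add: ennreal_mult)
  qed
  also have "\<dots> = ennreal (2 * pi) * (\<integral>\<^sup>+y. \<integral>\<^sup>+z. ennreal (cmod (f y) * (cmod (f z) * normal_density 0 s (z - y))) \<partial>lborel \<partial>lborel)"
    by (rule nn_integral_cmult) measurable
  also have "\<dots> \<le> ennreal (2 * pi) * sq_int f"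
    by (intro mult_left_mono nn_integral_schur nn_integral_normal_density s) auto
  finally show ?thesis .
qed

text \<open>Fatou's lemma removes the damping. Stated in extended integrals, so that the right side
  may be infinite.\<close>

lemma ft_bessel:
  assumes f: "integrable lborel f"
  shows "sq_int (ft f) \<le> ennreal (2 * pi) * sq_int f"
proof -
  note [measurable] = borel_measurable_integrable[OF f, simplified]
  let ?g = "\<lambda>n \<xi>. ennreal ((cmod (ft f \<xi>))\<^sup>2 * Re (gauss (1 / real (Suc n)) \<xi>))"
  have "sq_int (ft f) = (\<integral>\<^sup>+\<xi>. liminf (\<lambda>n. ?g n \<xi>) \<partial>lborel)"
  proof (intro nn_integral_cong)
    fix \<xi> :: real
    have "(\<lambda>n. ?g n \<xi>) \<longlonglongrightarrow> ennreal ((cmod (ft f \<xi>))\<^sup>2 * Re 1)"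
      by (intro tendsto_intros gauss_tendsto)
    then show "ennreal ((cmod (ft f \<xi>))\<^sup>2) = liminf (\<lambda>n. ?g n \<xi>)"
      by (simp add: lim_imp_Liminf)
  qed
  also have "\<dots> \<le> liminf (\<lambda>n. \<integral>\<^sup>+\<xi>. ?g n \<xi> \<partial>lborel)"
    by (rule nn_integral_liminf) measurable
  also have "\<dots> \<le> ennreal (2 * pi) * sq_int f"
    using ft_bessel_gauss[OF f] by (intro Liminf_le) (auto simp del: of_nat_Suc)
  finally show ?thesis .
qed

text \<open>Both sides of the damped inversion formula converge: the damping tends to 1 in the
  frequency integral, and the normal average concentrates at \<open>x\<close>, where
  \<open>f\<close> is continuous.\<close>

lemma ft_inversion:
  assumes f: "integrable lborel f" and cont: "continuous_on UNIV f" and bd: "\<And>x. cmod (f x) \<le> B"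
    and ff: "integrable lborel (ft f)"
  shows "(LINT \<xi>|lborel. cis (\<xi> * x) * ft f \<xi>) = of_real (2 * pi) * f x"
proof -
  note [measurable] = borel_measurable_integrable[OF f, simplified]
  let ?s = "\<lambda>n. 1 / real (Suc n)"
  have eq: "(LINT \<xi>|lborel. ft f \<xi> * (cis (\<xi> * x) * gauss (?s n) \<xi>)) =
      (LINT r|lborel. std_normal_density r *\<^sub>R (of_real (2 * pi) * f (x + ?s n * r)))" for n
  proof -
    have s: "?s n > 0" by simp
    have "(LINT \<xi>|lborel. ft f \<xi> * (cis (\<xi> * x) * gauss (?s n) \<xi>)) =
       (LINT y|lborel. f y * of_real (2 * pi * normal_density 0 (?s n) (y - x)))"
      by (rule integral_ft_gauss[OF f s])
    also have "\<dots> = ?s n *\<^sub>R (LINT r|lborel. f (x + ?s n * r) * of_real (2 * pi * normal_density 0 (?s n) (x + ?s n * r - x)))"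
      by (subst lborel_integral_real_affine[where c = "?s n" and t = x]) auto
    also have "\<dots> = (LINT r|lborel. ?s n *\<^sub>R (f (x + ?s n * r) * of_real (2 * pi * normal_density 0 (?s n) (x + ?s n * r - x))))"
      by simp
    also have "\<dots> = (LINT r|lborel. std_normal_density r *\<^sub>R (of_real (2 * pi) * f (x + ?s n * r)))"
    proof (intro Bochner_Integration.integral_cong refl)
      fix r
      have "?s n * normal_density 0 (?s n) (?s n * r) = std_normal_density r"
        using s unfolding normal_density_def
        by (simp add: real_sqrt_mult real_sqrt_divide power_mult_distrib power_divide del: of_nat_Suc)
      moreover have "a *\<^sub>R (z * of_real (2 * pi * b)) = (a * b) *\<^sub>R (of_real (2 * pi) * z)" for a b :: real and z :: complex
        by (simp add: scaleR_conv_of_real mult_ac)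
      ultimately show "?s n *\<^sub>R (f (x + ?s n * r) * of_real (2 * pi * normal_density 0 (?s n) (x + ?s n * r - x)))
        = std_normal_density r *\<^sub>R (of_real (2 * pi) * f (x + ?s n * r))"
        by (simp only: add_diff_cancel_left')
    qed
    finally show ?thesis .
  qed
  have l1: "(\<lambda>n. LINT \<xi>|lborel. ft f \<xi> * (cis (\<xi> * x) * gauss (?s n) \<xi>)) \<longlonglongrightarrow> (LINT \<xi>|lborel. ft f \<xi> * (cis (\<xi> * x) * 1))"
  proof (rule integral_dominated_convergence[where w = "\<lambda>\<xi>. cmod (ft f \<xi>)"])
    show "AE \<xi> in lborel. (\<lambda>n. ft f \<xi> * (cis (\<xi> * x) * gauss (?s n) \<xi>)) \<longlonglongrightarrow> ft f \<xi> * (cis (\<xi> * x) * 1)"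
      by (intro AE_I2 tendsto_intros gauss_tendsto)
    show "AE \<xi> in lborel. norm (ft f \<xi> * (cis (\<xi> * x) * gauss (?s n) \<xi>)) \<le> cmod (ft f \<xi>)" for n
      by (intro AE_I2) (simp add: norm_mult gauss_bounds mult_left_le del: of_nat_Suc)
  qed (use ff in auto)
  have l2: "(\<lambda>n. LINT r|lborel. std_normal_density r *\<^sub>R (of_real (2 * pi) * f (x + ?s n * r)))
      \<longlonglongrightarrow> (LINT r|lborel. std_normal_density r *\<^sub>R (of_real (2 * pi) * f x))"
  proof (rule integral_dominated_convergence[where w = "\<lambda>r. (2 * pi * B) * std_normal_density r"])
    have "(\<lambda>n. f (x + ?s n * r)) \<longlonglongrightarrow> f (x + 0 * r)" for r
      by (intro continuous_on_tendsto_compose[OF cont] tendsto_intros LIMSEQ_Suc[OF lim_1_over_n]) auto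
    then show "AE r in lborel. (\<lambda>n. std_normal_density r *\<^sub>R (of_real (2 * pi) * f (x + ?s n * r)))
        \<longlonglongrightarrow> std_normal_density r *\<^sub>R (of_real (2 * pi) * f x)"
      by (intro AE_I2 tendsto_intros) simp
    show "AE r in lborel. norm (std_normal_density r *\<^sub>R (of_real (2 * pi) * f (x + ?s n * r))) \<le> (2 * pi * B) * std_normal_density r" for n
      using bd by (intro AE_I2) (simp add: norm_mult mult.commute mult_left_mono del: of_nat_Suc)
    show "integrable lborel (\<lambda>r. (2 * pi * B) * std_normal_density r)"
      by (intro integrable_mult_right integrable_normal_density) auto
  qed measurable
  have l3: "(LINT r|lborel. std_normal_density r *\<^sub>R (of_real (2 * pi) * f x)) = of_real (2 * pi) * f x"
    by (subst integral_scaleR_left) (auto simp: integral_normal_density integrable_normal_density)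
  show ?thesis using LIMSEQ_unique[OF l1[unfolded eq] l2] unfolding l3 by (simp add: mult.commute)
qed

section \<open>Test functions\<close>

definition smooth :: "(real \<Rightarrow> real) \<Rightarrow> bool" where
  "smooth f \<longleftrightarrow> (\<forall>n x. (deriv ^^ n) f differentiable (at x))"

text \<open>Formulas for higher derivatives are thereby avoided: it is enough to exhibit a class of
  differentiable functions that is closed under \<open>deriv\<close>.\<close>

lemma smooth_coinduct:
  assumes "f \<in> X" and X: "\<And>f. f \<in> X \<Longrightarrow> (\<forall>x. f differentiable (at x)) \<and> deriv f \<in> X"
  shows "smooth f"
proof -
  have "(deriv ^^ n) f \<in> X" for n by (induction n) (use assms in auto)
  then show ?thesis using X unfolding smooth_def by blast
qed

lemma smooth_deriv: "smooth f \<Longrightarrow> smooth (deriv f)"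
  unfolding smooth_def by (metis comp_apply funpow_Suc_right)

lemma smooth_higher_deriv: "smooth f \<Longrightarrow> smooth ((deriv ^^ n) f)"
  by (induction n) (auto intro: smooth_deriv)

lemma smooth_has_derivative: "smooth f \<Longrightarrow> (f has_real_derivative deriv f x) (at x)"
  unfolding smooth_def by (metis DERIV_deriv_iff_real_differentiable funpow_0)

lemma smooth_continuous_on: "smooth f \<Longrightarrow> continuous_on A f"
  by (meson DERIV_continuous_on has_field_derivative_at_within smooth_has_derivative)

lemma smooth_measurable [measurable_dest]: "smooth f \<Longrightarrow> f \<in> borel_measurable borel"
  by (intro borel_measurable_continuous_onI smooth_continuous_on)

text \<open>Products of smooth functions are not closed under \<open>deriv\<close>, but sums of
  products are; this replaces Leibniz's formula.\<close>

inductive product_sum :: "(real \<Rightarrow> real) \<Rightarrow> bool" where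
  mult: "smooth a \<Longrightarrow> smooth b \<Longrightarrow> product_sum (\<lambda>x. a x * b x)"
| add: "product_sum f \<Longrightarrow> product_sum g \<Longrightarrow> product_sum (\<lambda>x. f x + g x)"

lemma has_derivative_fun:
  assumes "\<And>x. (f has_real_derivative f' x) (at x)"
  shows "(\<forall>x. f differentiable (at x)) \<and> deriv f = f'"
  using assms by (auto simp: real_differentiable_def DERIV_imp_deriv)

lemma product_sum_deriv: "product_sum f \<Longrightarrow> (\<forall>x. f differentiable (at x)) \<and> product_sum (deriv f)"
proof (induction rule: product_sum.induct)
  case (mult a b)
  have "\<And>x. ((\<lambda>x. a x * b x) has_real_derivative deriv a x * b x + a x * deriv b x) (at x)"
    using mult by (auto intro!: derivative_eq_intros smooth_has_derivative)
  from has_derivative_fun[OF this] show ?case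
    using mult by (auto intro!: product_sum.intros smooth_deriv)
next
  case (add f g)
  have "\<And>x. ((\<lambda>x. f x + g x) has_real_derivative deriv f x + deriv g x) (at x)"
    using add.IH by (intro DERIV_add) (auto simp: DERIV_deriv_iff_real_differentiable)
  from has_derivative_fun[OF this] show ?case
    using add by (auto intro!: product_sum.intros)
qed

lemma smooth_mult: "smooth a \<Longrightarrow> smooth b \<Longrightarrow> smooth (\<lambda>x. a x * b x)"
  by (rule smooth_coinduct[of _ "{f. product_sum f}"]) (auto simp: product_sum_deriv product_sum.mult)

lemma smooth_affine:
  assumes "smooth f"
  shows "smooth (\<lambda>x. c * f (a * x + b))"
proof (rule smooth_coinduct[of _ "{\<lambda>x. c * f (a * x + b) | f c. smooth f}"])
  fix g assume "g \<in> {\<lambda>x. c * f (a * x + b) | f c. smooth f}"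
  then obtain f c where g: "g = (\<lambda>x. c * f (a * x + b))" and f: "smooth f" by auto
  have "(g has_real_derivative (c * a) * deriv f (a * x + b)) (at x)" for x
    unfolding g by (rule derivative_eq_intros DERIV_chain2[OF smooth_has_derivative[OF f]] refl | simp)+
  from has_derivative_fun[OF this] show "(\<forall>x. g differentiable (at x)) \<and> deriv g \<in> {\<lambda>x. c * f (a * x + b) | f c. smooth f}"
    using smooth_deriv[OF f] by auto
qed (use assms in auto)

lemma higher_deriv_affine:
  assumes f: "smooth f"
  shows "(deriv ^^ n) (\<lambda>x. f (a * x + b)) = (\<lambda>x. a ^ n * (deriv ^^ n) f (a * x + b))"
proof (induction n)
  case (Suc n)
  have "((\<lambda>x. a ^ n * (deriv ^^ n) f (a * x + b)) has_real_derivative a ^ Suc n * deriv ((deriv ^^ n) f) (a * x + b)) (at x)" for x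
    by (rule derivative_eq_intros DERIV_chain2[OF smooth_has_derivative[OF smooth_higher_deriv[OF f]]] refl | simp)+
  from has_derivative_fun[OF this] show ?case by (simp add: Suc.IH)
qed simp

text \<open>Admitting a polynomial factor in \<open>1 / x\<close> gives a class closed under
  \<open>deriv\<close>: with \<open>y = 1 / x\<close>, differentiation replaces \<open>p\<close> by
  \<open>y\<^sup>2 (p - p')\<close>.\<close>

definition flat_exp :: "real poly \<Rightarrow> real \<Rightarrow> real" where
  "flat_exp p x = (if x \<le> 0 then 0 else poly p (1 / x) * exp (- (1 / x)))"

lemma poly_div_exp_tendsto_0: "((\<lambda>y::real. poly p y / exp y) \<longlongrightarrow> 0) at_top"
proof -
  have "((\<lambda>y. \<Sum>i\<le>degree p. coeff p i * (y ^ i / exp y)) \<longlongrightarrow> (\<Sum>i\<le>degree p. coeff p i * 0)) at_top"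
    by (intro tendsto_intros tendsto_power_div_exp_0)
  then show ?thesis by (simp add: poly_altdef sum_divide_distrib)
qed

lemma flat_exp_deriv:
  "(flat_exp p has_real_derivative flat_exp ([:0, 0, 1:] * (p - pderiv p)) x) (at x)"
proof -
  consider "x < 0" | "x > 0" | "x = 0" by linarith
  then show ?thesis
  proof cases
    case 1
    have "\<forall>\<^sub>F y in nhds x. flat_exp p y = 0"
      using eventually_nhds_in_open[of "{..<0}" x] 1 by (auto elim!: eventually_mono simp: flat_exp_def)
    then show ?thesis using 1 by (subst DERIV_cong_ev[OF refl _ refl]) (auto simp: flat_exp_def)
  next
    case 2
    have ev: "\<forall>\<^sub>F y in nhds x. flat_exp p y = poly p (1 / y) * exp (- (1 / y))"
      using eventually_nhds_in_open[of "{0<..}" x] 2 by (auto elim!: eventually_mono simp: flat_exp_def)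
    have "((\<lambda>y. poly p (1 / y) * exp (- (1 / y))) has_real_derivative
        poly (pderiv p) (1 / x) * (- 1 / x\<^sup>2) * exp (- (1 / x)) + poly p (1 / x) * (exp (- (1 / x)) * (1 / x\<^sup>2))) (at x)"
      using 2 by (auto intro!: derivative_eq_intros DERIV_chain2[OF poly_DERIV] simp: power2_eq_square)
    then show ?thesis using 2
      by (subst DERIV_cong_ev[OF refl ev refl]) (simp add: flat_exp_def field_simps power2_eq_square)
  next
    case 3
    \<comment> \<open>At 0 from the right the difference quotient is \<open>y p(y) / exp y\<close>
      with \<open>y = 1 / h\<close>; the extra factor \<open>y\<close> is the division by
      \<open>h\<close>.\<close>
    have "((\<lambda>h. poly ([:0, 1:] * p) (inverse h) / exp (inverse h)) \<longlongrightarrow> 0) (at_right (0::real))"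
      by (rule filterlim_compose[OF poly_div_exp_tendsto_0 filterlim_inverse_at_top_right])
    then have r: "((\<lambda>h. (flat_exp p (0 + h) - flat_exp p 0) / h) \<longlongrightarrow> 0) (at_right 0)"
      by (rule Lim_transform_eventually)
        (auto simp: eventually_at_right_field flat_exp_def exp_minus field_simps intro!: exI[of _ 1])
    have l: "((\<lambda>h. (flat_exp p (0 + h) - flat_exp p 0) / h) \<longlongrightarrow> 0) (at_left 0)"
      by (rule Lim_transform_eventually[OF tendsto_const])
        (auto simp: eventually_at_left_field flat_exp_def intro!: exI[of _ "- 1"])
    show ?thesis using 3 filterlim_split_at[OF l r]
      by (simp add: DERIV_def flat_exp_def)
  qed
qed

lemma smooth_flat_exp: "smooth (flat_exp p)"
proof (rule smooth_coinduct[of _ "range flat_exp"])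
  fix f assume "f \<in> range flat_exp"
  then obtain p where "f = flat_exp p" by auto
  then show "(\<forall>x. f differentiable (at x)) \<and> deriv f \<in> range flat_exp"
    using has_derivative_fun[OF flat_exp_deriv[of p]] by auto
qed simp

text \<open>\<open>n\<close> steepens both flanks: as it grows, these bumps tend pointwise to the
  indicator of the open interval, staying between 0 and 1 and inside the same support.\<close>

definition plateau :: "real \<Rightarrow> real \<Rightarrow> real \<Rightarrow> real \<Rightarrow> real" where
  "plateau n a b x = flat_exp 1 (n * (x - a)) * flat_exp 1 (n * (b - x))"

lemma flat_exp_1_bounds: "0 \<le> flat_exp 1 x" "flat_exp 1 x \<le> 1"
  by (auto simp: flat_exp_def)

lemma plateau_bounds: "0 \<le> plateau n a b x" "plateau n a b x \<le> 1"
  using flat_exp_1_bounds by (auto simp: plateau_def intro: mult_le_one)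

lemma plateau_support: "n > 0 \<Longrightarrow> plateau n a b x \<noteq> 0 \<longleftrightarrow> a < x \<and> x < b"
  by (auto simp: plateau_def flat_exp_def zero_less_mult_iff mult_le_0_iff not_le)

lemma smooth_plateau: "smooth (plateau n a b)"
proof -
  have "smooth (\<lambda>x. (1 * flat_exp 1 (n * x + (- n * a))) * (1 * flat_exp 1 (- n * x + n * b)))"
    by (intro smooth_mult smooth_affine smooth_flat_exp)
  then show ?thesis by (simp add: plateau_def[abs_def] algebra_simps)
qed

lemma test_functionI:
  assumes "smooth f" "\<And>x. x < a \<or> b < x \<Longrightarrow> f x = 0"
  shows "test_function f"
proof -
  have "closure {x. f x \<noteq> 0} \<subseteq> {a..b}"
    using assms(2) by (intro closure_minimal) (auto, metis not_le, metis not_le)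
  then have "compact (closure {x. f x \<noteq> 0})"
    by (meson bounded_subset closed_closure compact_Icc compact_eq_bounded_closed)
  then show ?thesis using assms(1) by (simp add: test_function_def smooth_def)
qed

lemma test_function_smooth: "test_function f \<Longrightarrow> smooth f"
  by (simp add: test_function_def smooth_def)

lemma test_function_plateau: "n > 0 \<Longrightarrow> test_function (plateau n a b)"
  by (rule test_functionI[OF smooth_plateau, of a b]) (metis less_asym plateau_support)

lemma plateau_tendsto: "(\<lambda>n. plateau (real (Suc n)) a b x) \<longlonglongrightarrow> indicator {a<..<b} x"
proof -
  have *: "(\<lambda>n. flat_exp 1 (real (Suc n) * y)) \<longlonglongrightarrow> (if y \<le> 0 then 0 else 1)" for y :: real
  proof (cases "y \<le> 0")
    case False
    have "(\<lambda>n. exp (- (1 / real (Suc n) * (1 / y)))) \<longlonglongrightarrow> exp (- (0 * (1 / y)))"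
      by (intro tendsto_intros LIMSEQ_Suc[OF lim_1_over_n])
    then show ?thesis using False by (simp add: flat_exp_def mult_le_0_iff del: of_nat_Suc)
  qed (simp add: flat_exp_def mult_le_0_iff)
  have "(\<lambda>n. plateau (real (Suc n)) a b x) \<longlonglongrightarrow> (if x - a \<le> 0 then 0 else 1) * (if b - x \<le> 0 then 0 else 1)"
    unfolding plateau_def by (intro tendsto_mult *)
  also have "(if x - a \<le> 0 then 0 else 1) * (if b - x \<le> 0 then 0 else 1) = (indicator {a<..<b} x :: real)"
    by (auto simp: indicator_def)
  finally show ?thesis .
qed

text \<open>Open intervals form a generator of the Borel sets that is stable under intersection, so
  Dynkin's argument extends the vanishing to all Borel sets, and the density is zero.\<close>

lemma AE_zero_if_integral_intervals_zero:
  fixes f :: "real \<Rightarrow> 'a::{banach, second_countable_topology}"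
  assumes f: "integrable lborel f"
    and zero: "\<And>a b. (LINT x|lborel. indicator {a<..<b} x *\<^sub>R f x) = 0"
  shows "AE x in lborel. f x = 0"
proof (rule sigma_finite_measure.density_zero[OF sigma_finite_lborel f])
  note [measurable] = borel_measurable_integrable[OF f]
  have ind: "integrable lborel (\<lambda>x. indicator A x *\<^sub>R f x)" if "A \<in> sets borel" for A
    using integrable_mult_indicator[OF _ f, of A] that by simp
  \<comment> \<open>Complements require the integral over the whole line, which is not one of the
    intervals and is reached as a limit.\<close>
  have total: "(LINT x|lborel. f x) = 0"
  proof -
    have "(\<lambda>n. LINT x|lborel. indicator {- real n<..<real n} x *\<^sub>R f x) \<longlonglongrightarrow> (LINT x|lborel. f x)"
    proof (rule integral_dominated_convergence[where w = "\<lambda>x. norm (f x)"])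
      show "AE x in lborel. (\<lambda>n. indicator {- real n<..<real n} x *\<^sub>R f x) \<longlonglongrightarrow> f x"
      proof (intro AE_I2 tendsto_eventually)
        fix x :: real
        obtain N where "\<bar>x\<bar> < real N" using reals_Archimedean2 by blast
        then show "\<forall>\<^sub>F n in sequentially. indicator {- real n<..<real n} x *\<^sub>R f x = f x"
          by (intro eventually_sequentiallyI[of N]) (auto simp: indicator_def abs_less_iff)
      qed
    qed (use f in \<open>auto simp: indicator_def\<close>)
    then show ?thesis unfolding zero using LIMSEQ_unique tendsto_const by metis
  qed
  have sets: "sets borel = sigma_sets UNIV (range (\<lambda>(a, b). {a<..<b :: real}))"
    by (subst borel_eq_box, subst sets_measure_of) (simp_all add: split_beta')
  fix A :: "real set" assume "A \<in> sets lborel"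
  then have A: "A \<in> sigma_sets UNIV (range (\<lambda>(a, b). {a<..<b :: real}))" by (simp add: sets)
  have subset_Pow_UNIV: "range (\<lambda>(a, b). {a<..<b :: real}) \<subseteq> Pow UNIV" by simp
  have stable: "Int_stable (range (\<lambda>(a, b). {a<..<b :: real}))"
  proof (rule Int_stableI)
    fix S T assume "S \<in> range (\<lambda>(a, b). {a<..<b :: real})" "T \<in> range (\<lambda>(a, b). {a<..<b :: real})"
    then obtain a b c d where "S = {a<..<b}" "T = {c<..<d}" by auto
    then have "S \<inter> T = {max a c<..<min b d}" by auto
    then show "S \<inter> T \<in> range (\<lambda>(a, b). {a<..<b :: real})" by auto
  qed
  show "(LINT x:A|lborel. f x) = 0"
    unfolding set_lebesgue_integral_def
    using stable subset_Pow_UNIV A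
  proof (induction rule: sigma_sets_induct_disjoint)
    case (basic A)
    then show ?case using zero by auto
  next
    case (compl A)
    then have A: "A \<in> sets borel" by (simp add: sets)
    have "(LINT x|lborel. indicator (UNIV - A) x *\<^sub>R f x) = (LINT x|lborel. f x - indicator A x *\<^sub>R f x)"
      by (intro Bochner_Integration.integral_cong) (auto simp: indicator_def)
    also have "\<dots> = 0" using f ind[OF A] total compl.IH by simp
    finally show ?case .
  next
    case (union A)
    have A: "A i \<in> sets lborel" for i using union by (auto simp: sets)
    have "(\<Union>i. A i) \<in> sets borel" using A by auto
    then have "set_lebesgue_integral lborel (\<Union>i. A i) f = (\<Sum>i. set_lebesgue_integral lborel (A i) f)"
      using union.hyps A ind by (intro lebesgue_integral_countable_add) (auto simp: disjoint_family_on_def set_integrable_def)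
    then show ?case using union.IH by (simp add: set_lebesgue_integral_def)
  qed auto
qed

section \<open>Supports, bounds and transforms of test functions\<close>

lemma test_function_cutoff:
  assumes "test_function \<psi>"
  shows "\<exists>a>0. \<forall>x. a \<le> \<bar>x\<bar> \<longrightarrow> \<psi> x = 0"
proof -
  have "bounded {x. \<psi> x \<noteq> 0}"
    using assms unfolding test_function_def by (meson bounded_closure_image bounded_subset closure_subset compact_imp_bounded)
  then obtain B where B: "\<And>x. \<psi> x \<noteq> 0 \<Longrightarrow> \<bar>x\<bar> \<le> B" unfolding bounded_iff by auto
  have "\<psi> x = 0" if "\<bar>B\<bar> + 1 \<le> \<bar>x\<bar>" for x
    using B[of x] that by linarith
  then show ?thesis by (intro exI[of _ "\<bar>B\<bar> + 1"]) auto
qed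

lemma deriv_eq_0_if_locally_0:
  fixes f :: "real \<Rightarrow> real"
  assumes "open S" "x \<in> S" "\<And>y. y \<in> S \<Longrightarrow> f y = 0"
  shows "deriv f x = 0"
proof -
  have "\<forall>\<^sub>F y in nhds x. f y = 0"
    using eventually_nhds_in_open[OF assms(1,2)] by (rule eventually_mono) (rule assms(3))
  then have "(f has_real_derivative 0) (at x)"
    by (subst DERIV_cong_ev[OF refl _ refl]) auto
  then show ?thesis by (rule DERIV_imp_deriv)
qed

lemma test_function_deriv:
  assumes "test_function \<psi>"
  shows "test_function (deriv \<psi>)"
proof -
  obtain a where a: "a > 0" "\<And>x. a \<le> \<bar>x\<bar> \<Longrightarrow> \<psi> x = 0" using test_function_cutoff[OF assms] by blast
  have "deriv \<psi> x = 0" if "x < - a \<or> a < x" for x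
    using that deriv_eq_0_if_locally_0[of "{..<- a}" x \<psi>] deriv_eq_0_if_locally_0[of "{a<..}" x \<psi>] a by auto
  then show ?thesis
    by (rule test_functionI[where a = "- a" and b = a, OF smooth_deriv[OF test_function_smooth[OF assms]]])
qed

lemma test_function_higher_deriv: "test_function \<psi> \<Longrightarrow> test_function ((deriv ^^ n) \<psi>)"
  by (induction n) (auto intro: test_function_deriv)

lemma test_function_measurable [measurable_dest]: "test_function \<psi> \<Longrightarrow> \<psi> \<in> borel_measurable borel"
  by (intro smooth_measurable test_function_smooth)

lemma test_function_bounded:
  assumes "test_function \<psi>"
  shows "\<exists>B. \<forall>x. \<bar>\<psi> x\<bar> \<le> B"
proof -
  obtain a where a: "a > 0" "\<And>x. a \<le> \<bar>x\<bar> \<Longrightarrow> \<psi> x = 0" using test_function_cutoff[OF assms] by blast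
  have "compact (\<psi> ` {- a..a})"
    by (intro compact_continuous_image smooth_continuous_on test_function_smooth[OF assms]) auto
  from compact_imp_bounded[OF this] obtain B where B: "\<forall>x\<in>{- a..a}. \<bar>\<psi> x\<bar> \<le> B"
    unfolding bounded_iff by auto
  have "\<bar>\<psi> x\<bar> \<le> \<bar>B\<bar>" for x
  proof (cases "a \<le> \<bar>x\<bar>")
    case False
    then have "x \<in> {- a..a}" by auto
    with B have "\<bar>\<psi> x\<bar> \<le> B" by blast
    then show ?thesis by linarith
  qed (simp add: a(2))
  then show ?thesis by blast
qed

lemma test_function_integrable:
  assumes "test_function \<psi>"
  shows "integrable lborel \<psi>" "integrable lborel (\<lambda>x. (\<psi> x)\<^sup>2)"
proof -
  note [measurable] = test_function_measurable[OF assms]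
  obtain a where a: "a > 0" "\<And>x. a \<le> \<bar>x\<bar> \<Longrightarrow> \<psi> x = 0" using test_function_cutoff[OF assms] by blast
  obtain B where B: "\<And>x. \<bar>\<psi> x\<bar> \<le> B" using test_function_bounded[OF assms] by blast
  show *: "integrable lborel \<psi>"
  proof (rule Bochner_Integration.integrable_bound)
    show "integrable lborel (\<lambda>x. B * indicator {- a..a} x)" 
      by (intro integrable_mult_right integrable_real_indicator) (auto simp: emeasure_lborel_Icc_eq)
    show "AE x in lborel. norm (\<psi> x) \<le> norm (B * indicator {- a..a} x)"
      using B a(2) by (intro AE_I2) (auto simp: indicator_def intro: order_trans[OF B])
  qed measurable
  show "integrable lborel (\<lambda>x. (\<psi> x)\<^sup>2)"
  proof (rule Bochner_Integration.integrable_bound)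
    show "integrable lborel (\<lambda>x. B * \<psi> x)" using * by simp
    show "AE x in lborel. norm ((\<psi> x)\<^sup>2) \<le> norm (B * \<psi> x)"
    proof (intro AE_I2)
      fix x
      have "\<bar>\<psi> x\<bar> * \<bar>\<psi> x\<bar> \<le> \<bar>B\<bar> * \<bar>\<psi> x\<bar>" using B[of x] by (intro mult_right_mono) auto
      then show "norm ((\<psi> x)\<^sup>2) \<le> norm (B * \<psi> x)" by (simp add: power2_eq_square abs_mult)
    qed
  qed measurable
qed

text \<open>The derivative of \<open>cis (- (\<xi> * x)) * \<psi> x\<close> is integrated over an
  interval at whose ends \<open>\<psi>\<close> vanishes.\<close>

lemma ft_deriv:
  assumes \<psi>: "test_function \<psi>"
  shows "ft (\<lambda>x. of_real (deriv \<psi> x)) \<xi> = \<i> * of_real \<xi> * ft (\<lambda>x. of_real (\<psi> x)) \<xi>"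
proof -
  obtain a where a: "a > 0" "\<And>x. a \<le> \<bar>x\<bar> \<Longrightarrow> \<psi> x = 0" using test_function_cutoff[OF \<psi>] by blast
  have d0: "deriv \<psi> x = 0" if "a < \<bar>x\<bar>" for x
    using that deriv_eq_0_if_locally_0[of "{..<- a}" x \<psi>] deriv_eq_0_if_locally_0[of "{a<..}" x \<psi>] a
    by (cases "0 \<le> x") auto
  let ?F = "\<lambda>x. cis (- (\<xi> * x)) * of_real (\<psi> x)"
  let ?f = "\<lambda>x. cis (- (\<xi> * x)) * of_real (deriv \<psi> x) - \<i> * of_real \<xi> * (cis (- (\<xi> * x)) * of_real (\<psi> x))"
  have dF: "(?F has_vector_derivative ?f x) (at x within S)" for x S
  proof -
    have c: "((\<lambda>x. cis (- (\<xi> * x))) has_vector_derivative (- \<xi>) *\<^sub>R (\<i> * cis (- (\<xi> * x)))) (at x within S)"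
      unfolding has_vector_derivative_def by (auto intro!: derivative_eq_intros)
    have p: "((\<lambda>x. complex_of_real (\<psi> x)) has_vector_derivative of_real (deriv \<psi> x)) (at x within S)"
      using has_field_derivative_at_within[OF smooth_has_derivative[OF test_function_smooth[OF \<psi>]], of x S]
      by (rule has_vector_derivative_of_real)
    show ?thesis
      using has_vector_derivative_mult[OF c p] by (simp add: scaleR_conv_of_real algebra_simps)
  qed
  have cont: "continuous_on {- a..a} ?f"
    by (intro continuous_intros smooth_continuous_on smooth_deriv test_function_smooth[OF \<psi>])
  have "(LINT x|lborel. indicator {- a..a} x *\<^sub>R ?f x) = ?F a - ?F (- a)"
    by (rule integral_FTC_Icc[OF _ dF cont]) (use a in auto)
  also have "\<dots> = 0" using a by simp
  also have "(LINT x|lborel. indicator {- a..a} x *\<^sub>R ?f x) = (LINT x|lborel. ?f x)"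
    using a(2) d0 by (intro Bochner_Integration.integral_cong) (auto simp: indicator_def)
  also have "(LINT x|lborel. ?f x) = ft (\<lambda>x. of_real (deriv \<psi> x)) \<xi> - \<i> * of_real \<xi> * ft (\<lambda>x. of_real (\<psi> x)) \<xi>"
    unfolding ft_def using \<psi> test_function_deriv[OF \<psi>]
    by (subst Bochner_Integration.integral_diff)
      (auto intro!: integrable_cis_mult integrable_mult_right integrable_of_real test_function_integrable)
  finally show ?thesis by simp
qed

lemma ft_higher_deriv:
  assumes \<psi>: "test_function \<psi>"
  shows "ft (\<lambda>x. of_real ((deriv ^^ n) \<psi> x)) \<xi> = (\<i> * of_real \<xi>) ^ n * ft (\<lambda>x. of_real (\<psi> x)) \<xi>"
  by (induction n) (simp_all add: ft_deriv[OF test_function_higher_deriv[OF \<psi>]])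

lemma integrable_inverse_1_plus_sq: "integrable lborel (\<lambda>x::real. inverse (1 + x\<^sup>2))"
  using integrable_inverse_1_plus_square by (simp add: set_integrable_def einterval_def)

text \<open>The transform of the second derivative bounds \<open>\<xi>\<^sup>2\<close> times the
  transform of \<open>\<psi>\<close>, which gives decay like
  \<open>1 / (1 + \<xi>\<^sup>2)\<close>.\<close>

lemma integrable_ft_test:
  assumes \<psi>: "test_function \<psi>"
  shows "integrable lborel (ft (\<lambda>x. of_real (\<psi> x)))"
proof (rule Bochner_Integration.integrable_bound)
  note [measurable] = test_function_measurable[OF \<psi>]
  let ?N = "\<lambda>\<psi>. LINT x|lborel. cmod (of_real (\<psi> x))"
  define N where "N = ?N \<psi> + ?N ((deriv ^^ 2) \<psi>)"
  show "integrable lborel (\<lambda>\<xi>. N * inverse (1 + \<xi>\<^sup>2))"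
    by (intro integrable_mult_right integrable_inverse_1_plus_sq)
  have "cmod (ft (\<lambda>x. of_real (\<psi> x)) \<xi>) * (1 + \<xi>\<^sup>2) \<le> N" for \<xi>
    using cmod_ft_le[of "\<lambda>x. of_real (\<psi> x)" \<xi>] cmod_ft_le[of "\<lambda>x. of_real ((deriv ^^ 2) \<psi> x)" \<xi>]
    by (simp only: ft_higher_deriv[OF \<psi>] norm_mult norm_power N_def) (simp add: algebra_simps)
  then have "cmod (ft (\<lambda>x. of_real (\<psi> x)) \<xi>) \<le> N * inverse (1 + \<xi>\<^sup>2)" for \<xi>
    by (simp add: pos_le_divide_eq add_pos_nonneg flip: divide_inverse)
  then show "AE \<xi> in lborel. norm (ft (\<lambda>x. of_real (\<psi> x)) \<xi>) \<le> norm (N * inverse (1 + \<xi>\<^sup>2))"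
    by (intro AE_I2) (smt (verit) real_norm_def)
  show "ft (\<lambda>x. of_real (\<psi> x)) \<in> borel_measurable lborel" by measurable
qed

definition inv_ft :: "(real \<Rightarrow> real) \<Rightarrow> real \<Rightarrow> complex" where
  "inv_ft \<psi> \<xi> = ft (\<lambda>x. of_real (\<psi> x)) (- \<xi>) / of_real (2 * pi)"

lemma integrable_uminus_arg:
  "integrable lborel f \<Longrightarrow> integrable lborel (\<lambda>x::real. f (- x))" for f :: "real \<Rightarrow> complex"
  using lborel_integrable_real_affine[of f "- 1" 0] by simp

lemma integral_uminus_arg: "(LINT x|lborel. f (- x)) = (LINT x|lborel. f x)" for f :: "real \<Rightarrow> complex"
  using lborel_integral_real_affine[of "- 1" f 0] by simp

lemma inv_ft_props:
  assumes \<psi>: "test_function \<psi>"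
  shows "integrable lborel (inv_ft \<psi>)" "integrable lborel (\<lambda>\<xi>. (cmod (inv_ft \<psi> \<xi>))\<^sup>2)"
    "ft (inv_ft \<psi>) x = of_real (\<psi> x)"
    "inv_ft ((deriv ^^ n) \<psi>) \<xi> = (- \<i> * of_real \<xi>) ^ n * inv_ft \<psi> \<xi>"
proof -
  note [measurable] = test_function_measurable[OF \<psi>]
  have [measurable]: "inv_ft \<psi> \<in> borel_measurable borel" unfolding inv_ft_def[abs_def] by measurable
  show *: "integrable lborel (inv_ft \<psi>)"
    unfolding inv_ft_def[abs_def] by (intro integrable_divide_zero integrable_uminus_arg integrable_ft_test \<psi>)
  define N where "N = (LINT x|lborel. cmod (of_real (\<psi> x))) / (2 * pi)"
  have N: "cmod (inv_ft \<psi> \<xi>) \<le> N" for \<xi>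
    unfolding inv_ft_def norm_divide N_def using cmod_ft_le[of "\<lambda>x. of_real (\<psi> x)" "- \<xi>"]
    by (simp add: divide_right_mono)
  show "integrable lborel (\<lambda>\<xi>. (cmod (inv_ft \<psi> \<xi>))\<^sup>2)"
  proof (rule Bochner_Integration.integrable_bound)
    show "integrable lborel (\<lambda>\<xi>. N * cmod (inv_ft \<psi> \<xi>))" using * by simp
    show "AE \<xi> in lborel. norm ((cmod (inv_ft \<psi> \<xi>))\<^sup>2) \<le> norm (N * cmod (inv_ft \<psi> \<xi>))"
      using N by (intro AE_I2) (auto simp: power2_eq_square abs_mult intro!: mult_right_mono intro: order_trans[OF N])
  qed measurable
  obtain B where B: "\<And>x. \<bar>\<psi> x\<bar> \<le> B" using test_function_bounded[OF \<psi>] by blast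
  have "ft (inv_ft \<psi>) x = (LINT \<xi>|lborel. cis (- (- \<xi> * x)) * inv_ft \<psi> (- \<xi>))"
    using integral_uminus_arg[of "\<lambda>\<xi>. cis (- (x * \<xi>)) * inv_ft \<psi> \<xi>"]
    unfolding ft_def[of "inv_ft \<psi>"] by (simp add: mult.commute)
  also have "\<dots> = (LINT \<xi>|lborel. (cis (\<xi> * x) * ft (\<lambda>x. of_real (\<psi> x)) \<xi>) / of_real (2 * pi))"
    by (simp add: inv_ft_def)
  also have "\<dots> = (LINT \<xi>|lborel. cis (\<xi> * x) * ft (\<lambda>x. of_real (\<psi> x)) \<xi>) / of_real (2 * pi)"
    by (rule integral_divide_zero)
  also have "(LINT \<xi>|lborel. cis (\<xi> * x) * ft (\<lambda>x. of_real (\<psi> x)) \<xi>) = of_real (2 * pi) * of_real (\<psi> x)"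
    using B by (intro ft_inversion[where B = B] integrable_of_real test_function_integrable continuous_intros
      smooth_continuous_on test_function_smooth[OF \<psi>] integrable_ft_test \<psi>) auto
  finally show "ft (inv_ft \<psi>) x = of_real (\<psi> x)" by simp
  show "inv_ft ((deriv ^^ n) \<psi>) \<xi> = (- \<i> * of_real \<xi>) ^ n * inv_ft \<psi> \<xi>"
    unfolding inv_ft_def ft_higher_deriv[OF \<psi>] by simp
qed

section \<open>Pairings of square integrable functions\<close>

lemma cauchy_schwarz_integral:
  fixes a b :: "real \<Rightarrow> complex"
  assumes [measurable]: "a \<in> borel_measurable borel" "b \<in> borel_measurable borel"
  shows "ennreal ((cmod (LINT x|lborel. a x * b x))\<^sup>2)
    \<le> sq_int a * sq_int b"
proof (cases "integrable lborel (\<lambda>x. a x * b x)")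
  case True
  have "ennreal ((cmod (LINT x|lborel. a x * b x))\<^sup>2) = (ennreal (cmod (LINT x|lborel. a x * b x)))\<^sup>2"
    by (simp add: ennreal_power)
  also have "\<dots> \<le> (\<integral>\<^sup>+x. ennreal (cmod (a x)) * ennreal (cmod (b x)) \<partial>lborel)\<^sup>2"
    using integral_norm_bound_ennreal[OF True] by (intro power_mono) (auto simp: norm_mult ennreal_mult)
  also have "\<dots> \<le> (\<integral>\<^sup>+x. ennreal (cmod (a x)) ^ 2 \<partial>lborel) * (\<integral>\<^sup>+x. ennreal (cmod (b x)) ^ 2 \<partial>lborel)"
    by (rule Cauchy_Schwarz_nn_integral) measurable
  finally show ?thesis by (simp add: ennreal_power)
qed (simp add: not_integrable_integral_eq)

lemma integrable_mult_L2:
  fixes a b :: "real \<Rightarrow> complex"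
  assumes [measurable]: "a \<in> borel_measurable borel" "b \<in> borel_measurable borel"
    and "integrable lborel (\<lambda>x. (cmod (a x))\<^sup>2)" "integrable lborel (\<lambda>x. (cmod (b x))\<^sup>2)"
  shows "integrable lborel (\<lambda>x. a x * b x)"
proof (rule Bochner_Integration.integrable_bound)
  show "integrable lborel (\<lambda>x. (cmod (a x))\<^sup>2 + (cmod (b x))\<^sup>2)" using assms by simp
  have "cmod (a x) * cmod (b x) \<le> (cmod (a x))\<^sup>2 + (cmod (b x))\<^sup>2" for x
    using sum_squares_bound[of "cmod (a x)" "cmod (b x)"] mult_nonneg_nonneg[OF norm_ge_zero norm_ge_zero, of "a x" "b x"] by linarith
  then show "AE x in lborel. norm (a x * b x) \<le> norm ((cmod (a x))\<^sup>2 + (cmod (b x))\<^sup>2)"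
    by (intro AE_I2) (simp add: norm_mult)
qed measurable

lemma tendsto_integral_mult_L2:
  fixes a g :: "real \<Rightarrow> complex"
  assumes m [measurable]: "a \<in> borel_measurable borel" "g \<in> borel_measurable borel" "\<And>i. b i \<in> borel_measurable borel"
    and a: "integrable lborel (\<lambda>x. (cmod (a x))\<^sup>2)" and ag: "integrable lborel (\<lambda>x. a x * g x)"
    and ab: "\<And>i. integrable lborel (\<lambda>x. a x * b i x)"
    and lim: "((\<lambda>i. sq_int (\<lambda>x. b i x - g x)) \<longlongrightarrow> 0) F"
  shows "((\<lambda>i. LINT x|lborel. a x * b i x) \<longlongrightarrow> (LINT x|lborel. a x * g x)) F"
proof -
  let ?A = "sq_int a"
  let ?d = "\<lambda>i. cmod ((LINT x|lborel. a x * b i x) - (LINT x|lborel. a x * g x))"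
  have A: "?A \<noteq> \<infinity>" using a by (simp add: nn_integral_eq_integral)
  have le: "ennreal ((?d i)\<^sup>2) \<le> ?A * sq_int (\<lambda>x. b i x - g x)" for i
    using cauchy_schwarz_integral[of a "\<lambda>x. b i x - g x"] ab ag by (simp add: right_diff_distrib)
  have "((\<lambda>i. ?A * sq_int (\<lambda>x. b i x - g x)) \<longlongrightarrow> ?A * 0) F"
    using A by (intro ennreal_tendsto_cmult lim) (simp add: less_top)
  then have "((\<lambda>i. ennreal ((?d i)\<^sup>2)) \<longlongrightarrow> ennreal 0) F"
    unfolding mult_zero_right ennreal_0
    by (rule tendsto_sandwich[OF always_eventually always_eventually tendsto_const, rotated 2]) (simp_all add: le)
  then have "((\<lambda>i. (?d i)\<^sup>2) \<longlongrightarrow> 0) F"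
    by (subst (asm) tendsto_ennreal_iff) auto
  then have "((\<lambda>i. sqrt ((?d i)\<^sup>2)) \<longlongrightarrow> sqrt 0) F" by (intro tendsto_real_sqrt)
  then have "((\<lambda>i. ?d i) \<longlongrightarrow> 0) F" by simp
  then show ?thesis using Lim_null tendsto_norm_zero_iff by blast
qed

section \<open>The inverse Fourier transform on square integrable functions\<close>

lemma tendsto_0_le_ennreal:
  fixes f g :: "'b \<Rightarrow> ennreal"
  assumes "(g \<longlongrightarrow> 0) F" "\<And>i. f i \<le> g i"
  shows "(f \<longlongrightarrow> 0) F"
  by (rule tendsto_sandwich[of "\<lambda>_. 0" f F g]) (use assms in auto)

text \<open>The argument of Riesz and Fischer with explicit rates. Weighted by \<open>4 ^ k\<close>,
  the squared increments still have integrals at most \<open>(1 / 2) ^ k\<close>, so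
  \<open>H\<close> is finite almost everywhere; where it is, the increments are at most
  \<open>sqrt (H x) / 2 ^ k\<close>, which gives the limit and the squared error
  \<open>4 * H x / 4 ^ n\<close>.\<close>

lemma L2_rapid_limit:
  fixes f :: "nat \<Rightarrow> real \<Rightarrow> complex"
  assumes m [measurable]: "\<And>n. f n \<in> borel_measurable borel"
    and fast: "\<And>n. sq_int (\<lambda>x. f (Suc n) x - f n x) \<le> ennreal ((1 / 8) ^ n)"
  shows "\<exists>g. g \<in> borel_measurable borel \<and> (AE x in lborel. (\<lambda>n. f n x) \<longlonglongrightarrow> g x) \<and>
    (\<lambda>n. sq_int (\<lambda>x. f n x - g x)) \<longlonglongrightarrow> 0"
proof (intro exI conjI)
  define d where "d = (\<lambda>n x. f (Suc n) x - f n x)"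
  define g where "g = (\<lambda>x. lim (\<lambda>n. f n x))"
  define H where "H = (\<lambda>x. \<Sum>k. ennreal (4 ^ k * (cmod (d k x))\<^sup>2))"
  have [measurable]: "d n \<in> borel_measurable borel" for n unfolding d_def by measurable
  have [measurable]: "H \<in> borel_measurable borel" unfolding H_def by measurable
  show [measurable]: "g \<in> borel_measurable borel" unfolding g_def by measurable
  have "(\<integral>\<^sup>+x. H x \<partial>lborel) = (\<Sum>k. \<integral>\<^sup>+x. ennreal (4 ^ k * (cmod (d k x))\<^sup>2) \<partial>lborel)"
    unfolding H_def by (rule nn_integral_suminf) measurable
  also have "\<dots> \<le> (\<Sum>k. ennreal ((1 / 2) ^ k))"
  proof (rule suminf_le)
    fix k
    have "(\<integral>\<^sup>+x. ennreal (4 ^ k * (cmod (d k x))\<^sup>2) \<partial>lborel) = ennreal (4 ^ k) * sq_int (d k)"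
      by (simp add: ennreal_mult nn_integral_cmult)
    also have "\<dots> \<le> ennreal (4 ^ k) * ennreal ((1 / 8) ^ k)"
      using fast[of k] by (intro mult_left_mono) (simp_all add: d_def)
    also have "\<dots> = ennreal ((1 / 2) ^ k)"
      by (simp flip: ennreal_mult power_mult_distrib)
    finally show "(\<integral>\<^sup>+x. ennreal (4 ^ k * (cmod (d k x))\<^sup>2) \<partial>lborel) \<le> ennreal ((1 / 2) ^ k)" .
  qed auto
  also have "\<dots> = ennreal 2"
    using geometric_sums[of "1 / 2 :: real"] by (intro suminf_ennreal_eq) auto
  finally have H: "(\<integral>\<^sup>+x. H x \<partial>lborel) \<le> ennreal 2" .
  have half: "((1 / 2 :: real) ^ n)\<^sup>2 = (1 / 4) ^ n" for n
    by (simp add: power2_eq_square flip: power_mult_distrib)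
  have conv: "(\<lambda>n. f n x) \<longlonglongrightarrow> g x \<and> (\<forall>n. (cmod (f n x - g x))\<^sup>2 \<le> 4 * h * (1 / 4) ^ n)"
    if h: "H x = ennreal h" "0 \<le> h" for x h
  proof -
    have d: "cmod (d k x) \<le> sqrt h * (1 / 2) ^ k" for k
    proof -
      have "(\<Sum>i\<in>{k}. ennreal (4 ^ i * (cmod (d i x))\<^sup>2)) \<le> H x"
        unfolding H_def by (rule sum_le_suminf) auto
      then have "ennreal (4 ^ k * (cmod (d k x))\<^sup>2) \<le> ennreal h" unfolding h(1) by simp
      then have "4 ^ k * (cmod (d k x))\<^sup>2 \<le> h" by (rule ennreal_le_iff[OF h(2), THEN iffD1])
      then have "(cmod (d k x))\<^sup>2 \<le> h * (1 / 4) ^ k" by (simp add: field_simps power_one_over)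
      also have "\<dots> = (sqrt h * (1 / 2) ^ k)\<^sup>2"
        using h(2) by (simp only: power_mult_distrib half real_sqrt_pow2, simp?)
      finally show ?thesis by (rule power2_le_imp_le) (simp add: h(2))
    qed
    have "summable (\<lambda>k. d k x)"
      by (rule summable_comparison_test'[of "\<lambda>k. sqrt h * (1 / 2) ^ k" 0])
        (auto intro!: summable_mult summable_geometric d)
    then have "(\<lambda>n. \<Sum>k<n. d k x) \<longlonglongrightarrow> (\<Sum>k. d k x)" by (rule summable_LIMSEQ)
    then have "(\<lambda>n. f 0 x + (\<Sum>k<n. d k x)) \<longlonglongrightarrow> f 0 x + (\<Sum>k. d k x)" by (intro tendsto_intros)
    moreover have "f 0 x + (\<Sum>k<n. d k x) = f n x" for n
      unfolding d_def by (subst sum_lessThan_telescope) simp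
    ultimately have lim: "(\<lambda>n. f n x) \<longlonglongrightarrow> g x"
      unfolding g_def by (simp add: limI)
    have step: "cmod (f n x - f (n + p) x) \<le> 2 * sqrt h * (1 / 2) ^ n" for n p
    proof -
      \<comment> \<open>Strengthened by the exact partial geometric sum so that the induction on
        \<open>p\<close> closes.\<close>
      have "cmod (f n x - f (n + p) x) \<le> 2 * sqrt h * (1 / 2) ^ n * (1 - (1 / 2) ^ p)"
      proof (induction p)
        case (Suc p)
        have "cmod (f n x - f (n + Suc p) x) \<le> cmod (f n x - f (n + p) x) + cmod (d (n + p) x)"
          using norm_triangle_ineq4[of "f n x - f (n + p) x" "d (n + p) x"] by (simp add: d_def)
        also have "\<dots> \<le> 2 * sqrt h * (1 / 2) ^ n * (1 - (1 / 2) ^ p) + sqrt h * (1 / 2) ^ (n + p)"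
          by (intro add_mono Suc.IH d)
        also have "\<dots> = 2 * sqrt h * (1 / 2) ^ n * (1 - (1 / 2) ^ Suc p)"
          by (simp add: algebra_simps power_add)
        finally show ?case .
      qed simp
      also have "\<dots> \<le> 2 * sqrt h * (1 / 2) ^ n * 1"
        using h(2) by (intro mult_left_mono) auto
      finally show ?thesis by simp
    qed
    have "(cmod (f n x - g x))\<^sup>2 \<le> 4 * h * (1 / 4) ^ n" for n
    proof -
      have "(\<lambda>p. cmod (f n x - f (n + p) x)) \<longlonglongrightarrow> cmod (f n x - g x)"
        using LIMSEQ_ignore_initial_segment[OF lim, of n] by (intro tendsto_intros) (simp add: add.commute)
      then have "cmod (f n x - g x) \<le> 2 * sqrt h * (1 / 2) ^ n"
        by (rule LIMSEQ_le_const2) (auto intro: step)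
      then have "(cmod (f n x - g x))\<^sup>2 \<le> (2 * sqrt h * (1 / 2) ^ n)\<^sup>2"
        by (intro power_mono) auto
      also have "\<dots> = 4 * h * (1 / 4) ^ n"
        using h(2) by (simp only: power_mult_distrib half real_sqrt_pow2, simp?)
      finally show ?thesis .
    qed
    with lim show ?thesis by blast
  qed
  have fin: "AE x in lborel. H x \<noteq> \<infinity>"
    using H by (intro nn_integral_PInf_AE) (auto simp: top_unique)
  have real: "\<exists>h\<ge>0. H x = ennreal h" if "H x \<noteq> \<infinity>" for x
    using that by (cases "H x") auto
  show "AE x in lborel. (\<lambda>n. f n x) \<longlonglongrightarrow> g x"
    using fin by eventually_elim (use real conv in blast)
  have le: "sq_int (\<lambda>x. f n x - g x) \<le> ennreal (8 * (1 / 4) ^ n)" for n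
  proof -
    have "sq_int (\<lambda>x. f n x - g x) \<le> (\<integral>\<^sup>+x. ennreal (4 * (1 / 4) ^ n) * H x \<partial>lborel)"
    proof (rule nn_integral_mono_AE)
      show "AE x in lborel. ennreal ((cmod (f n x - g x))\<^sup>2) \<le> ennreal (4 * (1 / 4) ^ n) * H x"
        using fin
      proof eventually_elim
        fix x assume "H x \<noteq> \<infinity>"
        then obtain h where h: "h \<ge> 0" "H x = ennreal h" using real by blast
        then have "(cmod (f n x - g x))\<^sup>2 \<le> 4 * (1 / 4) ^ n * h" using conv[of x h] by (simp add: mult_ac)
        then show "ennreal ((cmod (f n x - g x))\<^sup>2) \<le> ennreal (4 * (1 / 4) ^ n) * H x"
          using h by (simp add: ennreal_leI flip: ennreal_mult)
      qed
    qed
    also have "\<dots> \<le> ennreal (4 * (1 / 4) ^ n) * ennreal 2"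
      using H by (simp add: nn_integral_cmult mult_left_mono)
    also have "\<dots> = ennreal (8 * (1 / 4) ^ n)" by (subst ennreal_mult[symmetric]) simp_all
    finally show ?thesis .
  qed
  have "(\<lambda>n. ennreal (8 * (1 / 4) ^ n)) \<longlonglongrightarrow> ennreal (8 * 0)"
    by (intro tendsto_ennrealI tendsto_intros LIMSEQ_realpow_zero) auto
  then show "(\<lambda>n. sq_int (\<lambda>x. f n x - g x)) \<longlonglongrightarrow> 0"
    unfolding mult_zero_right ennreal_0 by (rule tendsto_0_le_ennreal) (rule le)
qed

lemma integrable_truncation:
  fixes h :: "real \<Rightarrow> complex"
  assumes [measurable]: "h \<in> borel_measurable borel" and h: "integrable lborel (\<lambda>x. (cmod (h x))\<^sup>2)"
  shows "integrable lborel (\<lambda>x. indicator {- R..R} x *\<^sub>R h x)"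
proof (rule Bochner_Integration.integrable_bound)
  show "integrable lborel (\<lambda>x. indicator {- R..R} x + (cmod (h x))\<^sup>2)"
    by (intro Bochner_Integration.integrable_add h integrable_real_indicator) (auto simp: emeasure_lborel_Icc_eq)
  have "cmod (h x) \<le> 1 + (cmod (h x))\<^sup>2" for x
    using sum_squares_bound[of "cmod (h x)" 1] norm_ge_zero[of "h x"]
    unfolding power_one mult_1_right by linarith
  then show "AE x in lborel. norm (indicator {- R..R} x *\<^sub>R h x) \<le> norm (indicator {- R..R} x + (cmod (h x))\<^sup>2 :: real)"
    by (intro AE_I2) (auto simp: indicator_def)
qed measurable

lemma truncation_tendsto:
  fixes h :: "real \<Rightarrow> complex"
  assumes [measurable]: "h \<in> borel_measurable borel" and h: "integrable lborel (\<lambda>x. (cmod (h x))\<^sup>2)"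
  shows "((\<lambda>R. sq_int (\<lambda>x. indicator {- R..R} x *\<^sub>R h x - h x)) \<longlongrightarrow> 0) at_top"
proof -
  let ?s = "\<lambda>R x. (cmod (indicator {- R..R} x *\<^sub>R h x - h x))\<^sup>2"
  have le: "?s R x \<le> (cmod (h x))\<^sup>2" for R x by (auto simp: indicator_def)
  have "((\<lambda>R. LINT x|lborel. ?s R x) \<longlongrightarrow> integral\<^sup>L (lborel :: real measure) (\<lambda>_. 0)) at_top"
  proof (rule integral_dominated_convergence_at_top[where s = ?s and f = "\<lambda>_. 0" and w = "\<lambda>x. (cmod (h x))\<^sup>2"])
    show "AE x in lborel. ((\<lambda>R. ?s R x) \<longlongrightarrow> 0) at_top"
    proof (intro AE_I2 tendsto_eventually)
      fix x show "\<forall>\<^sub>F R in at_top. ?s R x = 0"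
        using eventually_ge_at_top[of "\<bar>x\<bar>"] by eventually_elim (auto simp: indicator_def abs_le_iff)
    qed
  qed (use h in \<open>auto simp: le\<close>)
  then have "((\<lambda>R. ennreal (LINT x|lborel. ?s R x)) \<longlongrightarrow> ennreal 0) at_top"
    by (intro tendsto_ennrealI) simp
  moreover have "(\<integral>\<^sup>+x. ennreal (?s R x) \<partial>lborel) = ennreal (LINT x|lborel. ?s R x)" for R
    using le by (intro nn_integral_eq_integral Bochner_Integration.integrable_bound[OF h]) auto
  ultimately show ?thesis by simp
qed

text \<open>The transforms of truncations of \<open>h\<close> satisfy the rapid convergence above if
  the cut-offs grow fast enough. The norm bound and the pairing with test functions both pass to the
  limit and are all that is later needed of an inverse transform.\<close>

lemma inverse_L2_fourier:
  fixes h :: "real \<Rightarrow> complex"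
  assumes m [measurable]: "h \<in> borel_measurable borel" and h: "integrable lborel (\<lambda>x. (cmod (h x))\<^sup>2)"
  shows "\<exists>g. g \<in> borel_measurable borel \<and>
    ennreal (2 * pi) * sq_int g \<le> sq_int h \<and>
    (\<forall>\<psi>. test_function \<psi> \<longrightarrow> (LINT x|lborel. of_real (\<psi> x) * g x) = (LINT \<xi>|lborel. inv_ft \<psi> \<xi> * h \<xi>))"
proof -
  let ?T = "\<lambda>R. sq_int (\<lambda>x. indicator {- R..R} x *\<^sub>R h x - h x)"
  have "\<exists>R. ?T R < ennreal ((1 / 8) ^ n)" for n
    using order_tendstoD(2)[OF truncation_tendsto[OF m h], of "ennreal ((1 / 8) ^ n)"]
    by (auto simp: eventually_at_top_linorder)
  then obtain R where R: "\<And>n. ?T (R n) < ennreal ((1 / 8) ^ n)" by metis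
  define k where "k = (\<lambda>n \<xi>. indicator {- R n..R n} \<xi> *\<^sub>R h \<xi>)"
  have k [measurable]: "k n \<in> borel_measurable borel" for n unfolding k_def by measurable
  have ki: "integrable lborel (k n)" for n unfolding k_def by (rule integrable_truncation[OF m h])
  have kh: "(cmod (k n \<xi>))\<^sup>2 \<le> (cmod (h \<xi>))\<^sup>2" for n \<xi> by (auto simp: k_def indicator_def)
  define g where "g = (\<lambda>n x. ft (k n) (- x) / of_real (2 * pi))"
  have g [measurable]: "g n \<in> borel_measurable borel" for n unfolding g_def by measurable
  have bessel: "ennreal (2 * pi) * sq_int (\<lambda>x. ft f (- x) / of_real (2 * pi))
      \<le> sq_int f" if f: "integrable lborel f" for f
  proof -
    note [measurable] = borel_measurable_integrable[OF f, simplified]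
    have "sq_int (\<lambda>x. ft f (- x) / of_real (2 * pi))
        = (\<integral>\<^sup>+x. ennreal (1 / (2 * pi)\<^sup>2) * ennreal ((cmod (ft f (- x)))\<^sup>2) \<partial>lborel)"
      by (intro nn_integral_cong) (simp add: norm_divide norm_mult power_divide power_mult_distrib flip: ennreal_mult)
    also have "\<dots> = ennreal (1 / (2 * pi)\<^sup>2) * sq_int (ft f)"
      using nn_integral_real_affine[of "\<lambda>x. ennreal ((cmod (ft f x))\<^sup>2)" "- 1" 0] by (simp add: nn_integral_cmult)
    also have "\<dots> \<le> ennreal (1 / (2 * pi)\<^sup>2) * (ennreal (2 * pi) * sq_int f)"
      by (intro mult_left_mono ft_bessel f) simp
    finally have "ennreal (2 * pi) * sq_int (\<lambda>x. ft f (- x) / of_real (2 * pi))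
      \<le> ennreal (2 * pi) * (ennreal (1 / (2 * pi)\<^sup>2) * (ennreal (2 * pi) * sq_int f))"
      by (intro mult_left_mono) auto
    also have "\<dots> = ennreal (2 * pi * (1 / (2 * pi)\<^sup>2) * (2 * pi)) * sq_int f"
      by (simp only: ennreal_mult mult.assoc[symmetric] pi_ge_zero mult_nonneg_nonneg zero_le_numeral zero_le_divide_1_iff zero_le_power2)
    also have "2 * pi * (1 / (2 * pi)\<^sup>2) * (2 * pi) = 1" by (simp add: power2_eq_square)
    finally show ?thesis by simp
  qed
  have "sq_int (\<lambda>x. g (Suc n) x - g n x) \<le> ennreal ((1 / 8) ^ n)" for n
  proof -
    let ?D = "\<lambda>\<xi>. k (Suc n) \<xi> - k n \<xi>"
    have "ft ?D x = ft (k (Suc n)) x - ft (k n) x" for x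
      unfolding ft_def right_diff_distrib
      by (intro Bochner_Integration.integral_diff integrable_cis_mult ki) measurable
    then have "g (Suc n) x - g n x = ft ?D (- x) / of_real (2 * pi)" for x
      by (simp add: g_def diff_divide_distrib)
    then have "ennreal (2 * pi) * sq_int (\<lambda>x. g (Suc n) x - g n x)
        \<le> sq_int (\<lambda>\<xi>. ?D \<xi>)"
      using bessel[of ?D] ki by simp
    \<comment> \<open>At each point either truncation is \<open>h\<close> or 0. Where the two
      differ, exactly one of the distances to \<open>h\<close> is nonzero and equals their
      difference, so no factor 2 arises.\<close>
    also have "\<dots> \<le> (\<integral>\<^sup>+\<xi>. ennreal ((cmod (k (Suc n) \<xi> - h \<xi>))\<^sup>2) + ennreal ((cmod (k n \<xi> - h \<xi>))\<^sup>2) \<partial>lborel)"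
      by (intro nn_integral_mono) (auto simp: k_def indicator_def)
    also have "\<dots> = ?T (R (Suc n)) + ?T (R n)"
      unfolding k_def by (rule nn_integral_add) measurable
    also have "\<dots> \<le> ennreal ((1 / 8) ^ Suc n) + ennreal ((1 / 8) ^ n)"
      using R by (intro add_mono less_imp_le)
    also have "\<dots> \<le> ennreal (2 * pi) * ennreal ((1 / 8) ^ n)"
    proof -
      have "(1 / 8 :: real) ^ Suc n + (1 / 8) ^ n \<le> 2 * pi * (1 / 8) ^ n"
        using mult_right_mono[of "9 / 8" "2 * pi" "(1 / 8 :: real) ^ n"] pi_gt3 by simp
      then show ?thesis by (simp add: ennreal_leI flip: ennreal_mult ennreal_plus)
    qed
    finally show ?thesis by (subst (asm) ennreal_mult_le_mult_iff) auto
  qed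
  from L2_rapid_limit[OF g this] obtain G where G [measurable]: "G \<in> borel_measurable borel"
    and lim: "AE x in lborel. (\<lambda>n. g n x) \<longlonglongrightarrow> G x"
    and L2: "(\<lambda>n. sq_int (\<lambda>x. g n x - G x)) \<longlonglongrightarrow> 0" by blast
  have norm: "ennreal (2 * pi) * sq_int G \<le> sq_int h"
  proof -
    have "ennreal (2 * pi) * sq_int G
       = (\<integral>\<^sup>+x. ennreal (2 * pi) * ennreal ((cmod (G x))\<^sup>2) \<partial>lborel)" by (simp add: nn_integral_cmult)
    also have "\<dots> = (\<integral>\<^sup>+x. liminf (\<lambda>n. ennreal (2 * pi) * ennreal ((cmod (g n x))\<^sup>2)) \<partial>lborel)"
    proof (rule nn_integral_cong_AE)
      show "AE x in lborel. ennreal (2 * pi) * ennreal ((cmod (G x))\<^sup>2) = liminf (\<lambda>n. ennreal (2 * pi) * ennreal ((cmod (g n x))\<^sup>2))"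
        using lim
      proof eventually_elim
        fix x assume "(\<lambda>n. g n x) \<longlonglongrightarrow> G x"
        then have "(\<lambda>n. ennreal (2 * pi) * ennreal ((cmod (g n x))\<^sup>2)) \<longlonglongrightarrow> ennreal (2 * pi) * ennreal ((cmod (G x))\<^sup>2)"
          by (intro ennreal_tendsto_cmult tendsto_ennrealI tendsto_intros) auto
        then show "ennreal (2 * pi) * ennreal ((cmod (G x))\<^sup>2) = liminf (\<lambda>n. ennreal (2 * pi) * ennreal ((cmod (g n x))\<^sup>2))"
          by (simp add: lim_imp_Liminf)
      qed
    qed
    also have "\<dots> \<le> liminf (\<lambda>n. \<integral>\<^sup>+x. ennreal (2 * pi) * ennreal ((cmod (g n x))\<^sup>2) \<partial>lborel)"
      by (rule nn_integral_liminf) measurable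
    also have "\<dots> \<le> sq_int h"
    proof (rule Liminf_le)
      have "(\<integral>\<^sup>+x. ennreal (2 * pi) * ennreal ((cmod (g n x))\<^sup>2) \<partial>lborel) \<le> sq_int (k n)" for n
        using bessel[OF ki[of n]] unfolding g_def by (simp add: nn_integral_cmult)
      also have "sq_int (k n) \<le> sq_int h" for n
        by (intro nn_integral_mono ennreal_leI kh)
      finally show "\<forall>\<^sub>F n in sequentially. (\<integral>\<^sup>+x. ennreal (2 * pi) * ennreal ((cmod (g n x))\<^sup>2) \<partial>lborel)
          \<le> sq_int h" by (intro always_eventually) auto
    qed simp
    finally show ?thesis .
  qed
  have fin: "sq_int h < \<infinity>" using h by (simp add: nn_integral_eq_integral)
  have sqi: "integrable lborel (\<lambda>x. (cmod (f x))\<^sup>2)"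
    if [measurable]: "f \<in> borel_measurable borel"
      and "ennreal (2 * pi) * sq_int f \<le> sq_int h" for f
  proof -
    have "ennreal (2 * pi) * sq_int f < \<infinity>"
      using that(2) fin by (rule le_less_trans)
    then have "sq_int f < \<infinity>"
      by (auto simp: ennreal_mult_less_top)
    then show ?thesis by (intro integrableI_nonneg) auto
  qed
  have gb: "ennreal (2 * pi) * sq_int (g n) \<le> sq_int h" for n
    using bessel[OF ki[of n]] unfolding g_def by (rule order_trans) (intro nn_integral_mono ennreal_leI kh)
  have pair: "(LINT x|lborel. of_real (\<psi> x) * G x) = (LINT \<xi>|lborel. inv_ft \<psi> \<xi> * h \<xi>)" if \<psi>: "test_function \<psi>" for \<psi>
  proof -
    note [measurable] = test_function_measurable[OF \<psi>] borel_measurable_integrable[OF inv_ft_props(1)[OF \<psi>], simplified]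
    have \<psi>2: "integrable lborel (\<lambda>x. (cmod (of_real (\<psi> x)))\<^sup>2)" using test_function_integrable(2)[OF \<psi>] by simp
    have eq: "(LINT x|lborel. of_real (\<psi> x) * g n x) = (LINT \<xi>|lborel. inv_ft \<psi> \<xi> * k n \<xi>)" for n
    proof -
      have fg: "ft (\<lambda>\<xi>. k n (- \<xi>) / of_real (2 * pi)) x = g n x" for x
      proof -
        have "ft (\<lambda>\<xi>. k n (- \<xi>) / of_real (2 * pi)) x = (LINT \<xi>|lborel. cis (- (x * - \<xi>)) * (k n \<xi> / of_real (2 * pi)))"
          unfolding ft_def using integral_uminus_arg[of "\<lambda>\<xi>. cis (- (x * - \<xi>)) * (k n \<xi> / of_real (2 * pi))"] by simp
        then show ?thesis unfolding g_def ft_def by simp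
      qed
      have "(LINT \<xi>|lborel. inv_ft \<psi> \<xi> * k n \<xi>) = (LINT \<xi>|lborel. ft (\<lambda>x. of_real (\<psi> x)) \<xi> * (k n (- \<xi>) / of_real (2 * pi)))"
        using integral_uminus_arg[of "\<lambda>\<xi>. ft (\<lambda>x. of_real (\<psi> x)) \<xi> * (k n (- \<xi>) / of_real (2 * pi))"]
        by (simp add: inv_ft_def)
      also have "\<dots> = (LINT x|lborel. of_real (\<psi> x) * ft (\<lambda>\<xi>. k n (- \<xi>) / of_real (2 * pi)) x)"
        by (intro integral_ft_mult integrable_of_real test_function_integrable \<psi> integrable_divide_zero integrable_uminus_arg ki)
      finally show ?thesis unfolding fg ..
    qed
    have "(\<lambda>n. LINT x|lborel. of_real (\<psi> x) * g n x) \<longlonglongrightarrow> (LINT x|lborel. of_real (\<psi> x) * G x)"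
      by (intro tendsto_integral_mult_L2[OF _ _ _ \<psi>2 _ _ L2] integrable_mult_L2 \<psi>2 sqi norm gb) measurable
    moreover have "(\<lambda>n. LINT \<xi>|lborel. inv_ft \<psi> \<xi> * k n \<xi>) \<longlonglongrightarrow> (LINT \<xi>|lborel. inv_ft \<psi> \<xi> * h \<xi>)"
    proof (rule tendsto_integral_mult_L2[OF _ _ _ inv_ft_props(2)[OF \<psi>]])
      show "integrable lborel (\<lambda>x. inv_ft \<psi> x * h x)" "integrable lborel (\<lambda>x. inv_ft \<psi> x * k n x)" for n
        using kh by (intro integrable_mult_L2 inv_ft_props \<psi> h Bochner_Integration.integrable_bound[OF h]; auto)+
      have "(\<lambda>n. ennreal ((1 / 8) ^ n)) \<longlonglongrightarrow> ennreal 0"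
        by (intro tendsto_ennrealI LIMSEQ_realpow_zero) auto
      moreover have "sq_int (\<lambda>x. k n x - h x) \<le> ennreal ((1 / 8) ^ n)" for n
        unfolding k_def by (intro less_imp_le R)
      ultimately show "(\<lambda>n. sq_int (\<lambda>x. k n x - h x)) \<longlonglongrightarrow> 0"
        unfolding ennreal_0 by (rule tendsto_0_le_ennreal)
    qed measurable
    ultimately show ?thesis unfolding eq using LIMSEQ_unique by blast
  qed
  show ?thesis using G norm pair by blast
qed

section \<open>Weak derivatives and the Fourier transform\<close>

lemma integrable_mult_ft:
  assumes f: "integrable lborel f" and k: "integrable lborel k"
  shows "integrable lborel (\<lambda>\<xi>. k \<xi> * ft f \<xi>)"
proof (rule Bochner_Integration.integrable_bound)
  note [measurable] = borel_measurable_integrable[OF f, simplified] borel_measurable_integrable[OF k, simplified]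
  show "integrable lborel (\<lambda>\<xi>. of_real (LINT x|lborel. cmod (f x)) * k \<xi>)" using k by simp
  show "AE \<xi> in lborel. norm (k \<xi> * ft f \<xi>) \<le> norm (complex_of_real (LINT x|lborel. cmod (f x)) * k \<xi>)"
    using cmod_ft_le[of f] by (intro AE_I2) (simp add: norm_mult mult.commute mult_left_mono integral_nonneg)
  show "(\<lambda>\<xi>. k \<xi> * ft f \<xi>) \<in> borel_measurable lborel" by measurable
qed

text \<open>Once \<open>R\<close> exceeds the support of \<open>\<psi>\<close>, truncating
  \<open>f\<close> does not affect its pairing with \<open>\<psi>\<close>; that side is eventually
  constant while the frequency side converges by Cauchy-Schwarz.\<close>

lemma test_function_pairing:
  fixes f g :: "real \<Rightarrow> complex"
  assumes m [measurable]: "f \<in> borel_measurable borel" "g \<in> borel_measurable borel"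
    and f: "integrable lborel (\<lambda>x. (cmod (f x))\<^sup>2)" and g: "integrable lborel (\<lambda>x. (cmod (g x))\<^sup>2)"
    and lim: "((\<lambda>R. sq_int (\<lambda>\<xi>. ft (\<lambda>x. indicator {-R..R} x *\<^sub>R f x) \<xi> - g \<xi>)) \<longlongrightarrow> 0) at_top"
    and \<psi>: "test_function \<psi>"
  shows "(LINT x|lborel. of_real (\<psi> x) * f x) = (LINT \<xi>|lborel. inv_ft \<psi> \<xi> * g \<xi>)"
proof -
  define k where "k = (\<lambda>R x. indicator {-R..R} x *\<^sub>R f x)"
  have [measurable]: "k R \<in> borel_measurable borel" for R :: real unfolding k_def by measurable
  have k: "integrable lborel (k R)" for R unfolding k_def by (rule integrable_truncation[OF m(1) f])
  note [measurable] = borel_measurable_integrable[OF inv_ft_props(1)[OF \<psi>], simplified]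
  obtain a where a: "a > 0" "\<And>x. a \<le> \<bar>x\<bar> \<Longrightarrow> \<psi> x = 0" using test_function_cutoff[OF \<psi>] by blast
  have "((\<lambda>R. LINT \<xi>|lborel. inv_ft \<psi> \<xi> * ft (k R) \<xi>) \<longlongrightarrow> (LINT \<xi>|lborel. inv_ft \<psi> \<xi> * g \<xi>)) at_top"
  proof (rule tendsto_integral_mult_L2[OF _ _ _ inv_ft_props(2)[OF \<psi>]])
    show "((\<lambda>R. sq_int (\<lambda>\<xi>. ft (k R) \<xi> - g \<xi>)) \<longlongrightarrow> 0) at_top"
      using lim unfolding k_def .
    show "integrable lborel (\<lambda>\<xi>. inv_ft \<psi> \<xi> * g \<xi>)"
      by (intro integrable_mult_L2 inv_ft_props[OF \<psi>] g) measurable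
    show "integrable lborel (\<lambda>\<xi>. inv_ft \<psi> \<xi> * ft (k R) \<xi>)" for R
      by (intro integrable_mult_ft k inv_ft_props[OF \<psi>])
  qed measurable
  moreover have "((\<lambda>R. LINT \<xi>|lborel. inv_ft \<psi> \<xi> * ft (k R) \<xi>) \<longlongrightarrow> (LINT x|lborel. of_real (\<psi> x) * f x)) at_top"
  proof (intro tendsto_eventually, use eventually_ge_at_top[of a] in eventually_elim)
    fix R assume R: "a \<le> R"
    have "(LINT \<xi>|lborel. inv_ft \<psi> \<xi> * ft (k R) \<xi>) = (LINT x|lborel. k R x * ft (inv_ft \<psi>) x)"
      using integral_ft_mult[OF k[of R] inv_ft_props(1)[OF \<psi>]] by (simp add: mult.commute)
    also have "\<dots> = (LINT x|lborel. of_real (\<psi> x) * f x)"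
      unfolding inv_ft_props(3)[OF \<psi>] k_def using a(2) R
      by (intro Bochner_Integration.integral_cong refl) (auto simp: indicator_def)
    finally show "(LINT \<xi>|lborel. inv_ft \<psi> \<xi> * ft (k R) \<xi>) = (LINT x|lborel. of_real (\<psi> x) * f x)" .
  qed
  ultimately show ?thesis using tendsto_unique trivial_limit_at_top_linorder by blast
qed

section \<open>Reduction of vector functions to components\<close>

lemma norm_sq_vec: "(norm x)\<^sup>2 = (\<Sum>i\<in>UNIV. (norm (x $ i))\<^sup>2)" for x :: "'a::real_normed_vector ^ 'n::finite"
  unfolding norm_vec_def L2_set_def by (simp add: sum_nonneg)

lemma borel_measurable_vec_iff:
  fixes f :: "'b \<Rightarrow> complex ^ 'n::finite"
  shows "f \<in> borel_measurable M \<longleftrightarrow> (\<forall>i. (\<lambda>x. f x $ i) \<in> borel_measurable M)"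
proof
  assume [measurable]: "f \<in> borel_measurable M"
  have "(\<lambda>x::complex ^ 'n. x $ i) \<in> borel_measurable borel" for i
    by (intro borel_measurable_continuous_onI continuous_intros)
  from measurable_compose[OF \<open>f \<in> borel_measurable M\<close> this] show "\<forall>i. (\<lambda>x. f x $ i) \<in> borel_measurable M" by blast
next
  assume "\<forall>i. (\<lambda>x. f x $ i) \<in> borel_measurable M"
  then show "f \<in> borel_measurable M"
    by (subst borel_measurable_euclidean_space) (auto simp: Basis_vec_def inner_axis intro!: borel_measurable_inner)
qed

lemma in_L2_vec_iff:
  fixes f :: "real \<Rightarrow> complex ^ 'n::finite"
  shows "in_L2 f \<longleftrightarrow> (\<forall>i. in_L2 (\<lambda>x. f x $ i))"
proof
  assume f: "in_L2 f"
  then have [measurable]: "(\<lambda>x. f x $ i) \<in> borel_measurable borel" for i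
    by (simp add: in_L2_def borel_measurable_vec_iff)
  have "(norm (f x $ i))\<^sup>2 \<le> (norm (f x))\<^sup>2" for x i
    using component_le_norm_cart power_mono norm_ge_zero Finite_Cartesian_Product.norm_nth_le by metis
  then show "\<forall>i. in_L2 (\<lambda>x. f x $ i)"
    using f unfolding in_L2_def
    by (intro allI conjI, simp) (rule Bochner_Integration.integrable_bound[of _ "\<lambda>x. (norm (f x))\<^sup>2"], auto)
next
  assume "\<forall>i. in_L2 (\<lambda>x. f x $ i)"
  then show "in_L2 f"
    unfolding in_L2_def norm_sq_vec by (auto simp: borel_measurable_vec_iff)
qed

lemma in_L2_D:
  fixes f :: "real \<Rightarrow> complex"
  assumes "in_L2 f"
  shows "f \<in> borel_measurable borel" "integrable lborel (\<lambda>x. (cmod (f x))\<^sup>2)"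
  using assms by (simp_all add: in_L2_def)

lemma integrable_test_L2:
  fixes f :: "real \<Rightarrow> 'a::euclidean_space"
  assumes \<psi>: "test_function \<psi>" and f: "in_L2 f"
  shows "integrable lborel (\<lambda>x. \<psi> x *\<^sub>R f x)"
proof (rule Bochner_Integration.integrable_bound)
  show "(\<lambda>x. \<psi> x *\<^sub>R f x) \<in> borel_measurable lborel"
    using f test_function_measurable[OF \<psi>] by (intro borel_measurable_scaleR) (simp_all add: in_L2_def)
  show "integrable lborel (\<lambda>x. (\<psi> x)\<^sup>2 + (norm (f x))\<^sup>2)"
    using f test_function_integrable[OF \<psi>] by (simp add: in_L2_def)
  have "\<bar>\<psi> x\<bar> * norm (f x) \<le> (\<psi> x)\<^sup>2 + (norm (f x))\<^sup>2" for x
    using sum_squares_bound[of "\<bar>\<psi> x\<bar>" "norm (f x)"] mult_nonneg_nonneg[OF abs_ge_zero norm_ge_zero, of "\<psi> x" "f x"]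
    unfolding power2_abs by linarith
  then show "AE x in lborel. norm (\<psi> x *\<^sub>R f x) \<le> norm ((\<psi> x)\<^sup>2 + (norm (f x))\<^sup>2)"
    by (intro AE_I2) simp
qed

lemma integral_test_component:
  fixes f :: "real \<Rightarrow> complex ^ 'n::finite"
  assumes "test_function \<psi>" "in_L2 f"
  shows "(LINT x|lborel. \<psi> x *\<^sub>R f x) $ i = (LINT x|lborel. of_real (\<psi> x) * f x $ i)"
  using integral_bounded_linear[OF bounded_linear_vec_nth integrable_test_L2[OF assms], of i, symmetric]
  unfolding vector_scaleR_component scaleR_conv_of_real[where 'a = complex] .

text \<open>In each component the candidate is the inverse transform of
  \<open>(\<i> * \<xi>) ^ n * F\<close>. Pairing with test functions identifies it; the sign
  \<open>(-1) ^ n\<close> stems from the factor \<open>(- \<i> * \<xi>) ^ n\<close> in the inverse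
  transform of a derivative.\<close>

lemma weak_deriv_exists:
  fixes f F :: "real \<Rightarrow> complex ^ 'n::finite"
  assumes fF: "has_L2_fourier f F"
    and F: "integrable lborel (\<lambda>\<xi>. \<xi> ^ (2 * n) * (norm (F \<xi>))\<^sup>2)"
  shows "\<exists>g. has_weak_deriv n f g \<and>
    ennreal (2 * pi) * sq_int g \<le> (\<integral>\<^sup>+\<xi>. ennreal (\<xi> ^ (2 * n) * (norm (F \<xi>))\<^sup>2) \<partial>lborel)"
proof -
  have fL2: "in_L2 f" and FL2: "in_L2 F" using fF by (auto simp: has_L2_fourier_def)
  note fi = in_L2_D[OF fL2[unfolded in_L2_vec_iff, rule_format]] and Fi = in_L2_D[OF FL2[unfolded in_L2_vec_iff, rule_format]]
  note [measurable] = fi(1) Fi(1)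
  have [measurable]: "f \<in> borel_measurable borel" "F \<in> borel_measurable borel"
    using fL2 FL2 by (simp_all add: in_L2_def)
  define h where "h = (\<lambda>i \<xi>. (\<i> * of_real \<xi>) ^ n * F \<xi> $ i)"
  have [measurable]: "h i \<in> borel_measurable borel" for i unfolding h_def by measurable
  have hn: "(cmod (h i \<xi>))\<^sup>2 = \<xi> ^ (2 * n) * (cmod (F \<xi> $ i))\<^sup>2" for i \<xi>
    by (simp add: h_def norm_mult norm_power power_mult_distrib power_mult[symmetric] mult.commute[of 2])
      (simp add: power_mult mult.commute[of n 2])
  have hi: "integrable lborel (\<lambda>\<xi>. (cmod (h i \<xi>))\<^sup>2)" for i
  proof (rule Bochner_Integration.integrable_bound[OF F])
    show "AE \<xi> in lborel. norm ((cmod (h i \<xi>))\<^sup>2) \<le> norm (\<xi> ^ (2 * n) * (norm (F \<xi>))\<^sup>2)"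
      unfolding hn using Finite_Cartesian_Product.norm_nth_le[of "F _" i]
      by (intro AE_I2) (simp add: abs_mult mult_left_mono power_mono)
  qed measurable
  have "\<forall>i. \<exists>g. g \<in> borel_measurable borel \<and>
    ennreal (2 * pi) * sq_int g \<le> sq_int (h i) \<and>
    (\<forall>\<psi>. test_function \<psi> \<longrightarrow> (LINT x|lborel. of_real (\<psi> x) * g x) = (LINT \<xi>|lborel. inv_ft \<psi> \<xi> * h i \<xi>))"
    by (intro allI inverse_L2_fourier hi) measurable
  from choice[OF this] obtain G where GG: "\<forall>i. G i \<in> borel_measurable borel \<and>
    ennreal (2 * pi) * sq_int (G i) \<le> sq_int (h i) \<and>
    (\<forall>\<psi>. test_function \<psi> \<longrightarrow> (LINT x|lborel. of_real (\<psi> x) * G i x) = (LINT \<xi>|lborel. inv_ft \<psi> \<xi> * h i \<xi>))" ..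
  note G [measurable] = GG[rule_format, THEN conjunct1]
    and Gn = GG[rule_format, THEN conjunct2, THEN conjunct1]
    and Gp = GG[rule_format, THEN conjunct2, THEN conjunct2, rule_format]
  define g where "g = (\<lambda>x. \<chi> i. G i x)"
  have gi: "g x $ i = G i x" for x i by (simp add: g_def)
  have fin: "sq_int (h i) < \<infinity>" for i using hi[of i] by (simp add: nn_integral_eq_integral)
  have "in_L2 (G i)" for i
  proof -
    have "ennreal (2 * pi) * sq_int (G i) < \<infinity>"
      using Gn fin by (rule le_less_trans)
    then have "sq_int (G i) < \<infinity>" by (auto simp: ennreal_mult_less_top)
    then show ?thesis unfolding in_L2_def by (intro conjI integrableI_nonneg) auto
  qed
  then have gL2: "in_L2 g" unfolding in_L2_vec_iff gi by simp
  have comp: "((\<lambda>R. sq_int (\<lambda>\<xi>. ft (\<lambda>x. indicator {-R..R} x *\<^sub>R f x $ i) \<xi> - F \<xi> $ i)) \<longlongrightarrow> 0) at_top" for i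
  proof (rule tendsto_0_le_ennreal)
    show "((\<lambda>R. sq_int (\<lambda>\<xi>. fourier (\<lambda>x. indicator {-R..R} x *\<^sub>R f x) \<xi> - F \<xi>)) \<longlongrightarrow> 0) at_top"
      using fF by (simp add: has_L2_fourier_def)
    fix R :: real
    have "cmod (ft (\<lambda>x. indicator {-R..R} x *\<^sub>R f x $ i) \<xi> - F \<xi> $ i) \<le> norm (fourier (\<lambda>x. indicator {-R..R} x *\<^sub>R f x) \<xi> - F \<xi>)" for \<xi>
      using Finite_Cartesian_Product.norm_nth_le[of "fourier (\<lambda>x. indicator {-R..R} x *\<^sub>R f x) \<xi> - F \<xi>" i]
      by (simp add: fourier_def ft_def)
    then show "sq_int (\<lambda>\<xi>. ft (\<lambda>x. indicator {-R..R} x *\<^sub>R f x $ i) \<xi> - F \<xi> $ i)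
       \<le> sq_int (\<lambda>\<xi>. fourier (\<lambda>x. indicator {-R..R} x *\<^sub>R f x) \<xi> - F \<xi>)"
      by (intro nn_integral_mono ennreal_leI power_mono) auto
  qed
  have "(LINT x|lborel. (deriv ^^ n) \<psi> x *\<^sub>R f x) = (-1) ^ n *\<^sub>R (LINT x|lborel. \<psi> x *\<^sub>R g x)" if \<psi>: "test_function \<psi>" for \<psi>
    unfolding vec_eq_iff
  proof
    fix i
    have "(LINT x|lborel. (deriv ^^ n) \<psi> x *\<^sub>R f x) $ i = (LINT x|lborel. of_real ((deriv ^^ n) \<psi> x) * f x $ i)"
      by (rule integral_test_component[OF test_function_higher_deriv[OF \<psi>] fL2])
    also have "\<dots> = (LINT \<xi>|lborel. inv_ft ((deriv ^^ n) \<psi>) \<xi> * F \<xi> $ i)"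
      by (rule test_function_pairing[OF fi(1) Fi(1) fi(2) Fi(2) comp test_function_higher_deriv[OF \<psi>]])
    also have "\<dots> = (LINT \<xi>|lborel. (- 1) ^ n * (inv_ft \<psi> \<xi> * h i \<xi>))"
      unfolding inv_ft_props(4)[OF \<psi>] h_def
      by (intro Bochner_Integration.integral_cong refl) (simp add: power_minus[of "\<i> * _"] mult_ac)
    also have "\<dots> = (- 1) ^ n * (LINT \<xi>|lborel. inv_ft \<psi> \<xi> * h i \<xi>)" by (rule integral_mult_right_zero)
    also have "\<dots> = (- 1) ^ n * (LINT x|lborel. \<psi> x *\<^sub>R g x) $ i"
      unfolding Gp[OF \<psi>, symmetric] integral_test_component[OF \<psi> gL2] gi ..
    finally show "(LINT x|lborel. (deriv ^^ n) \<psi> x *\<^sub>R f x) $ i = ((-1) ^ n *\<^sub>R (LINT x|lborel. \<psi> x *\<^sub>R g x)) $ i"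
      unfolding vector_scaleR_component scaleR_conv_of_real[where 'a = complex] by simp
  qed
  then have wd: "has_weak_deriv n f g" unfolding has_weak_deriv_def using fL2 gL2 by blast
  have "ennreal (2 * pi) * sq_int g = (\<Sum>i\<in>UNIV. ennreal (2 * pi) * sq_int (G i))"
    unfolding norm_sq_vec gi by (simp add: nn_integral_sum sum_distrib_left flip: sum_ennreal)
  also have "\<dots> \<le> (\<Sum>i\<in>UNIV. sq_int (h i))" by (intro sum_mono Gn)
  also have "\<dots> = (\<integral>\<^sup>+\<xi>. ennreal (\<xi> ^ (2 * n) * (norm (F \<xi>))\<^sup>2) \<partial>lborel)"
    unfolding norm_sq_vec sum_distrib_left hn[symmetric] by (simp add: nn_integral_sum flip: sum_ennreal)
  finally show ?thesis using wd by blast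
qed

text \<open>The difference of two weak derivatives annihilates all test functions, and plateaus
  approximate indicators of intervals, so its integral over every bounded interval vanishes.\<close>

lemma weak_deriv_unique:
  fixes f :: "real \<Rightarrow> 'a::euclidean_space"
  assumes g: "has_weak_deriv n f g" "has_weak_deriv n f g'"
  shows "AE x in lborel. g x = g' x"
proof -
  have L2: "in_L2 g" "in_L2 g'" using g by (auto simp: has_weak_deriv_def)
  then have [measurable]: "g \<in> borel_measurable borel" "g' \<in> borel_measurable borel" by (simp_all add: in_L2_def)
  define d where "d = (\<lambda>x. g x - g' x)"
  have [measurable]: "d \<in> borel_measurable borel" unfolding d_def by measurable
  have test: "(LINT x|lborel. \<psi> x *\<^sub>R d x) = 0" if \<psi>: "test_function \<psi>" for \<psi>
  proof -
    have "(LINT x|lborel. (deriv ^^ n) \<psi> x *\<^sub>R f x) = (-1) ^ n *\<^sub>R (LINT x|lborel. \<psi> x *\<^sub>R g x)"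
      "(LINT x|lborel. (deriv ^^ n) \<psi> x *\<^sub>R f x) = (-1) ^ n *\<^sub>R (LINT x|lborel. \<psi> x *\<^sub>R g' x)"
      using g \<psi> unfolding has_weak_deriv_def by blast+
    then have "(LINT x|lborel. \<psi> x *\<^sub>R g x) = (LINT x|lborel. \<psi> x *\<^sub>R g' x)" by simp
    then show ?thesis unfolding d_def scaleR_diff_right
      by (subst Bochner_Integration.integral_diff) (auto intro!: integrable_test_L2 \<psi> L2)
  qed
  have loc: "integrable lborel (\<lambda>x. indicator {a<..<b} x *\<^sub>R d x)" for a b :: real
  proof (rule Bochner_Integration.integrable_bound)
    show "integrable lborel (\<lambda>x. 2 * indicator {a..b} x + ((norm (g x))\<^sup>2 + (norm (g' x))\<^sup>2))"
      using L2 by (intro Bochner_Integration.integrable_add integrable_mult_right integrable_real_indicator)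
        (auto simp: in_L2_def emeasure_lborel_Icc_eq)
    have "norm (d x) \<le> 2 + ((norm (g x))\<^sup>2 + (norm (g' x))\<^sup>2)" for x
      using norm_triangle_ineq4[of "g x" "g' x"] sum_squares_bound[of "norm (g x)" 1] sum_squares_bound[of "norm (g' x)" 1]
        norm_ge_zero[of "g x"] norm_ge_zero[of "g' x"] unfolding d_def power_one mult_1_right by linarith
    then show "AE x in lborel. norm (indicator {a<..<b} x *\<^sub>R d x) \<le> norm (2 * indicator {a..b} x + ((norm (g x))\<^sup>2 + (norm (g' x))\<^sup>2))"
      by (intro AE_I2) (auto simp: indicator_def)
  qed measurable
  have int: "(LINT x|lborel. indicator {a<..<b} x *\<^sub>R d x) = 0" for a b :: real
  proof -
    have "(\<lambda>k. LINT x|lborel. plateau (real (Suc k)) a b x *\<^sub>R d x) \<longlonglongrightarrow> (LINT x|lborel. indicator {a<..<b} x *\<^sub>R d x)"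
    proof (rule integral_dominated_convergence[where w = "\<lambda>x. norm (indicator {a<..<b} x *\<^sub>R d x)"])
      show "AE x in lborel. (\<lambda>k. plateau (real (Suc k)) a b x *\<^sub>R d x) \<longlonglongrightarrow> indicator {a<..<b} x *\<^sub>R d x"
        by (intro AE_I2 tendsto_intros plateau_tendsto)
      show "AE x in lborel. norm (plateau (real (Suc k)) a b x *\<^sub>R d x) \<le> norm (indicator {a<..<b} x *\<^sub>R d x)" for k
      proof (intro AE_I2)
        fix x
        have "\<bar>plateau (real (Suc k)) a b x\<bar> \<le> indicator {a<..<b} x"
          using plateau_bounds[of "real (Suc k)" a b x] plateau_support[of "real (Suc k)" a b x]
          by (auto simp: indicator_def)
        then show "norm (plateau (real (Suc k)) a b x *\<^sub>R d x) \<le> norm (indicator {a<..<b} x *\<^sub>R d x)"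
          by (simp add: mult_right_mono)
      qed
      show "(\<lambda>x. plateau (real (Suc k)) a b x *\<^sub>R d x) \<in> borel_measurable lborel" for k
        using smooth_measurable[OF smooth_plateau, of "real (Suc k)" a b] by measurable
      show "integrable lborel (\<lambda>x. norm (indicator {a<..<b} x *\<^sub>R d x))"
        by (intro integrable_norm loc)
    qed measurable
    moreover have zero: "(LINT x|lborel. plateau (real (Suc k)) a b x *\<^sub>R d x) = 0" for k
      by (intro test test_function_plateau) simp
    ultimately show ?thesis unfolding zero using LIMSEQ_unique[OF _ tendsto_const] by blast
  qed
  \<comment> \<open>The difference is only locally integrable; it is cut to bounded intervals, and
    countably many null sets are united.\<close>
  have "AE x in lborel. indicator {- real N<..<real N} x *\<^sub>R d x = 0" for N
  proof (rule AE_zero_if_integral_intervals_zero[OF loc])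
    fix a b :: real
    have "indicator {a<..<b} x *\<^sub>R indicator {- real N<..<real N} x *\<^sub>R d x = indicator {max a (- real N)<..<min b (real N)} x *\<^sub>R d x" for x
      by (auto simp: indicator_def)
    then show "(LINT x|lborel. indicator {a<..<b} x *\<^sub>R indicator {- real N<..<real N} x *\<^sub>R d x) = 0"
      by (simp only: int)
  qed
  then have "AE x in lborel. \<forall>N. indicator {- real N<..<real N} x *\<^sub>R d x = 0"
    unfolding AE_all_countable by blast
  then show ?thesis
  proof eventually_elim
    fix x assume *: "\<forall>N. indicator {- real N<..<real N} x *\<^sub>R d x = 0"
    obtain N where "\<bar>x\<bar> < real N" using reals_Archimedean2 by blast
    then show "g x = g' x" using *[rule_format, of N] by (auto simp: indicator_def d_def)
  qed
qed

section \<open>Mollifiers and their transforms\<close>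

definition mollifier :: "real \<Rightarrow> real \<Rightarrow> real" where
  "mollifier m x = m * plateau 1 (- 1) 1 (m * x) / (LINT y|lborel. plateau 1 (- 1) 1 y)"

lemma plateau_integral_pos: "0 < (LINT y|lborel. plateau 1 (- 1) 1 y)"
proof -
  have "\<not> (AE x in lborel. plateau 1 (- 1) 1 x = 0)"
  proof
    assume "AE x in lborel. plateau 1 (- 1) 1 x = 0"
    then have "AE x::real in lborel. x \<notin> {- 1<..<1}"
      by eventually_elim (use plateau_support[of 1 "- 1" 1] in force)
    then have "emeasure lborel {- 1<..<1 :: real} = 0"
      by (subst (asm) AE_iff_measurable[of "{- 1<..<1}"]) auto
    then show False by simp
  qed
  then have "(LINT y|lborel. plateau 1 (- 1) 1 y) \<noteq> 0"
    using test_function_integrable(1)[OF test_function_plateau, of 1 "- 1" 1] plateau_bounds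
    by (subst integral_nonneg_eq_0_iff_AE) auto
  moreover have "0 \<le> (LINT y|lborel. plateau 1 (- 1) 1 y)"
    using plateau_bounds by (intro Bochner_Integration.integral_nonneg) auto
  ultimately show ?thesis by simp
qed

lemma test_function_mollifier: "m > 0 \<Longrightarrow> test_function (mollifier m)"
proof -
  assume m: "m > 0"
  let ?c = "LINT y|lborel. plateau 1 (- 1) 1 y"
  have "smooth (\<lambda>x. (m / ?c) * plateau 1 (- 1) 1 (m * x + 0))"
    by (intro smooth_affine smooth_plateau)
  moreover have "plateau 1 (- 1) 1 (m * x) = 0" if "x < - (1 / m) \<or> 1 / m < x" for x
  proof -
    have "m * x < - 1 \<or> 1 < m * x" using that m by (auto simp: field_simps)
    then show ?thesis using plateau_support[of 1 "- 1" 1 "m * x"] by auto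
  qed
  ultimately show "test_function (mollifier m)"
    by (intro test_functionI[of _ "- (1 / m)" "1 / m"]) (auto simp: mollifier_def[abs_def])
qed

lemma mollifier_nonneg: "m > 0 \<Longrightarrow> 0 \<le> mollifier m x"
  using plateau_bounds plateau_integral_pos by (simp add: mollifier_def)

lemma integral_mollifier: "m > 0 \<Longrightarrow> (LINT x|lborel. of_real (mollifier m x) * f (m * x)) = (LINT x|lborel. of_real (mollifier 1 x) * (f x :: complex))"
  using lborel_integral_real_affine[of "1 / m" "\<lambda>x. of_real (mollifier m x) * f (m * x)" 0]
  by (simp add: mollifier_def scaleR_conv_of_real field_simps flip: integral_mult_right_zero integral_mult_left_zero integral_divide_zero)

lemma integral_mollifier_1: "(LINT x|lborel. mollifier 1 x) = 1"
  using plateau_integral_pos by (simp add: mollifier_def)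

lemma nn_integral_mollifier:
  assumes "m > 0" shows "(\<integral>\<^sup>+x. ennreal (mollifier m x) \<partial>lborel) = 1"
proof -
  have "complex_of_real (LINT x|lborel. mollifier m x) = of_real (LINT x|lborel. mollifier 1 x)"
    using integral_mollifier[OF assms, of "\<lambda>_. 1"] by simp
  then have "(LINT x|lborel. mollifier m x) = 1" by (simp only: of_real_eq_iff integral_mollifier_1)
  then show ?thesis
    using mollifier_nonneg[OF assms] test_function_integrable(1)[OF test_function_mollifier[OF assms]]
    by (subst nn_integral_eq_integral) auto
qed

text \<open>Substitution moves the scale into the frequency: the value at \<open>\<xi>\<close> is
  that of the unscaled mollifier at \<open>\<xi> / (n + 1)\<close>, which tends to its
  integral.\<close>

lemma ft_mollifier_tendsto: "(\<lambda>n. ft (\<lambda>x. of_real (mollifier (real (Suc n)) x)) \<xi>) \<longlonglongrightarrow> 1"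
proof -
  have [measurable]: "mollifier 1 \<in> borel_measurable borel"
    by (intro test_function_measurable test_function_mollifier) simp
  have int: "integrable lborel (mollifier 1)"
    by (intro test_function_integrable test_function_mollifier) simp
  have eq: "ft (\<lambda>x. of_real (mollifier (real (Suc n)) x)) \<xi> = (LINT x|lborel. of_real (mollifier 1 x) * cis (- (1 / real (Suc n) * (\<xi> * x))))" for n
  proof -
    have "ft (\<lambda>x. of_real (mollifier (real (Suc n)) x)) \<xi>
      = (LINT x|lborel. of_real (mollifier (real (Suc n)) x) * cis (- (1 / real (Suc n) * (\<xi> * (real (Suc n) * x)))))"
      unfolding ft_def by (intro Bochner_Integration.integral_cong refl) (simp add: mult.commute del: of_nat_Suc)
    also have "\<dots> = (LINT x|lborel. of_real (mollifier 1 x) * cis (- (1 / real (Suc n) * (\<xi> * x))))"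
      by (rule integral_mollifier) simp
    finally show ?thesis .
  qed
  have "(\<lambda>n. LINT x|lborel. of_real (mollifier 1 x) * cis (- (1 / real (Suc n) * (\<xi> * x))))
      \<longlonglongrightarrow> (LINT x|lborel. of_real (mollifier 1 x) * cis (- (0 * (\<xi> * x))))"
  proof (rule integral_dominated_convergence[where w = "mollifier 1"])
    have "(\<lambda>n. cis (- (1 / real (Suc n) * (\<xi> * x)))) \<longlonglongrightarrow> cis (- (0 * (\<xi> * x)))" for x
      by (intro continuous_on_tendsto_compose[of UNIV cis] continuous_intros tendsto_intros LIMSEQ_Suc[OF lim_1_over_n]) auto
    then show "AE x in lborel. (\<lambda>n. of_real (mollifier 1 x) * cis (- (1 / real (Suc n) * (\<xi> * x))))
        \<longlonglongrightarrow> of_real (mollifier 1 x) * cis (- (0 * (\<xi> * x)))"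
      by (intro AE_I2 tendsto_mult tendsto_const)
    show "AE x in lborel. norm (of_real (mollifier 1 x) * cis (- (1 / real (Suc n) * (\<xi> * x)))) \<le> mollifier 1 x" for n
      using mollifier_nonneg[of 1] by (intro AE_I2) (simp add: norm_mult del: of_nat_Suc)
  qed (use int in measurable)
  then show ?thesis unfolding eq by (simp add: integral_mollifier_1)
qed

text \<open>Cauchy-Schwarz with the kernel split into two square roots, one kept with
  \<open>g\<close>; the kernel has mass one in each variable.\<close>

lemma nn_integral_mollified_le:
  fixes g :: "real \<Rightarrow> complex"
  assumes [measurable]: "g \<in> borel_measurable borel" and m: "m > 0"
  shows "sq_int (\<lambda>x. LINT y|lborel. of_real (mollifier m (x - y)) * g y)
    \<le> sq_int g"
proof -
  note [measurable] = test_function_measurable[OF test_function_mollifier[OF m]]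
  let ?k = "\<lambda>x y. mollifier m (x - y)"
  note k0 = mollifier_nonneg[OF m]
  have shift: "(\<integral>\<^sup>+y. ennreal (?k x y) \<partial>lborel) = 1" "(\<integral>\<^sup>+x. ennreal (?k x y) \<partial>lborel) = 1" for x y
    using nn_integral_real_affine[of "\<lambda>x. ennreal (mollifier m x)" "- 1" x]
      nn_integral_real_affine[of "\<lambda>x. ennreal (mollifier m x)" 1 "- y"] nn_integral_mollifier[OF m] by simp_all
  have "ennreal ((cmod (LINT y|lborel. of_real (?k x y) * g y))\<^sup>2) \<le> (\<integral>\<^sup>+y. ennreal (?k x y * (cmod (g y))\<^sup>2) \<partial>lborel)" for x
  proof -
    have eq: "of_real (?k x y) * g y = of_real (sqrt (?k x y)) * (of_real (sqrt (?k x y)) * g y)" for y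
      using k0 by (simp flip: of_real_mult mult.assoc)
    have "ennreal ((cmod (LINT y|lborel. of_real (sqrt (?k x y)) * (of_real (sqrt (?k x y)) * g y)))\<^sup>2)
       \<le> sq_int (\<lambda>y. complex_of_real (sqrt (?k x y))) * sq_int (\<lambda>y. of_real (sqrt (?k x y)) * g y)"
      by (rule cauchy_schwarz_integral) measurable
    then show ?thesis unfolding eq[symmetric] using k0 shift by (simp add: norm_mult power_mult_distrib)
  qed
  then have "sq_int (\<lambda>x. LINT y|lborel. of_real (?k x y) * g y)
      \<le> (\<integral>\<^sup>+x. \<integral>\<^sup>+y. ennreal (?k x y * (cmod (g y))\<^sup>2) \<partial>lborel \<partial>lborel)"
    by (intro nn_integral_mono)
  also have "\<dots> = (\<integral>\<^sup>+y. \<integral>\<^sup>+x. ennreal (?k x y * (cmod (g y))\<^sup>2) \<partial>lborel \<partial>lborel)"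
    by (rule lborel_pair.Fubini') measurable
  also have "\<dots> = sq_int g"
    using k0 by (intro nn_integral_cong) (simp add: ennreal_mult nn_integral_multc shift)
  finally show ?thesis .
qed

text \<open>Absolute integrability on the product space justifies exchanging the integrals; a
  translation then separates the exponential.\<close>

lemma ft_convolution:
  fixes k f :: "real \<Rightarrow> complex"
  assumes k: "integrable lborel k" and f: "integrable lborel f"
  shows "integrable lborel (\<lambda>x. LINT y|lborel. k (x - y) * f y)"
    and "ft (\<lambda>x. LINT y|lborel. k (x - y) * f y) \<xi> = ft k \<xi> * ft f \<xi>"
proof -
  note [measurable] = borel_measurable_integrable[OF k, simplified] borel_measurable_integrable[OF f, simplified]
  have shift: "integrable lborel (\<lambda>x. k (x - y))" for y
    using lborel_integrable_real_affine[OF k, of 1 "- y"] by simp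
  have shift_norm: "(LINT x|lborel. cmod (k (x - y))) = (LINT x|lborel. cmod (k x))" for y
    using lborel_integral_real_affine[of 1 "\<lambda>x. cmod (k x)" "- y"] by simp
  have I: "integrable (lborel \<Otimes>\<^sub>M lborel) (\<lambda>(y, x). k (x - y) * f y)"
  proof (rule lborel_pair.Fubini_integrable)
    show "integrable lborel (\<lambda>y. LINT x|lborel. norm (case (y, x) of (y, x) \<Rightarrow> k (x - y) * f y))"
      using f by (simp add: norm_mult shift_norm)
    show "AE y in lborel. integrable lborel (\<lambda>x. case (y, x) of (y, x) \<Rightarrow> k (x - y) * f y)"
      using shift by simp
  qed measurable
  show "integrable lborel (\<lambda>x. LINT y|lborel. k (x - y) * f y)"
    using lborel_pair.integrable_snd[OF I] by simp
  have J: "integrable (lborel \<Otimes>\<^sub>M lborel) (\<lambda>(y, x). cis (- (\<xi> * x)) * (k (x - y) * f y))"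
    using integrable_cis_mult[OF I, of "\<lambda>p. - (\<xi> * snd p)"] by (simp add: split_beta')
  have "ft (\<lambda>x. LINT y|lborel. k (x - y) * f y) \<xi> = (LINT x|lborel. LINT y|lborel. cis (- (\<xi> * x)) * (k (x - y) * f y))"
    unfolding ft_def by (simp flip: integral_mult_right_zero)
  also have "\<dots> = (LINT y|lborel. LINT x|lborel. cis (- (\<xi> * x)) * (k (x - y) * f y))"
    using lborel_pair.Fubini_integral[OF J] by simp
  also have "\<dots> = (LINT y|lborel. ft k \<xi> * (cis (- (\<xi> * y)) * f y))"
  proof (intro Bochner_Integration.integral_cong refl)
    fix y :: real
    have "(LINT x|lborel. cis (- (\<xi> * x)) * (k (x - y) * f y)) = (LINT x|lborel. cis (- (\<xi> * (y + x))) * (k x * f y))"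
      using lborel_integral_real_affine[of 1 "\<lambda>x. cis (- (\<xi> * x)) * (k (x - y) * f y)" y] by simp
    also have "\<dots> = (LINT x|lborel. (cis (- (\<xi> * x)) * k x) * (cis (- (\<xi> * y)) * f y))"
    proof (intro Bochner_Integration.integral_cong refl)
      fix x
      have "cis (- (\<xi> * (y + x))) = cis (- (\<xi> * x)) * cis (- (\<xi> * y))"
        by (simp add: cis_mult algebra_simps)
      then show "cis (- (\<xi> * (y + x))) * (k x * f y) = (cis (- (\<xi> * x)) * k x) * (cis (- (\<xi> * y)) * f y)"
        by (simp only: mult_ac)
    qed
    also have "\<dots> = ft k \<xi> * (cis (- (\<xi> * y)) * f y)" unfolding ft_def by (rule integral_mult_left_zero)
    finally show "(LINT x|lborel. cis (- (\<xi> * x)) * (k (x - y) * f y)) = ft k \<xi> * (cis (- (\<xi> * y)) * f y)" .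
  qed
  also have "\<dots> = ft k \<xi> * ft f \<xi>" unfolding ft_def[of f] by (rule integral_mult_right_zero)
  finally show "ft (\<lambda>x. LINT y|lborel. k (x - y) * f y) \<xi> = ft k \<xi> * ft f \<xi>" .
qed

text \<open>Mollification turns the weak derivative into an honest convolution identity
  \<open>k\<^sup>(\<^sup>n\<^sup>) * f = k * g\<close>, both sides of which are integrable and square integrable.\<close>

lemma ft_weak_deriv_bound:
  fixes f g :: "real \<Rightarrow> complex"
  assumes f: "integrable lborel f" and g [measurable]: "g \<in> borel_measurable borel"
    and wd: "\<And>\<psi>. test_function \<psi> \<Longrightarrow>
      (LINT x|lborel. of_real ((deriv ^^ n) \<psi> x) * f x) = (-1) ^ n * (LINT x|lborel. of_real (\<psi> x) * g x)"
  shows "(\<integral>\<^sup>+\<xi>. ennreal (\<xi> ^ (2 * n) * (cmod (ft f \<xi>))\<^sup>2) \<partial>lborel) \<le> ennreal (2 * pi) * sq_int g"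
proof -
  note [measurable] = borel_measurable_integrable[OF f, simplified]
  define K where "K = (\<lambda>m \<xi>. ft (\<lambda>x. of_real (mollifier (real (Suc m)) x)) \<xi>)"
  have [measurable]: "mollifier (real (Suc m)) \<in> borel_measurable borel" for m
    by (intro test_function_measurable test_function_mollifier) simp
  have [measurable]: "K m \<in> borel_measurable borel" for m unfolding K_def by measurable
  have bound: "(\<integral>\<^sup>+\<xi>. ennreal (\<xi> ^ (2 * n) * (cmod (K m \<xi>))\<^sup>2 * (cmod (ft f \<xi>))\<^sup>2) \<partial>lborel)
      \<le> ennreal (2 * pi) * sq_int g" for m
  proof -
    let ?k = "mollifier (real (Suc m))"
    have t: "test_function ?k" by (rule test_function_mollifier) simp
    define \<phi> where "\<phi> = (\<lambda>x. complex_of_real ((deriv ^^ n) ?k x))"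
    have \<phi>: "integrable lborel \<phi>"
      unfolding \<phi>_def by (intro integrable_of_real test_function_integrable test_function_higher_deriv t)
    have conv: "(LINT y|lborel. \<phi> (x - y) * f y) = (LINT y|lborel. of_real (?k (x - y)) * g y)" for x
    proof -
      \<comment> \<open>The reflected mollifier is the test function: its \<open>n\<close>-th
        derivative brings a sign \<open>(- 1) ^ n\<close>, which cancels that of the weak
        derivative.\<close>
      let ?\<psi> = "\<lambda>y. ?k (- 1 * y + x)"
      obtain a where a: "a > 0" "\<And>x. a \<le> \<bar>x\<bar> \<Longrightarrow> ?k x = 0" using test_function_cutoff[OF t] by blast
      have sm: "smooth ?k" by (rule test_function_smooth[OF t])
      have "test_function ?\<psi>"
      proof (rule test_functionI[where a = "x - a" and b = "x + a"])
        show "smooth ?\<psi>" using smooth_affine[OF sm, of 1 "- 1" x] by simp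
      qed (auto intro!: a(2) simp del: of_nat_Suc)
      from wd[OF this] have "(LINT y|lborel. (- 1) ^ n * (\<phi> (x - y) * f y)) = (- 1) ^ n * (LINT y|lborel. of_real (?k (x - y)) * g y)"
        unfolding higher_deriv_affine[OF sm] \<phi>_def by (simp add: mult.assoc)
      then show ?thesis by (subst (asm) integral_mult_right_zero) simp
    qed
    have fc: "ft (\<lambda>x. LINT y|lborel. \<phi> (x - y) * f y) \<xi> = (\<i> * of_real \<xi>) ^ n * K m \<xi> * ft f \<xi>" for \<xi>
      unfolding ft_convolution(2)[OF \<phi> f] unfolding \<phi>_def ft_higher_deriv[OF t] K_def ..
    have "(cmod (ft (\<lambda>x. LINT y|lborel. \<phi> (x - y) * f y) \<xi>))\<^sup>2 = \<xi> ^ (2 * n) * (cmod (K m \<xi>))\<^sup>2 * (cmod (ft f \<xi>))\<^sup>2" for \<xi>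
    proof -
      have "(\<bar>\<xi>\<bar> ^ n)\<^sup>2 = \<xi> ^ (2 * n)" by (metis power2_abs power_abs power_mult mult.commute)
      then show ?thesis unfolding fc by (simp add: norm_mult norm_power power_mult_distrib)
    qed
    then have "(\<integral>\<^sup>+\<xi>. ennreal (\<xi> ^ (2 * n) * (cmod (K m \<xi>))\<^sup>2 * (cmod (ft f \<xi>))\<^sup>2) \<partial>lborel)
       \<le> ennreal (2 * pi) * sq_int (\<lambda>x. LINT y|lborel. \<phi> (x - y) * f y)"
      using ft_bessel[OF ft_convolution(1)[OF \<phi> f]] by simp
    also have "\<dots> \<le> ennreal (2 * pi) * sq_int g"
      unfolding conv by (intro mult_left_mono nn_integral_mollified_le g) auto
    finally show ?thesis .
  qed
  \<comment> \<open>The bound is uniform in \<open>m\<close> and \<open>K m\<close> tends to 1, so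
    Fatou's lemma removes the mollifier.\<close>
  have "(\<integral>\<^sup>+\<xi>. ennreal (\<xi> ^ (2 * n) * (cmod (ft f \<xi>))\<^sup>2) \<partial>lborel)
     = (\<integral>\<^sup>+\<xi>. liminf (\<lambda>m. ennreal (\<xi> ^ (2 * n) * (cmod (K m \<xi>))\<^sup>2 * (cmod (ft f \<xi>))\<^sup>2)) \<partial>lborel)"
  proof (intro nn_integral_cong)
    fix \<xi> :: real
    have "(\<lambda>m. ennreal (\<xi> ^ (2 * n) * (cmod (K m \<xi>))\<^sup>2 * (cmod (ft f \<xi>))\<^sup>2)) \<longlonglongrightarrow> ennreal (\<xi> ^ (2 * n) * (cmod 1)\<^sup>2 * (cmod (ft f \<xi>))\<^sup>2)"
      unfolding K_def by (intro tendsto_ennrealI tendsto_intros ft_mollifier_tendsto)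
    from lim_imp_Liminf[OF sequentially_bot this]
    show "ennreal (\<xi> ^ (2 * n) * (cmod (ft f \<xi>))\<^sup>2) = liminf (\<lambda>m. ennreal (\<xi> ^ (2 * n) * (cmod (K m \<xi>))\<^sup>2 * (cmod (ft f \<xi>))\<^sup>2))"
      by simp
  qed
  also have "\<dots> \<le> liminf (\<lambda>m. \<integral>\<^sup>+\<xi>. ennreal (\<xi> ^ (2 * n) * (cmod (K m \<xi>))\<^sup>2 * (cmod (ft f \<xi>))\<^sup>2) \<partial>lborel)"
    by (rule nn_integral_liminf) measurable
  also have "\<dots> \<le> ennreal (2 * pi) * sq_int g"
    using bound by (intro Liminf_le) auto
  finally show ?thesis .
qed

text \<open>Turns derivatives of the initial datum into powers of the frequency. Squares of
  components add up on both sides, so the dimension does not enter the constant.\<close>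

lemma fourier_weak_deriv_bound:
  fixes f g :: "real \<Rightarrow> complex ^ 'n::finite"
  assumes f: "integrable lborel f" and wd: "has_weak_deriv n f g"
  shows "(\<integral>\<^sup>+\<xi>. ennreal (\<xi> ^ (2 * n) * (norm (fourier f \<xi>))\<^sup>2) \<partial>lborel)
    \<le> ennreal (2 * pi) * sq_int g"
proof -
  have L2: "in_L2 f" "in_L2 g" using wd by (auto simp: has_weak_deriv_def)
  note gi = in_L2_D[OF L2(2)[unfolded in_L2_vec_iff, rule_format]]
  have fi: "integrable lborel (\<lambda>x. f x $ i)" for i
    by (rule integrable_bounded_linear[OF bounded_linear_vec_nth f])
  note [measurable] = gi(1) borel_measurable_integrable[OF fi, simplified]
  have b: "(\<integral>\<^sup>+\<xi>. ennreal (\<xi> ^ (2 * n) * (cmod (ft (\<lambda>x. f x $ i) \<xi>))\<^sup>2) \<partial>lborel)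
      \<le> ennreal (2 * pi) * sq_int (\<lambda>x. g x $ i)" for i
  proof (rule ft_weak_deriv_bound[OF fi gi(1)])
    fix \<psi> assume \<psi>: "test_function \<psi>"
    have "(LINT x|lborel. (deriv ^^ n) \<psi> x *\<^sub>R f x) $ i = ((-1) ^ n *\<^sub>R (LINT x|lborel. \<psi> x *\<^sub>R g x)) $ i"
      using wd \<psi> by (simp only: has_weak_deriv_def)
    then show "(LINT x|lborel. of_real ((deriv ^^ n) \<psi> x) * f x $ i) = (-1) ^ n * (LINT x|lborel. of_real (\<psi> x) * g x $ i)"
      unfolding integral_test_component[OF test_function_higher_deriv[OF \<psi>] L2(1)] vector_scaleR_component
        integral_test_component[OF \<psi> L2(2)] scaleR_conv_of_real[where 'a = complex] by simp
  qed
  have fo: "fourier f \<xi> $ i = ft (\<lambda>x. f x $ i) \<xi>" for \<xi> i by (simp add: fourier_def ft_def)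
  have "(\<integral>\<^sup>+\<xi>. ennreal (\<xi> ^ (2 * n) * (norm (fourier f \<xi>))\<^sup>2) \<partial>lborel)
     = (\<Sum>i\<in>UNIV. \<integral>\<^sup>+\<xi>. ennreal (\<xi> ^ (2 * n) * (cmod (ft (\<lambda>x. f x $ i) \<xi>))\<^sup>2) \<partial>lborel)"
    unfolding norm_sq_vec fo sum_distrib_left by (subst nn_integral_sum[symmetric]) (auto simp: sum_ennreal)
  also have "\<dots> \<le> (\<Sum>i\<in>UNIV. ennreal (2 * pi) * sq_int (\<lambda>x. g x $ i))"
    by (intro sum_mono b)
  also have "\<dots> = ennreal (2 * pi) * sq_int g"
    unfolding norm_sq_vec sum_distrib_left[symmetric] by (subst nn_integral_sum[symmetric]) (auto simp: sum_ennreal)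
  finally show ?thesis .
qed

section \<open>Decay estimates\<close>

lemma L2_norm_sq:
  assumes "in_L2 g"
  shows "ennreal ((L2_norm g)\<^sup>2) = sq_int g"
  using assms unfolding in_L2_def L2_norm_def by (subst nn_integral_eq_integral) auto

lemma L2_norm_nonneg: "0 \<le> L2_norm g"
  by (simp add: L2_norm_def)

text \<open>\<open>weak_deriv\<close> is chosen arbitrarily; almost everywhere uniqueness transfers
  the bound from the constructed derivative to the chosen one.\<close>

lemma weak_deriv_fourier_bound:
  fixes f F :: "real \<Rightarrow> complex ^ 'n::finite"
  assumes fF: "has_L2_fourier f F"
    and fin: "(\<integral>\<^sup>+\<xi>. ennreal (\<xi> ^ (2 * n) * (norm (F \<xi>))\<^sup>2) \<partial>lborel) < \<infinity>"
  shows "has_weak_deriv n f (weak_deriv n f)"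
    and "ennreal (2 * pi) * ennreal ((L2_norm (weak_deriv n f))\<^sup>2) \<le> (\<integral>\<^sup>+\<xi>. ennreal (\<xi> ^ (2 * n) * (norm (F \<xi>))\<^sup>2) \<partial>lborel)"
proof -
  have [measurable]: "F \<in> borel_measurable borel" using fF by (simp add: has_L2_fourier_def in_L2_def)
  have "integrable lborel (\<lambda>\<xi>. \<xi> ^ (2 * n) * (norm (F \<xi>))\<^sup>2)"
    using fin by (intro integrableI_nonneg) auto
  from weak_deriv_exists[OF fF this] obtain g where g: "has_weak_deriv n f g"
    and gb: "ennreal (2 * pi) * sq_int g \<le> (\<integral>\<^sup>+\<xi>. ennreal (\<xi> ^ (2 * n) * (norm (F \<xi>))\<^sup>2) \<partial>lborel)"
    by blast
  show w: "has_weak_deriv n f (weak_deriv n f)"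
    unfolding weak_deriv_def by (rule someI[of "has_weak_deriv n f", OF g])
  have "ennreal ((L2_norm (weak_deriv n f))\<^sup>2) = sq_int (weak_deriv n f)"
    using w by (intro L2_norm_sq) (simp add: has_weak_deriv_def)
  also have "\<dots> = sq_int g"
    using weak_deriv_unique[OF w g] by (intro nn_integral_cong_AE) (auto elim: eventually_mono)
  finally show "ennreal (2 * pi) * ennreal ((L2_norm (weak_deriv n f))\<^sup>2) \<le> (\<integral>\<^sup>+\<xi>. ennreal (\<xi> ^ (2 * n) * (norm (F \<xi>))\<^sup>2) \<partial>lborel)"
    using gb by simp
qed

lemma norm_fourier_le:
  fixes f :: "real \<Rightarrow> complex ^ 'n::finite"
  assumes f: "in_L1 f"
  shows "(norm (fourier f \<xi>))\<^sup>2 \<le> real CARD('n) * (L1_norm f)\<^sup>2"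
proof -
  have fi: "integrable lborel f" using f by (simp add: in_L1_def)
  have "(norm (fourier f \<xi> $ i))\<^sup>2 \<le> (L1_norm f)\<^sup>2" for i
  proof (rule power_mono)
    have "norm (fourier f \<xi> $ i) = cmod (ft (\<lambda>x. f x $ i) \<xi>)" by (simp add: fourier_def ft_def)
    also have "\<dots> \<le> (LINT x|lborel. cmod (f x $ i))" by (rule cmod_ft_le)
    also have "\<dots> \<le> L1_norm f"
      unfolding L1_norm_def
      by (intro integral_mono integrable_norm integrable_bounded_linear[OF bounded_linear_vec_nth] fi Finite_Cartesian_Product.norm_nth_le)
    finally show "norm (fourier f \<xi> $ i) \<le> L1_norm f" .
  qed simp
  then have "(\<Sum>i\<in>UNIV. (norm (fourier f \<xi> $ i))\<^sup>2) \<le> (\<Sum>i\<in>(UNIV :: 'n set). (L1_norm f)\<^sup>2)" by (rule sum_mono)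
  then show ?thesis by (simp add: norm_sq_vec)
qed

section \<open>Time decay of frequency weights\<close>

lemma power_mult_exp_le:
  fixes c x :: real
  assumes "c > 0" "x \<ge> 0" "k > 0"
  shows "x ^ k * exp (- c * x) \<le> (real k / c) ^ k"
proof -
  have "0 \<le> c * x" using assms by simp
  then have nn: "- real k \<le> c * x" by linarith
  have "(c * x / real k) ^ k \<le> (1 + c * x / real k) ^ k"
    using assms by (intro power_mono) auto
  also have "\<dots> \<le> exp (c * x)"
    using assms nn by (intro exp_ge_one_plus_x_over_n_power_n) auto
  finally have "(c * x / real k) ^ k * exp (- c * x) \<le> exp (c * x) * exp (- c * x)"
    by (intro mult_right_mono) auto
  also have "\<dots> = 1" by (simp flip: exp_add)
  finally have "(c * x / real k) ^ k * exp (- c * x) \<le> 1" .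
  moreover have "x ^ k * exp (- c * x) = (real k / c) ^ k * ((c * x / real k) ^ k * exp (- c * x))"
    using assms by (simp add: power_divide power_mult_distrib)
  ultimately show ?thesis
    using mult_left_mono[of "(c * x / real k) ^ k * exp (- c * x)" 1 "(real k / c) ^ k"] assms by simp
qed

lemma low_moment_finite:
  fixes c :: real
  assumes c: "c > 0"
  shows "(\<integral>\<^sup>+\<xi>. ennreal (\<xi> ^ (2 * j) * exp (- c * \<xi> ^ 4)) \<partial>lborel) < \<infinity>"
proof -
  \<comment> \<open>The summand 2 serves \<open>\<xi>\<^sup>2 \<le> 1\<close>. For larger values the
    bounded product of a power and an exponential is used with the exponent \<open>Suc j\<close>,
    which is positive even for \<open>j = 0\<close>.\<close>
  define B where "B = 2 + 2 * (real (Suc j) / c) ^ Suc j"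
  have "\<xi> ^ (2 * j) * exp (- c * \<xi> ^ 4) \<le> B * inverse (1 + \<xi>\<^sup>2)" for \<xi> :: real
  proof -
    have B: "2 \<le> B" "2 * (real (Suc j) / c) ^ Suc j \<le> B" using c by (simp_all add: B_def)
    define x where "x = \<xi>\<^sup>2"
    have x: "0 \<le> x" by (simp add: x_def)
    have "x ^ j * exp (- c * x\<^sup>2) * (1 + x) \<le> B"
    proof (cases "x \<le> 1")
      case True
      have "x ^ j * exp (- c * x\<^sup>2) * (1 + x) \<le> 1 * 1 * 2"
        using True x c by (intro mult_mono power_le_one) auto
      then show ?thesis using B by simp
    next
      case False
      have "x ^ j * (1 + x) \<le> x ^ j * (2 * x)" using False x by (intro mult_left_mono) auto
      also have "\<dots> = 2 * x ^ Suc j" by simp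
      also have "x ^ Suc j \<le> x ^ (2 * Suc j)" using False by (intro power_increasing) auto
      finally have "x ^ j * (1 + x) * exp (- c * x\<^sup>2) \<le> 2 * x ^ (2 * Suc j) * exp (- c * x\<^sup>2)"
        by (intro mult_right_mono) auto
      also have "\<dots> = 2 * ((x\<^sup>2) ^ Suc j * exp (- c * x\<^sup>2))" by (simp only: power_mult mult.assoc)
      also have "\<dots> \<le> 2 * (real (Suc j) / c) ^ Suc j"
        using c by (intro mult_left_mono power_mult_exp_le) auto
      finally show ?thesis using B by (simp add: mult_ac)
    qed
    then have "x ^ j * exp (- c * x\<^sup>2) \<le> B * inverse (1 + x)"
      using x by (simp add: field_simps)
    moreover have "x ^ j = \<xi> ^ (2 * j)" "x\<^sup>2 = \<xi> ^ 4" by (simp_all add: x_def flip: power_mult)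
    ultimately show ?thesis by (simp add: x_def)
  qed
  then have "(\<integral>\<^sup>+\<xi>. ennreal (\<xi> ^ (2 * j) * exp (- c * \<xi> ^ 4)) \<partial>lborel) \<le> (\<integral>\<^sup>+\<xi>. ennreal (B * inverse (1 + \<xi>\<^sup>2)) \<partial>lborel)"
    by (intro nn_integral_mono ennreal_leI)
  also have "\<dots> < \<infinity>"
    using integrable_mult_right[OF integrable_inverse_1_plus_sq, of B] c
    by (subst nn_integral_eq_integral) (auto simp: B_def)
  finally show ?thesis .
qed

text \<open>The substitution of \<open>s powr (- 1 / 4) * \<xi>\<close> for \<open>\<xi>\<close>
  absorbs \<open>s\<close> into the exponential. The Jacobian and the factor
  \<open>\<xi> ^ (2 * j)\<close> produce the exponent, half of which is
  \<open>- 1 / 8 - j / 4\<close>.\<close>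

lemma low_moment_scaled:
  fixes c s :: real
  assumes s: "s > 0"
  shows "(\<integral>\<^sup>+\<xi>. ennreal (\<xi> ^ (2 * j) * exp (- c * \<xi> ^ 4 * s)) \<partial>lborel)
    = ennreal (s powr (- (2 * real j + 1) / 4)) * (\<integral>\<^sup>+\<xi>. ennreal (\<xi> ^ (2 * j) * exp (- c * \<xi> ^ 4)) \<partial>lborel)"
proof -
  define a where "a = s powr (- 1 / 4)"
  have a: "a > 0" using s by (simp add: a_def)
  have "a ^ 4 = a powr real 4" using a by (subst powr_realpow) auto
  also have "\<dots> = s powr (- 1 / 4 * real 4)" unfolding a_def by (rule powr_powr)
  also have "\<dots> = inverse s" using s by (simp add: powr_minus)
  finally have a4: "a ^ 4 * s = 1" using s by simp
  have ap: "a * a ^ (2 * j) = s powr (- (2 * real j + 1) / 4)"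
  proof -
    have "a * a ^ (2 * j) = a powr (real (Suc (2 * j)))" using a by (subst powr_realpow) auto
    also have "\<dots> = s powr (- 1 / 4 * real (Suc (2 * j)))" unfolding a_def by (rule powr_powr)
    also have "- 1 / 4 * real (Suc (2 * j)) = - (2 * real j + 1) / 4" by (simp add: field_simps)
    finally show ?thesis .
  qed
  have "(\<integral>\<^sup>+\<xi>. ennreal (\<xi> ^ (2 * j) * exp (- c * \<xi> ^ 4 * s)) \<partial>lborel)
     = ennreal a * (\<integral>\<^sup>+\<xi>. ennreal ((a * \<xi>) ^ (2 * j) * exp (- c * (a * \<xi>) ^ 4 * s)) \<partial>lborel)"
    using nn_integral_real_affine[of "\<lambda>\<xi>. ennreal (\<xi> ^ (2 * j) * exp (- c * \<xi> ^ 4 * s))" a 0] a by simp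
  also have "\<dots> = ennreal a * (\<integral>\<^sup>+\<xi>. ennreal (a ^ (2 * j)) * ennreal (\<xi> ^ (2 * j) * exp (- c * \<xi> ^ 4)) \<partial>lborel)"
  proof (intro arg_cong2[of _ _ _ _ "(*)"] refl nn_integral_cong)
    fix \<xi> :: real
    have "(a * \<xi>) ^ 4 * s = \<xi> ^ 4" using a4 by (simp add: power_mult_distrib mult.commute mult.left_commute)
    then have "- c * (a * \<xi>) ^ 4 * s = - c * \<xi> ^ 4" by (simp only: mult.assoc)
    then show "ennreal ((a * \<xi>) ^ (2 * j) * exp (- c * (a * \<xi>) ^ 4 * s)) = ennreal (a ^ (2 * j)) * ennreal (\<xi> ^ (2 * j) * exp (- c * \<xi> ^ 4))"
      using a by (simp add: power_mult_distrib mult.assoc flip: ennreal_mult)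
  qed
  also have "\<dots> = ennreal (a * a ^ (2 * j)) * (\<integral>\<^sup>+\<xi>. ennreal (\<xi> ^ (2 * j) * exp (- c * \<xi> ^ 4)) \<partial>lborel)"
    using a by (simp add: nn_integral_cmult ennreal_mult mult.assoc)
  finally show ?thesis unfolding ap .
qed

text \<open>With \<open>y = sqrt (1 + t) / \<xi>\<^sup>2\<close> the exponential is at most
  \<open>exp c * exp (- c * y\<^sup>2)\<close>. The product of \<open>y ^ l\<close> with the last
  factor is bounded, and \<open>\<xi> ^ (2 * l) * y ^ l\<close> is
  \<open>(1 + t) powr (l / 2)\<close>.\<close>

lemma high_frequency_decay:
  fixes c \<xi> t :: real
  assumes c: "c > 0" and t: "t \<ge> 0" and \<xi>: "1 < \<bar>\<xi>\<bar>" and l: "l > 0"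
  shows "exp (- c * inverse \<xi> ^ 4 * t) \<le> exp c * (1 + (real l / c) ^ l) * (1 + t) powr (- real l / 2) * \<xi> ^ (2 * l)"
proof -
  define y where "y = inverse (\<xi>\<^sup>2) * sqrt (1 + t)"
  have y: "y \<ge> 0" using t by (simp add: y_def)
  have q: "inverse \<xi> ^ 4 \<le> 1"
    using \<xi> power_le_one[of "\<bar>inverse \<xi>\<bar>" 4] by (simp add: field_simps abs_inverse)
  have y2: "y\<^sup>2 = inverse \<xi> ^ 4 * (1 + t)"
    using t by (simp add: y_def power_mult_distrib power_inverse flip: power_mult)
  have "exp (- c * inverse \<xi> ^ 4 * t) = exp (c * inverse \<xi> ^ 4) * exp (- c * y\<^sup>2)"
    by (simp add: y2 exp_add[symmetric] algebra_simps)
  also have "\<dots> \<le> exp c * exp (- c * y\<^sup>2)"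
    using q c by (intro mult_right_mono) auto
  finally have 1: "exp (- c * inverse \<xi> ^ 4 * t) \<le> exp c * exp (- c * y\<^sup>2)" .
  have "y ^ l * exp (- c * y\<^sup>2) \<le> (1 + (y\<^sup>2) ^ l) * exp (- c * y\<^sup>2)"
  proof (intro mult_right_mono)
    \<comment> \<open>\<open>l\<close> may be odd, whereas the available bound concerns integer
      powers of \<open>y\<^sup>2\<close>.\<close>
    show "y ^ l \<le> 1 + (y\<^sup>2) ^ l"
    proof (cases "y \<le> 1")
      case True
      have "0 \<le> (y\<^sup>2) ^ l" by simp
      with power_le_one[OF y True, of l] show ?thesis by linarith
    next
      case False
      then have "y ^ l \<le> y ^ (2 * l)" by (intro power_increasing) auto
      then show ?thesis by (simp add: power_mult)
    qed
  qed simp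
  also have "\<dots> = exp (- c * y\<^sup>2) + (y\<^sup>2) ^ l * exp (- c * y\<^sup>2)" by (simp add: algebra_simps)
  also have "\<dots> \<le> 1 + (real l / c) ^ l"
    using c l by (intro add_mono power_mult_exp_le) auto
  finally have 2: "y ^ l * exp (- c * y\<^sup>2) \<le> 1 + (real l / c) ^ l" .
  have "sqrt (1 + t) ^ l = (1 + t) powr (real l / 2)"
    using t by (simp add: powr_half_sqrt[symmetric] powr_powr flip: powr_realpow)
  then have "y ^ l = inverse (\<xi> ^ (2 * l)) * (1 + t) powr (real l / 2)"
    by (simp add: y_def power_mult_distrib power_inverse power_mult)
  then have "y ^ l * ((1 + t) powr (- real l / 2) * \<xi> ^ (2 * l))
      = (inverse (\<xi> ^ (2 * l)) * \<xi> ^ (2 * l)) * ((1 + t) powr (real l / 2) * (1 + t) powr (- real l / 2))"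
    by (simp only: mult_ac)
  moreover have "inverse (\<xi> ^ (2 * l)) * \<xi> ^ (2 * l) = 1" using \<xi> by auto
  moreover have "(1 + t) powr (real l / 2) * (1 + t) powr (- real l / 2) = 1"
    using t by (simp flip: powr_add)
  ultimately have yl: "y ^ l * ((1 + t) powr (- real l / 2) * \<xi> ^ (2 * l)) = 1" by (simp only: mult_1_left)
  have "exp (- c * y\<^sup>2) = (y ^ l * exp (- c * y\<^sup>2)) * ((1 + t) powr (- real l / 2) * \<xi> ^ (2 * l))"
    using yl by (simp add: mult_ac)
  also have "\<dots> \<le> (1 + (real l / c) ^ l) * ((1 + t) powr (- real l / 2) * \<xi> ^ (2 * l))"
    by (intro mult_right_mono 2) simp
  finally have "exp c * exp (- c * y\<^sup>2) \<le> exp c * ((1 + (real l / c) ^ l) * ((1 + t) powr (- real l / 2) * \<xi> ^ (2 * l)))"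
    by (intro mult_left_mono) auto
  from order_trans[OF 1 this] show ?thesis by (simp only: mult.assoc)
qed

lemma le_of_square_le:
  fixes a P Q x y :: real
  assumes "a\<^sup>2 \<le> P * x\<^sup>2 + Q * y\<^sup>2" "0 \<le> P" "0 \<le> Q" "0 \<le> x" "0 \<le> y"
  shows "a \<le> sqrt P * x + sqrt Q * y"
proof (rule power2_le_imp_le)
  have "0 \<le> 2 * (sqrt P * x) * (sqrt Q * y)" using assms by simp
  moreover have "(sqrt P * x)\<^sup>2 = P * x\<^sup>2" "(sqrt Q * y)\<^sup>2 = Q * y\<^sup>2"
    using assms by (simp_all add: power_mult_distrib)
  ultimately show "a\<^sup>2 \<le> (sqrt P * x + sqrt Q * y)\<^sup>2"
    unfolding power2_sum using assms(1) by linarith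
qed (use assms in simp)

theorem theorem3p7:
  fixes k1 k2 k3 k4 \<gamma> :: real
    and N l :: nat
    and U0 :: "real \<Rightarrow> complex ^ 7"
    and U :: "real \<Rightarrow> real \<Rightarrow> complex ^ 7"
  assumes "k1 > 0" "k2 > 0" "k3 > 0" "k4 > 0" "\<gamma> > 0"
    and "N \<ge> 1" "l \<ge> 1" "l \<le> N"
    and "in_Sobolev N U0" "in_L1 U0"
    and "laminated_solution k1 k2 k3 k4 \<gamma> U0 U"
  shows "\<forall>j\<in>{0..N - l}. \<exists>c0>0. \<exists>c1>0. \<forall>t\<ge>0.
    in_Sobolev j (U t) \<and>
    (k1 = k2 \<and> k2 = k3 \<longrightarrow>
      L2_norm (weak_deriv j (U t)) \<le>
        c0 * (1 + t) powr (- 1 / 8 - real j / 4) * L1_norm U0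
        + c0 * exp (- c1 * t) * L2_norm (weak_deriv (j + l) U0)) \<and>
    (\<not> (k1 = k2 \<and> k2 = k3) \<longrightarrow>
      L2_norm (weak_deriv j (U t)) \<le>
        c0 * (1 + t) powr (- 1 / 8 - real j / 4) * L1_norm U0
        + c0 * (1 + t) powr (- real l / 4) * L2_norm (weak_deriv (j + l) U0))"
proof
  fix j assume j: "j \<in> {0..N - l}"
  let ?e = "k1 = k2 \<and> k2 = k3"
  interpret laminated k1 k2 k3 k4 \<gamma> by unfold_locales (use assms in auto)
  have l: "l > 0" and jl: "j + l \<le> N" using j assms by auto
  obtain W where ode: "\<And>\<xi>. laminated_ode k1 k2 k3 k4 \<gamma> \<xi> (W \<xi>)" and W0: "\<And>\<xi>. W \<xi> 0 = fourier U0 \<xi>"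
    and UW: "\<And>t. t \<ge> 0 \<Longrightarrow> has_L2_fourier (U t) (\<lambda>\<xi>. W \<xi> t)"
    using assms(11) unfolding laminated_solution_def by blast
  obtain C c where C: "C > 0" and c: "c > 0"
    and dec: "\<forall>\<xi> W t. laminated_ode k1 k2 k3 k4 \<gamma> \<xi> W \<longrightarrow> 0 \<le> t \<longrightarrow>
      (norm (W t))\<^sup>2 \<le> C * exp (- c * decay_rate ?e \<xi> * t) * (norm (W 0))\<^sup>2"
    using decay_complex by (elim exE conjE) (rule that)
  have Wdec: "(norm (W \<xi> t))\<^sup>2 \<le> C * exp (- c * decay_rate ?e \<xi> * t) * (norm (fourier U0 \<xi>))\<^sup>2" if "t \<ge> 0" for \<xi> t
    using dec[rule_format, OF ode that] W0 by simp
  have L1: "integrable lborel U0" using assms by (simp add: in_L1_def)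
  have U0d: "has_weak_deriv n U0 (weak_deriv n U0)" if "n \<le> N" for n
    using assms(9) that unfolding in_Sobolev_def weak_deriv_def by (metis someI_ex)
  define I where "I = (\<lambda>n. \<integral>\<^sup>+\<xi>. ennreal (\<xi> ^ (2 * n) * (norm (fourier U0 \<xi>))\<^sup>2) \<partial>lborel)"
  have I: "I n \<le> ennreal (2 * pi) * ennreal ((L2_norm (weak_deriv n U0))\<^sup>2)" if "n \<le> N" for n
    using fourier_weak_deriv_bound[OF L1 U0d[OF that]] U0d[OF that] unfolding I_def
    by (subst L2_norm_sq) (auto simp: has_weak_deriv_def)
  have Ifin: "I n < \<infinity>" if "n \<le> N" for n
    using I[OF that] by (rule le_less_trans) (simp add: ennreal_mult_less_top)
  \<comment> \<open>At time 0 the transform of the solution is that of the datum, so the solution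
    concept supplies measurability.\<close>
  have [measurable]: "fourier U0 \<in> borel_measurable borel"
    using UW[of 0] by (simp add: has_L2_fourier_def in_L2_def W0)
  have rate0: "0 \<le> decay_rate ?e \<xi>" for \<xi> by (simp add: decay_rate_def)
  \<comment> \<open>Nonnegativity of the rate bounds the state by its initial value at each
    frequency, so the solution keeps all derivatives of the datum up to order
    \<open>N\<close>.\<close>
  have fin: "(\<integral>\<^sup>+\<xi>. ennreal (\<xi> ^ (2 * n) * (norm (W \<xi> t))\<^sup>2) \<partial>lborel) < \<infinity>" if "t \<ge> 0" "n \<le> N" for t n
  proof -
    have "\<xi> ^ (2 * n) * (norm (W \<xi> t))\<^sup>2 \<le> C * (\<xi> ^ (2 * n) * (norm (fourier U0 \<xi>))\<^sup>2)" for \<xi>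
    proof -
      have "exp (- c * decay_rate ?e \<xi> * t) \<le> 1" using c rate0[of \<xi>] that(1) by simp
      then have "C * exp (- c * decay_rate ?e \<xi> * t) * (norm (fourier U0 \<xi>))\<^sup>2 \<le> C * 1 * (norm (fourier U0 \<xi>))\<^sup>2"
        using C by (intro mult_right_mono mult_left_mono) auto
      with Wdec[OF that(1), of \<xi>] have "(norm (W \<xi> t))\<^sup>2 \<le> C * (norm (fourier U0 \<xi>))\<^sup>2" by simp
      then have "\<xi> ^ (2 * n) * (norm (W \<xi> t))\<^sup>2 \<le> \<xi> ^ (2 * n) * (C * (norm (fourier U0 \<xi>))\<^sup>2)"
        by (intro mult_left_mono) auto
      then show ?thesis by (simp add: mult_ac)
    qed
    then have "(\<integral>\<^sup>+\<xi>. ennreal (\<xi> ^ (2 * n) * (norm (W \<xi> t))\<^sup>2) \<partial>lborel)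
        \<le> (\<integral>\<^sup>+\<xi>. ennreal C * ennreal (\<xi> ^ (2 * n) * (norm (fourier U0 \<xi>))\<^sup>2) \<partial>lborel)"
      using C by (intro nn_integral_mono) (simp add: ennreal_leI flip: ennreal_mult)
    also have "\<dots> = ennreal C * I n" unfolding I_def by (rule nn_integral_cmult) measurable
    also have "\<dots> < \<infinity>" using Ifin[OF that(2)] by (simp add: ennreal_mult_less_top)
    finally show ?thesis .
  qed
  define Lm where "Lm = enn2real (\<integral>\<^sup>+\<xi>. ennreal (\<xi> ^ (2 * j) * exp (- c * \<xi> ^ 4)) \<partial>lborel)"
  have Lm: "(\<integral>\<^sup>+\<xi>. ennreal (\<xi> ^ (2 * j) * exp (- c * \<xi> ^ 4)) \<partial>lborel) = ennreal Lm" "0 \<le> Lm"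
    using low_moment_finite[OF c, of j] by (simp_all add: Lm_def less_top)
  \<comment> \<open>Factor for the squared norm at high frequencies; its root supplies the second
    term of the estimate.\<close>
  define E where "E = (\<lambda>t. if ?e then exp (- c * t) else exp c * (1 + (real l / c) ^ l) * (1 + t) powr (- real l / 2))"
  \<comment> \<open>7 is the number of components in \<open>norm_fourier_le\<close>,
    \<open>exp c\<close> the price of passing from \<open>t\<close> to \<open>1 + t\<close>, and
    \<open>Lm\<close> the frequency moment at unit time.\<close>
  define P where "P = C * exp c * 7 * Lm"
  have P: "0 \<le> P" using C Lm(2) by (simp add: P_def)
  let ?M = "L1_norm U0" and ?G = "L2_norm (weak_deriv (j + l) U0)"
  have E0: "0 \<le> E t" for t using c by (simp add: E_def)
  have pointwise: "\<xi> ^ (2 * j) * (norm (W \<xi> t))\<^sup>2 \<le>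
      C * exp c * (7 * ?M\<^sup>2) * (\<xi> ^ (2 * j) * exp (- c * \<xi> ^ 4 * (1 + t)))
      + C * E t * (\<xi> ^ (2 * (j + l)) * (norm (fourier U0 \<xi>))\<^sup>2)" if t: "t \<ge> 0" for \<xi> t
  proof -
    have ev: "0 \<le> \<xi> ^ (2 * (j + l)) * (norm (fourier U0 \<xi>))\<^sup>2"
      by (intro mult_nonneg_nonneg zero_le_even_power) auto
    have nn: "0 \<le> C * exp c * (7 * ?M\<^sup>2) * (\<xi> ^ (2 * j) * exp (- c * \<xi> ^ 4 * (1 + t)))"
      "0 \<le> C * E t * (\<xi> ^ (2 * (j + l)) * (norm (fourier U0 \<xi>))\<^sup>2)"
      using C E0[of t] mult_nonneg_nonneg[OF _ ev, of "C * E t"] by simp_all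
    show ?thesis
    proof (cases "\<bar>\<xi>\<bar> \<le> 1")
      case True
      have "\<xi> ^ 4 \<le> 1" using True power_le_one[of "\<bar>\<xi>\<bar>" 4] by simp
      \<comment> \<open>Replacing \<open>t\<close> by \<open>1 + t\<close> costs at most
        \<open>exp c\<close> because \<open>\<xi> ^ 4 \<le> 1\<close>, and keeps the moment integral
        finite at \<open>t = 0\<close>.\<close>
      then have "exp (- c * \<xi> ^ 4 * t) \<le> exp c * exp (- c * \<xi> ^ 4 * (1 + t))"
        using c by (simp add: algebra_simps flip: exp_add)
      then have "C * exp (- c * \<xi> ^ 4 * t) * (norm (fourier U0 \<xi>))\<^sup>2 \<le> C * (exp c * exp (- c * \<xi> ^ 4 * (1 + t))) * (7 * ?M\<^sup>2)"
        using C norm_fourier_le[OF assms(10), of \<xi>] by (intro mult_mono) auto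
      with Wdec[OF t, of \<xi>] True have "(norm (W \<xi> t))\<^sup>2 \<le> C * (exp c * exp (- c * \<xi> ^ 4 * (1 + t))) * (7 * ?M\<^sup>2)"
        by (simp add: decay_rate_def)
      then have "\<xi> ^ (2 * j) * (norm (W \<xi> t))\<^sup>2 \<le> \<xi> ^ (2 * j) * (C * (exp c * exp (- c * \<xi> ^ 4 * (1 + t))) * (7 * ?M\<^sup>2))"
        by (intro mult_left_mono) auto
      also have "\<dots> = C * exp c * (7 * ?M\<^sup>2) * (\<xi> ^ (2 * j) * exp (- c * \<xi> ^ 4 * (1 + t)))" by (simp only: mult_ac)
      finally show ?thesis using nn by linarith
    next
      case False
      have \<xi>jl: "\<xi> ^ (2 * (j + l)) = \<xi> ^ (2 * j) * \<xi> ^ (2 * l)" by (simp add: power_add distrib_left)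
      have "1 \<le> \<bar>\<xi>\<bar> ^ (2 * l)" using False by (intro one_le_power) simp
      then have "1 \<le> \<xi> ^ (2 * l)" by (simp add: power_mult)
      \<comment> \<open>For equal constants the factor \<open>\<xi> ^ (2 * l) \<ge> 1\<close> is
        merely inserted; otherwise it is the price of decay in time.\<close>
      then have "exp (- c * decay_rate ?e \<xi> * t) \<le> E t * \<xi> ^ (2 * l)"
        using False high_frequency_decay[OF c t, of \<xi> l] l by (simp add: decay_rate_def E_def)
      then have "C * exp (- c * decay_rate ?e \<xi> * t) * (norm (fourier U0 \<xi>))\<^sup>2 \<le> C * (E t * \<xi> ^ (2 * l)) * (norm (fourier U0 \<xi>))\<^sup>2"
        using C by (intro mult_right_mono mult_left_mono) auto
      with Wdec[OF t, of \<xi>] have "(norm (W \<xi> t))\<^sup>2 \<le> C * (E t * \<xi> ^ (2 * l)) * (norm (fourier U0 \<xi>))\<^sup>2"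
        by linarith
      then have "\<xi> ^ (2 * j) * (norm (W \<xi> t))\<^sup>2 \<le> \<xi> ^ (2 * j) * (C * (E t * \<xi> ^ (2 * l)) * (norm (fourier U0 \<xi>))\<^sup>2)"
        by (intro mult_left_mono) auto
      also have "\<dots> = C * E t * (\<xi> ^ (2 * (j + l)) * (norm (fourier U0 \<xi>))\<^sup>2)"
        unfolding \<xi>jl by (simp only: mult_ac)
      finally show ?thesis using nn by linarith
    qed
  qed
  have main: "(L2_norm (weak_deriv j (U t)))\<^sup>2 \<le> P * ((1 + t) powr (- 1 / 8 - real j / 4) * ?M)\<^sup>2 + C * (sqrt (E t) * ?G)\<^sup>2"
    if t: "t \<ge> 0" for t
  proof -
    have jN: "j \<le> N" using jl by simp
    let ?s = "(1 + t) powr (- (2 * real j + 1) / 4)"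
    have [measurable]: "(\<lambda>\<xi>. W \<xi> t) \<in> borel_measurable borel"
      using UW[OF t] by (simp add: has_L2_fourier_def in_L2_def)
    have "ennreal (2 * pi) * ennreal ((L2_norm (weak_deriv j (U t)))\<^sup>2) \<le> (\<integral>\<^sup>+\<xi>. ennreal (\<xi> ^ (2 * j) * (norm (W \<xi> t))\<^sup>2) \<partial>lborel)"
      by (rule weak_deriv_fourier_bound(2)[OF UW[OF t] fin[OF t jN]])
    also have "\<dots> \<le> (\<integral>\<^sup>+\<xi>. ennreal (C * exp c * (7 * ?M\<^sup>2)) * ennreal (\<xi> ^ (2 * j) * exp (- c * \<xi> ^ 4 * (1 + t)))
      + ennreal (C * E t) * ennreal (\<xi> ^ (2 * (j + l)) * (norm (fourier U0 \<xi>))\<^sup>2) \<partial>lborel)"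
    proof (intro nn_integral_mono)
      fix \<xi> :: real
      have ev: "0 \<le> \<xi> ^ (2 * (j + l)) * (norm (fourier U0 \<xi>))\<^sup>2"
        by (intro mult_nonneg_nonneg zero_le_even_power) auto
      have "ennreal (\<xi> ^ (2 * j) * (norm (W \<xi> t))\<^sup>2) \<le> ennreal (C * exp c * (7 * ?M\<^sup>2) * (\<xi> ^ (2 * j) * exp (- c * \<xi> ^ 4 * (1 + t)))
        + C * E t * (\<xi> ^ (2 * (j + l)) * (norm (fourier U0 \<xi>))\<^sup>2))"
        by (rule ennreal_leI[OF pointwise[OF t]])
      also have "\<dots> = ennreal (C * exp c * (7 * ?M\<^sup>2) * (\<xi> ^ (2 * j) * exp (- c * \<xi> ^ 4 * (1 + t))))
        + ennreal (C * E t * (\<xi> ^ (2 * (j + l)) * (norm (fourier U0 \<xi>))\<^sup>2))"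
        using C E0[of t] by (intro ennreal_plus mult_nonneg_nonneg ev) auto
      also have "\<dots> = ennreal (C * exp c * (7 * ?M\<^sup>2)) * ennreal (\<xi> ^ (2 * j) * exp (- c * \<xi> ^ 4 * (1 + t)))
      + ennreal (C * E t) * ennreal (\<xi> ^ (2 * (j + l)) * (norm (fourier U0 \<xi>))\<^sup>2)"
        using C E0[of t] by (intro arg_cong2[of _ _ _ _ "(+)"] ennreal_mult mult_nonneg_nonneg ev) auto
      finally show "ennreal (\<xi> ^ (2 * j) * (norm (W \<xi> t))\<^sup>2) \<le> \<dots>" .
    qed
    also have "\<dots> = ennreal (C * exp c * (7 * ?M\<^sup>2)) * (\<integral>\<^sup>+\<xi>. ennreal (\<xi> ^ (2 * j) * exp (- c * \<xi> ^ 4 * (1 + t))) \<partial>lborel)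
      + ennreal (C * E t) * I (j + l)"
      unfolding I_def by (subst nn_integral_add) (simp_all add: nn_integral_cmult)
    also have "(\<integral>\<^sup>+\<xi>. ennreal (\<xi> ^ (2 * j) * exp (- c * \<xi> ^ 4 * (1 + t))) \<partial>lborel) = ennreal ?s * ennreal Lm"
      using low_moment_scaled[of "1 + t" j c] t unfolding Lm(1) by simp
    also have "ennreal (C * exp c * (7 * ?M\<^sup>2)) * (ennreal ?s * ennreal Lm) + ennreal (C * E t) * I (j + l)
      \<le> ennreal (C * exp c * (7 * ?M\<^sup>2)) * (ennreal ?s * ennreal Lm) + ennreal (C * E t) * (ennreal (2 * pi) * ennreal (?G\<^sup>2))"
      by (intro add_left_mono mult_left_mono I jl) simp
    also have "\<dots> = ennreal (C * exp c * (7 * ?M\<^sup>2) * (?s * Lm) + C * E t * (2 * pi * ?G\<^sup>2))"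
      using C E0[of t] Lm(2) by (simp add: ennreal_mult ennreal_plus)
    finally have "ennreal (2 * pi * (L2_norm (weak_deriv j (U t)))\<^sup>2) \<le> ennreal (C * exp c * (7 * ?M\<^sup>2) * (?s * Lm) + C * E t * (2 * pi * ?G\<^sup>2))"
      by (simp add: ennreal_mult)
    then have "2 * pi * (L2_norm (weak_deriv j (U t)))\<^sup>2 \<le> C * exp c * (7 * ?M\<^sup>2) * (?s * Lm) + C * E t * (2 * pi * ?G\<^sup>2)"
      using C E0[of t] Lm(2) by (subst (asm) ennreal_le_iff) auto
    also have "\<dots> = P * (?s * ?M\<^sup>2) + 2 * pi * (C * (E t * ?G\<^sup>2))" by (simp add: P_def)
    \<comment> \<open>The bound for the datum carries the same factor \<open>2 * pi\<close> as the
      left side; the low frequency term lacks it and is enlarged so that the factor cancels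
      throughout.\<close>
    also have "\<dots> \<le> 2 * pi * (P * (?s * ?M\<^sup>2)) + 2 * pi * (C * (E t * ?G\<^sup>2))"
      using mult_right_mono[of 1 "2 * pi" "P * (?s * ?M\<^sup>2)"] P pi_gt3 by simp
    also have "\<dots> = 2 * pi * (P * (?s * ?M\<^sup>2) + C * (E t * ?G\<^sup>2))" by (simp add: distrib_left)
    finally have "(L2_norm (weak_deriv j (U t)))\<^sup>2 \<le> P * (?s * ?M\<^sup>2) + C * (E t * ?G\<^sup>2)"
      by simp
    moreover have "?s = ((1 + t) powr (- 1 / 8 - real j / 4))\<^sup>2"
    proof -
      have "- (2 * real j + 1) / 4 = (- 1 / 8 - real j / 4) + (- 1 / 8 - real j / 4)" by (simp add: field_simps)
      then show ?thesis unfolding power2_eq_square by (simp only: powr_add)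
    qed
    ultimately show ?thesis using E0[of t] by (simp add: power_mult_distrib)
  qed
  define c0 where "c0 = sqrt P + sqrt C * (1 + sqrt (exp c * (1 + (real l / c) ^ l))) + 1"
  have Kn: "0 \<le> (real l / c) ^ l" using c by simp
  have c0: "c0 > 0" "sqrt P \<le> c0" "sqrt C \<le> c0" "sqrt C * sqrt (exp c * (1 + (real l / c) ^ l)) \<le> c0"
    using P C Kn by (auto simp: c0_def distrib_left intro!: add_nonneg_pos add_nonneg_nonneg)
  have M0: "0 \<le> ?M" by (simp add: L1_norm_def)
  have G0: "0 \<le> ?G" by (rule L2_norm_nonneg)
  have est: "L2_norm (weak_deriv j (U t)) \<le> sqrt P * ((1 + t) powr (- 1 / 8 - real j / 4) * ?M) + sqrt C * (sqrt (E t) * ?G)"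
    if "t \<ge> 0" for t
    using main[OF that] P C M0 G0 E0[of t] by (intro le_of_square_le) auto
  have low: "sqrt P * ((1 + t) powr (- 1 / 8 - real j / 4) * ?M) \<le> c0 * (1 + t) powr (- 1 / 8 - real j / 4) * ?M" for t
    unfolding mult.assoc using c0(2) M0 by (intro mult_right_mono) auto
  show "\<exists>c0>0. \<exists>c1>0. \<forall>t\<ge>0.
    in_Sobolev j (U t) \<and>
    (k1 = k2 \<and> k2 = k3 \<longrightarrow>
      L2_norm (weak_deriv j (U t)) \<le>
        c0 * (1 + t) powr (- 1 / 8 - real j / 4) * L1_norm U0
        + c0 * exp (- c1 * t) * L2_norm (weak_deriv (j + l) U0)) \<and>
    (\<not> (k1 = k2 \<and> k2 = k3) \<longrightarrow>
      L2_norm (weak_deriv j (U t)) \<le>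
        c0 * (1 + t) powr (- 1 / 8 - real j / 4) * L1_norm U0
        + c0 * (1 + t) powr (- real l / 4) * L2_norm (weak_deriv (j + l) U0))"
  \<comment> \<open>The rate is \<open>c / 2\<close> because \<open>E\<close> bounds the square of
    the norm.\<close>
  proof (rule exI[of _ c0], intro conjI exI[of _ "c / 2"] allI impI)
    fix t :: real assume t: "t \<ge> 0"
    have "has_weak_deriv n (U t) (weak_deriv n (U t))" if "n \<le> j" for n
      using that jl by (intro weak_deriv_fourier_bound(1)[OF UW[OF t] fin[OF t]]) simp
    then show "in_Sobolev j (U t)" unfolding in_Sobolev_def by blast
  next
    fix t :: real assume t: "t \<ge> 0" and e: ?e
    have "sqrt (E t) = exp (- (c / 2) * t)"
      unfolding E_def if_P[OF e] by (rule real_sqrt_unique) (simp_all flip: exp_of_nat_mult)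
    then have "sqrt C * (sqrt (E t) * ?G) \<le> c0 * exp (- (c / 2) * t) * ?G"
      unfolding mult.assoc using c0(1,3) G0 by (intro mult_mono) auto
    with est[OF t] low[of t] show "L2_norm (weak_deriv j (U t)) \<le>
        c0 * (1 + t) powr (- 1 / 8 - real j / 4) * L1_norm U0 + c0 * exp (- (c / 2) * t) * ?G"
      by linarith
  next
    fix t :: real assume t: "t \<ge> 0" and e: "\<not> ?e"
    have "sqrt ((1 + t) powr (- real l / 2)) = (1 + t) powr (- real l / 4)"
      using t by (simp add: powr_half_sqrt[symmetric] powr_powr)
    then have "sqrt (E t) = sqrt (exp c * (1 + (real l / c) ^ l)) * (1 + t) powr (- real l / 4)"
      unfolding E_def if_not_P[OF e] by (simp only: real_sqrt_mult)
    then have "sqrt C * (sqrt (E t) * ?G) = sqrt C * sqrt (exp c * (1 + (real l / c) ^ l)) * ((1 + t) powr (- real l / 4) * ?G)"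
      by (simp only: mult.assoc)
    also have "\<dots> \<le> c0 * ((1 + t) powr (- real l / 4) * ?G)"
      using c0(4) G0 by (intro mult_right_mono) auto
    finally have "sqrt C * (sqrt (E t) * ?G) \<le> c0 * (1 + t) powr (- real l / 4) * ?G"
      by (simp only: mult.assoc)
    with est[OF t] low[of t] show "L2_norm (weak_deriv j (U t)) \<le>
        c0 * (1 + t) powr (- 1 / 8 - real j / 4) * L1_norm U0 + c0 * (1 + t) powr (- real l / 4) * ?G"
      by linarith
  qed (use c c0 in auto)
qed

end
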